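(* There exists a planar S-system having at least three limit cycles. More precisely, there exists a planar S-system that has at least two stable limit cycles and at least one unstable limit cycle.
   Context: A planar S-system is an ODE on the positive quadrant $\mathbb{R}^2_+=\{(x_1,x_2)\in\mathbb{R}^2 : x_1>0,\ x_2>0\}$ of the form $$\dot x_1=\alpha_1 x_1^{g_{11}}x_2^{g_{12}}-\beta_1 x_1^{h_{11}}x_2^{h_{12}},\qquad \dot x_2=\alpha_2 x_1^{g_{21}}x_2^{g_{22}}-\beta_2 x_1^{h_{21}}x_2^{h_{22}},$$ with $\alpha_1,\alpha_2,\beta_1,\beta_2>0$ and real exponents $g_{ij},h_{ij}\in\mathbb{R}$. A limit cycle is an isolated (nonconstant) periodic orbit; it is stable if it attracts nearby orbits from both sides. *)

theory Defs
  imports "HOL-Analysis.Analysis"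
begin

definition quadrant :: "(real \<times> real) set" where
  "quadrant = {(x1, x2). x1 > 0 \<and> x2 > 0}"

text \<open>The right-hand side is only meaningful on the quadrant: for negative or zero bases
  \<open>powr\<close> takes conventional values. All solutions below are confined to the quadrant.\<close>

definition s_field ::
  "real \<Rightarrow> real \<Rightarrow> real \<Rightarrow> real \<Rightarrow>
   real \<Rightarrow> real \<Rightarrow> real \<Rightarrow> real \<Rightarrow>
   real \<Rightarrow> real \<Rightarrow> real \<Rightarrow> real \<Rightarrow> real \<times> real \<Rightarrow> real \<times> real" where
  "s_field \<alpha>1 \<alpha>2 \<beta>1 \<beta>2 g11 g12 g21 g22 h11 h12 h21 h22 =
     (\<lambda>(x1, x2).
        (\<alpha>1 * x1 powr g11 * x2 powr g12 - \<beta>1 * x1 powr h11 * x2 powr h12,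
         \<alpha>2 * x1 powr g21 * x2 powr g22 - \<beta>2 * x1 powr h21 * x2 powr h22))"

definition planar_S_system :: "(real \<times> real \<Rightarrow> real \<times> real) \<Rightarrow> bool" where
  "planar_S_system F \<longleftrightarrow>
     (\<exists>\<alpha>1 \<alpha>2 \<beta>1 \<beta>2 g11 g12 g21 g22 h11 h12 h21 h22.
        \<alpha>1 > 0 \<and> \<alpha>2 > 0 \<and> \<beta>1 > 0 \<and> \<beta>2 > 0 \<and>
        F = s_field \<alpha>1 \<alpha>2 \<beta>1 \<beta>2 g11 g12 g21 g22 h11 h12 h21 h22)"

definition solution_on ::
  "(real \<times> real \<Rightarrow> real \<times> real) \<Rightarrow> real set \<Rightarrow> (real \<Rightarrow> real \<times> real) \<Rightarrow> bool" where
  "solution_on F I x \<longleftrightarrow>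
     (\<forall>t\<in>I. x t \<in> quadrant \<and> (x has_vector_derivative F (x t)) (at t within I))"

definition periodic_orbit ::
  "(real \<times> real \<Rightarrow> real \<times> real) \<Rightarrow> (real \<times> real) set \<Rightarrow> bool" where
  "periodic_orbit F \<Gamma> \<longleftrightarrow>
     (\<exists>x T. solution_on F UNIV x \<and> T > 0 \<and> (\<forall>t. x (t + T) = x t) \<and>
        (\<exists>s t. x s \<noteq> x t) \<and> \<Gamma> = range x)"

definition limit_cycle ::
  "(real \<times> real \<Rightarrow> real \<times> real) \<Rightarrow> (real \<times> real) set \<Rightarrow> bool" where
  "limit_cycle F \<Gamma> \<longleftrightarrow>
     periodic_orbit F \<Gamma> \<and>
     (\<exists>U. open U \<and> \<Gamma> \<subseteq> U \<and>
        (\<forall>\<Gamma>'. periodic_orbit F \<Gamma>' \<and> \<Gamma>' \<inter> U \<noteq> {} \<longrightarrow> \<Gamma>' = \<Gamma>))"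

text \<open>A neighbourhood of \<open>\<Gamma>\<close> in the plane contains points on both of its sides. Since an
  S-system is smooth on the quadrant, the solution through a given point is unique, so asking
  for some solution is the same as speaking of the solution; it also makes its existence for
  all positive (negative) times part of the requirement.\<close>

definition stable_limit_cycle ::
  "(real \<times> real \<Rightarrow> real \<times> real) \<Rightarrow> (real \<times> real) set \<Rightarrow> bool" where
  "stable_limit_cycle F \<Gamma> \<longleftrightarrow>
     limit_cycle F \<Gamma> \<and>
     (\<exists>U. open U \<and> \<Gamma> \<subseteq> U \<and>
        (\<forall>p\<in>U. \<exists>x. solution_on F {0..} x \<and> x 0 = p \<and>
           ((\<lambda>t. infdist (x t) \<Gamma>) \<longlongrightarrow> 0) at_top))"

text \<open>Unstable is understood as repelling on both sides, that is, attracting in backward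
  time; semistable limit cycles are neither stable nor unstable.\<close>

definition unstable_limit_cycle ::
  "(real \<times> real \<Rightarrow> real \<times> real) \<Rightarrow> (real \<times> real) set \<Rightarrow> bool" where
  "unstable_limit_cycle F \<Gamma> \<longleftrightarrow>
     limit_cycle F \<Gamma> \<and>
     (\<exists>U. open U \<and> \<Gamma> \<subseteq> U \<and>
        (\<forall>p\<in>U. \<exists>x. solution_on F {..0} x \<and> x 0 = p \<and>
           ((\<lambda>t. infdist (x t) \<Gamma>) \<longlongrightarrow> 0) at_bot))"

end

theory Submission
  imports Defs "HOL-Real_Asymp.Real_Asymp"
begin

text \<open>
For \<open>e = 0\<close> the S-system
\<open>x1' = x2 - x1 powr (- e)\<close>, \<open>x2' = K * (x2 powr (- c * e / K) - x1 ^ m)\<close>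
is a conservative oscillator: its energy is \<open>(x2 - 1)\<^sup>2 / 2 + K * V x1\<close> with
\<open>V z = (z ^ (m + 1) - 1) / (m + 1) - (z - 1)\<close>, and the point \<open>(1, 1)\<close> is surrounded by closed orbits,
labelled by \<open>r\<close>, the square root of twice the energy. For small \<open>e > 0\<close> the energy gained in one turn is
\<open>e * (A r - c * B r)\<close> up to higher order, where \<open>A\<close> and \<open>B\<close> are the integrals of
\<open>1 / x1\<close> and \<open>1 / x2\<close> over the region inside the orbit (the divergence of the perturbation). So limit
cycles appear where \<open>A / B\<close> takes the value \<open>c\<close> transversally, and they are stable where the ratio
decreases and unstable where it increases.

It remains to find a potential for which \<open>A / B\<close> crosses one level downwards, upwards and downwards
again (\<open>three_limit_cycles\<close>). The ratio tends to 1 at the equilibrium (\<open>ratio_tends_to_one\<close>), and an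
integration by parts shows that it is below 1 shortly afterwards if \<open>m + 1 < 2 * K * m\<close>
(\<open>ratio_below_one\<close>). As \<open>m\<close> grows, \<open>V\<close> turns into a linear slope \<open>1 - z\<close> that ends at a vertical wall at
\<open>z = 1\<close>. For the wall both integrals are elementary (\<open>wall_integral\<close>), and for the chosen \<open>K\<close>
slightly below 1 the ratio is above 1 at \<open>r = 1 / 10\<close> and below 1 at \<open>r = 49 / 50\<close>
(\<open>wall_value_small\<close>, \<open>wall_value_large\<close>). The dip near the equilibrium survives for every finite \<open>m\<close>
because it happens in a boundary layer at the wall, which
the limit does not see. A level slightly below 1 is then crossed three
times.

The step from simple zeros to limit cycles avoids flows and return maps in the plane. In coordinates
\<open>(\<theta>, r)\<close> in which the unperturbed orbits are circles, orbits are graphs of solutions of a scalar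
equation \<open>dr/d\<theta> = e * G e \<theta> r\<close> that is periodic in \<open>\<theta>\<close>, and \<open>periodic_averaging\<close> yields a periodic
solution that attracts its neighbours. Going back to the plane (\<open>averaged_stable_limit_cycle\<close>) needs only
a change of the time variable. Attraction implies isolation (\<open>attracting_periodic_orbit_stable\<close>), and
unstable cycles are stable cycles of the reversed field (\<open>stable_reverse_unstable\<close>).
\<close>

section \<open>Scalar differential equations\<close>

lemma continuous_real_antiderivative:
  fixes g :: "real \<Rightarrow> real"
  assumes "continuous_on UNIV g"
  obtains P where "P c = 0" "\<And>t. (P has_real_derivative g t) (at t)"
proof -
  have "\<exists>F. \<forall>x::real. -\<infinity> < ereal x \<longrightarrow> ereal x < \<infinity> \<longrightarrow> (F has_vector_derivative g x) (at x)"
    using assms by (intro einterval_antiderivative) (auto simp: continuous_on_eq_continuous_at)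
  then obtain F where F: "\<And>x. (F has_real_derivative g x) (at x)"
    by (auto simp: has_real_derivative_iff_has_vector_derivative)
  show ?thesis
    by (rule that[of "\<lambda>t. F t - F c"]) (auto intro!: derivative_eq_intros F)
qed

lemma abs_le_of_derivative_abs_le:
  fixes P Q :: "real \<Rightarrow> real"
  assumes P: "\<And>t. (P has_real_derivative p t) (at t)"
    and Q: "\<And>t. (Q has_real_derivative q t) (at t)"
    and le: "\<And>t. \<bar>p t\<bar> \<le> q t" and "P 0 = 0" "Q 0 = 0"
  shows "\<bar>P t\<bar> \<le> \<bar>Q t\<bar>"
proof -
  have "(\<lambda>t. Q t - P t) s \<le> (\<lambda>t. Q t - P t) u" if "s \<le> u" for s u
    using le by (intro DERIV_nonneg_imp_nondecreasing[OF that])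
      (auto simp: abs_le_iff intro!: exI derivative_eq_intros P Q)
  then have m1: "mono (\<lambda>t. Q t - P t)" by (intro monoI)
  have "(\<lambda>t. Q t + P t) s \<le> (\<lambda>t. Q t + P t) u" if "s \<le> u" for s u
  proof (intro DERIV_nonneg_imp_nondecreasing[OF that] exI conjI)
    fix t show "((\<lambda>t. Q t + P t) has_real_derivative q t + p t) (at t)"
      by (intro derivative_intros P Q)
    show "0 \<le> q t + p t" using le[of t] by (simp add: abs_le_iff)
  qed
  then have m2: "mono (\<lambda>t. Q t + P t)" by (intro monoI)
  show ?thesis
    using monoD[OF m1, of 0 t] monoD[OF m2, of 0 t] monoD[OF m1, of t 0] monoD[OF m2, of t 0] assms(4,5)
    by (cases "0 \<le> t") auto
qed

lemma abs_sinh_le_cosh: "\<bar>sinh x\<bar> \<le> cosh (x::real)"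
proof -
  have "cosh x + sinh x > 0" "cosh x - sinh x > 0" unfolding cosh_plus_sinh cosh_minus_sinh by auto
  then show ?thesis by (simp add: abs_le_iff)
qed

text \<open>The Picard operator is a contraction on all of the line at once when functions are measured
  relative to the weight \<open>cosh (2 * L * t)\<close>, because a primitive of the weight is at most the weight
  divided by \<open>2 * L\<close>.\<close>

lemma global_solution_at_0:
  fixes f :: "real \<Rightarrow> real \<Rightarrow> real"
  assumes cont: "continuous_on UNIV (\<lambda>(t, x). f t x)" and L: "L > 0"
    and lip: "\<And>t x y. \<bar>f t x - f t y\<bar> \<le> L * \<bar>x - y\<bar>" and B: "\<And>t. \<bar>f t 0\<bar> \<le> B"
  shows "\<exists>x. x 0 = x0 \<and> (\<forall>t. (x has_real_derivative f t (x t)) (at t))"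
proof -
  define W where "W t = cosh (2 * L * t)" for t
  have W: "W t \<ge> 1" for t unfolding W_def by (simp add: cosh_real_ge_1)
  have Wc: "continuous_on UNIV W" unfolding W_def by (intro continuous_intros)
  have fc: "continuous_on UNIV (\<lambda>t. f t (x t))" if "continuous_on UNIV x" for x :: "real \<Rightarrow> real"
    using continuous_on_compose2[OF cont, of UNIV "\<lambda>t. (t, x t)"] that by (simp add: continuous_on_Pair)
  define P where "P g = (SOME P. P 0 = 0 \<and> (\<forall>t. (P has_real_derivative g t) (at t)))"
    for g :: "real \<Rightarrow> real"
  have P: "P g 0 = 0 \<and> (\<forall>t. (P g has_real_derivative g t) (at t))" if "continuous_on UNIV g" for g
  proof -
    have "\<exists>P. P 0 = 0 \<and> (\<forall>t. (P has_real_derivative g t) (at t))"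
      using continuous_real_antiderivative[OF that, of 0] by blast
    then show ?thesis unfolding P_def by (rule someI_ex)
  qed
  have Pbound: "\<bar>P g t - P h t\<bar> \<le> d / (2 * L) * W t"
    if "continuous_on UNIV g" "continuous_on UNIV h" "\<And>t. \<bar>g t - h t\<bar> \<le> d * W t" for g h d t
  proof -
    have "\<bar>P g t - P h t\<bar> \<le> \<bar>d / (2 * L) * sinh (2 * L * t)\<bar>"
    proof (rule abs_le_of_derivative_abs_le[where P = "\<lambda>t. P g t - P h t"
            and Q = "\<lambda>t. d / (2 * L) * sinh (2 * L * t)"])
      fix t
      show "((\<lambda>t. P g t - P h t) has_real_derivative g t - h t) (at t)"
        using P[OF that(1)] P[OF that(2)] by (intro derivative_intros) auto
      show "((\<lambda>t. d / (2 * L) * sinh (2 * L * t)) has_real_derivative d * W t) (at t)"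
        using L by (auto intro!: derivative_eq_intros simp: W_def)
      show "\<bar>g t - h t\<bar> \<le> d * W t" by (rule that(3))
    qed (use P[OF that(1)] P[OF that(2)] in auto)
    also have "\<dots> = \<bar>d\<bar> / (2 * L) * \<bar>sinh (2 * L * t)\<bar>" using L by (simp add: abs_mult)
    also have "\<bar>d\<bar> = d" using that(3)[of 0] by (simp add: W_def)
    also have "d / (2 * L) * \<bar>sinh (2 * L * t)\<bar> \<le> d / (2 * L) * W t"
      unfolding W_def using L \<open>\<bar>d\<bar> = d\<close> by (intro mult_left_mono abs_sinh_le_cosh) auto
    finally show ?thesis .
  qed
  define T where "T \<psi> = (\<lambda>t. (x0 + P (\<lambda>s. f s (W s * \<psi> s)) t) / W t)" for \<psi>
  have gc: "continuous_on UNIV (\<lambda>s. f s (W s * apply_bcontfun \<psi> s))" for \<psi>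
    by (intro fc continuous_intros Wc continuous_on_apply_bcontfun)
  have fb: "\<bar>f t (W t * apply_bcontfun \<psi> t)\<bar> \<le> (B + L * norm \<psi>) * W t" for t \<psi>
  proof -
    have "\<bar>f t (W t * \<psi> t)\<bar> \<le> B + L * \<bar>W t * \<psi> t\<bar>" using lip[of t "W t * \<psi> t" 0] B[of t] by simp
    also have "\<dots> \<le> B * W t + L * (W t * norm \<psi>)"
    proof (intro add_mono mult_left_mono)
      have "0 \<le> B" using B[of t] by linarith
      then show "B \<le> B * W t" using W[of t] mult_left_mono[of 1 "W t" B] by simp
      show "\<bar>W t * \<psi> t\<bar> \<le> W t * norm \<psi>"
        using W[of t] norm_bounded[of \<psi> t] by (simp add: abs_mult mult_left_mono)
    qed (use L in auto)
    finally show ?thesis by (simp add: algebra_simps)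
  qed
  have TB: "T (apply_bcontfun \<psi>) \<in> bcontfun" for \<psi>
  proof -
    let ?g = "\<lambda>s. f s (W s * apply_bcontfun \<psi> s)"
    have c: "continuous_on UNIV (T \<psi>)"
    proof -
      have "continuous_on UNIV (P ?g)"
        using P[OF gc[of \<psi>]] by (intro DERIV_continuous_on[of _ _ ?g]) simp
      moreover have "\<forall>t\<in>UNIV. W t \<noteq> 0" using W[THEN less_le_trans[OF zero_less_one]] by (simp add: less_imp_neq[THEN not_sym])
      ultimately show ?thesis unfolding T_def by (intro continuous_intros Wc)
    qed
    have "P (\<lambda>s. 0) t = 0" for t
    proof -
      have *: "P (\<lambda>s. 0) 0 = 0 \<and> (\<forall>t. (P (\<lambda>s. 0) has_real_derivative 0) (at t))"
        by (intro P continuous_on_const)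
      then show ?thesis using DERIV_isconst_all[of "P (\<lambda>s. 0)" t 0] by simp
    qed
    moreover have "\<bar>P ?g t - P (\<lambda>s. 0) t\<bar> \<le> (B + L * norm \<psi>) / (2 * L) * W t" for t
      by (rule Pbound) (use fb[of _ \<psi>] gc[of \<psi>] in \<open>simp_all only: diff_zero continuous_on_const\<close>)
    ultimately have pb: "\<bar>P ?g t\<bar> \<le> (B + L * norm \<psi>) / (2 * L) * W t" for t
      by (simp only: diff_zero)
    define C where "C = (B + L * norm \<psi>) / (2 * L)"
    have "norm (T \<psi> t) \<le> \<bar>x0\<bar> + C" for t
    proof -
      have "\<bar>x0\<bar> * 1 \<le> \<bar>x0\<bar> * W t" using W by (intro mult_left_mono) auto
      then have "\<bar>x0 + P ?g t\<bar> \<le> (\<bar>x0\<bar> + C) * W t"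
        using pb[of t] unfolding C_def[symmetric] distrib_right by linarith
      moreover have "norm (T \<psi> t) = \<bar>x0 + P ?g t\<bar> / W t"
        using W[of t] by (simp add: T_def)
      ultimately show ?thesis using W[of t] by (simp only: pos_divide_le_eq[OF less_le_trans[OF zero_less_one W]])
    qed
    then have "bounded (range (T \<psi>))" by (intro boundedI[of _ "\<bar>x0\<bar> + C"]) blast
    then show ?thesis unfolding bcontfun_def using c by (intro CollectI conjI)
  qed
  define TT where "TT \<psi> = Bcontfun (T (apply_bcontfun \<psi>))" for \<psi>
  have TT: "apply_bcontfun (TT \<psi>) = T (apply_bcontfun \<psi>)" for \<psi>
    unfolding TT_def by (rule Bcontfun_inverse[OF TB])
  have "dist (TT \<psi>) (TT \<phi>) \<le> 1/2 * dist \<psi> \<phi>" for \<psi> \<phi>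
  proof (rule dist_bound)
    fix t
    have "\<bar>f s (W s * \<psi> s) - f s (W s * \<phi> s)\<bar> \<le> (L * dist \<psi> \<phi>) * W s" for s
    proof -
      have "\<bar>f s (W s * \<psi> s) - f s (W s * \<phi> s)\<bar> \<le> L * \<bar>W s * \<psi> s - W s * \<phi> s\<bar>" by (rule lip)
      also have "\<bar>W s * \<psi> s - W s * \<phi> s\<bar> = W s * dist (\<psi> s) (\<phi> s)"
        using W[of s] by (simp add: dist_real_def abs_mult flip: right_diff_distrib)
      also have "L * (W s * dist (\<psi> s) (\<phi> s)) \<le> L * (W s * dist \<psi> \<phi>)"
        using L W[of s] dist_bounded[of \<psi> s \<phi>] by (intro mult_left_mono) auto
      finally show ?thesis by (simp add: mult_ac)
    qed
    from Pbound[OF gc[of \<psi>] gc[of \<phi>] this, of t]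
    have "\<bar>P (\<lambda>s. f s (W s * \<psi> s)) t - P (\<lambda>s. f s (W s * \<phi> s)) t\<bar> \<le> dist \<psi> \<phi> / 2 * W t"
      using L by simp
    then show "dist (TT \<psi> t) (TT \<phi> t) \<le> 1/2 * dist \<psi> \<phi>"
      unfolding TT T_def dist_real_def using W[of t]
      by (simp add: abs_divide divide_le_eq flip: diff_divide_distrib)
  qed
  then obtain \<psi> where fp: "TT \<psi> = \<psi>"
    using ex1_implies_ex[OF banach_fix_type[of "1/2" TT]] by auto
  define x where "x = (\<lambda>t. x0 + P (\<lambda>s. f s (W s * \<psi> s)) t)"
  have x: "W t * \<psi> t = x t" for t
    using fun_cong[OF TT[of \<psi>], of t] W[of t] unfolding fp x_def T_def by (simp add: field_simps)
  have "(x has_real_derivative f t (W t * \<psi> t)) (at t)" for t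
    unfolding x_def using P[OF gc[of \<psi>]] by (auto intro!: derivative_eq_intros)
  then have "(x has_real_derivative f t (x t)) (at t)" for t unfolding x .
  moreover have "x 0 = x0" using P[OF gc[of \<psi>]] by (simp add: x_def)
  ultimately show ?thesis by blast
qed

lemma global_solution:
  fixes f :: "real \<Rightarrow> real \<Rightarrow> real"
  assumes cont: "continuous_on UNIV (\<lambda>(t, x). f t x)" and L: "L > 0"
    and lip: "\<And>t x y. \<bar>f t x - f t y\<bar> \<le> L * \<bar>x - y\<bar>" and B: "\<And>t. \<bar>f t 0\<bar> \<le> B"
  obtains x where "x t0 = x0" "\<And>t. (x has_real_derivative f t (x t)) (at t)"
proof -
  have c: "continuous_on UNIV (\<lambda>(t, x). f (t + t0) x)"
    using continuous_on_compose2[OF cont, of UNIV "\<lambda>p. (fst p + t0, snd p)"]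
    by (simp add: split_beta continuous_intros)
  obtain x where x: "x 0 = x0" "\<And>t. (x has_real_derivative f (t + t0) (x t)) (at t)"
    using global_solution_at_0[OF c L lip B] by blast
  have "((\<lambda>t. x (t + - t0)) has_real_derivative f t (x (t + - t0))) (at t)" for t
    using x(2)[of "t + - t0"] DERIV_shift[of x "f t (x (t + - t0))" t "- t0"] by simp
  then show ?thesis using x(1) by (intro that[of "\<lambda>t. x (t + - t0)"]) auto
qed

text \<open>Gronwall's inequality for the square of \<open>w\<close>; \<open>\<alpha>\<close> may be negative, which is the case of interest.\<close>

lemma abs_le_exp_growth:
  fixes w A :: "real \<Rightarrow> real"
  assumes w: "\<And>t. t0 \<le> t \<Longrightarrow> (w has_real_derivative w' t) (at t)"
    and A: "\<And>t. t0 \<le> t \<Longrightarrow> (A has_real_derivative \<alpha> t) (at t)"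
    and le: "\<And>t. t0 \<le> t \<Longrightarrow> w t * w' t \<le> \<alpha> t * (w t)\<^sup>2" and "t0 \<le> t"
  shows "\<bar>w t\<bar> \<le> \<bar>w t0\<bar> * exp (A t - A t0)"
proof -
  define V where "V = (\<lambda>t. (w t)\<^sup>2 * exp (- 2 * A t))"
  have "V t \<le> V t0"
  proof (rule DERIV_nonpos_imp_nonincreasing[OF \<open>t0 \<le> t\<close>])
    fix s assume s: "t0 \<le> s" "s \<le> t"
    have "(V has_real_derivative 2 * exp (- 2 * A s) * (w s * w' s - \<alpha> s * (w s)\<^sup>2)) (at s)"
      unfolding V_def by (auto intro!: derivative_eq_intros w A s simp: algebra_simps power2_eq_square)
    moreover have "2 * exp (- 2 * A s) * (w s * w' s - \<alpha> s * (w s)\<^sup>2) \<le> 0"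
      using le[OF s(1)] by (intro mult_nonneg_nonpos) auto
    ultimately show "\<exists>y. (V has_real_derivative y) (at s) \<and> y \<le> 0" by blast
  qed
  then have "V t * exp (2 * A t) \<le> V t0 * exp (2 * A t)" by simp
  then have "(w t)\<^sup>2 \<le> (w t0)\<^sup>2 * (exp (- 2 * A t0) * exp (2 * A t))"
    by (simp add: V_def mult.assoc flip: exp_add)
  also have "\<dots> = (\<bar>w t0\<bar> * exp (A t - A t0))\<^sup>2"
    by (simp add: power_mult_distrib power2_eq_square algebra_simps flip: exp_add)
  finally show ?thesis by (simp add: abs_le_square_iff[symmetric] abs_mult)
qed

lemma lipschitz_ode_unique_forward:
  fixes f :: "real \<Rightarrow> real \<Rightarrow> real"
  assumes lip: "\<And>t x y. \<bar>f t x - f t y\<bar> \<le> L * \<bar>x - y\<bar>"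
    and x: "\<And>t. (x has_real_derivative f t (x t)) (at t)"
    and y: "\<And>t. (y has_real_derivative f t (y t)) (at t)" and eq: "x t0 = y t0"
    and True: "t0 \<le> t"
  shows "x t = y t"
proof -
  have "\<bar>x t - y t\<bar> \<le> \<bar>x t0 - y t0\<bar> * exp (L * t - L * t0)"
  proof (rule abs_le_exp_growth[OF _ _ _ True, where w' = "\<lambda>t. f t (x t) - f t (y t)" and \<alpha> = "\<lambda>_. L"])
    fix t
    show "((\<lambda>t. x t - y t) has_real_derivative f t (x t) - f t (y t)) (at t)"
      by (intro derivative_intros x y)
    show "((*) L has_real_derivative L) (at t)" by (auto intro!: derivative_eq_intros)
    have "(x t - y t) * (f t (x t) - f t (y t)) \<le> \<bar>x t - y t\<bar> * \<bar>f t (x t) - f t (y t)\<bar>"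
      by (metis abs_ge_self abs_mult)
    also have "\<dots> \<le> \<bar>x t - y t\<bar> * (L * \<bar>x t - y t\<bar>)" by (intro mult_left_mono lip) auto
    finally show "(x t - y t) * (f t (x t) - f t (y t)) \<le> L * (x t - y t)\<^sup>2"
      by (simp add: power2_eq_square mult.left_commute)
  qed
  then show ?thesis using eq by simp
qed

text \<open>Backward uniqueness is forward uniqueness for the equation reflected in \<open>t\<close>.\<close>

lemma lipschitz_ode_unique:
  fixes f :: "real \<Rightarrow> real \<Rightarrow> real"
  assumes lip: "\<And>t x y. \<bar>f t x - f t y\<bar> \<le> L * \<bar>x - y\<bar>"
    and x: "\<And>t. (x has_real_derivative f t (x t)) (at t)"
    and y: "\<And>t. (y has_real_derivative f t (y t)) (at t)" and eq: "x t0 = y t0"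
  shows "x t = y t"
proof (cases "t0 \<le> t")
  case True
  then show ?thesis using lipschitz_ode_unique_forward[OF lip x y eq] by simp
next
  case False
  have "(\<lambda>t. x (- t)) (- t) = (\<lambda>t. y (- t)) (- t)"
  proof (rule lipschitz_ode_unique_forward[where x = "\<lambda>t. x (- t)" and y = "\<lambda>t. y (- t)" and t = "- t" and f = "\<lambda>t x. - f (- t) x" and ?t0.0 = "- t0" and L = L])
    fix s
    show "((\<lambda>t. x (- t)) has_real_derivative - f (- s) (x (- s))) (at s)"
      "((\<lambda>t. y (- t)) has_real_derivative - f (- s) (y (- s))) (at s)"
      using x[of "-s"] y[of "-s"] by (simp_all add: DERIV_mirror)
    show "\<bar>- f (- s) u - - f (- s) v\<bar> \<le> L * \<bar>u - v\<bar>" for u v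
      using lip[of "-s" u v] by (simp add: abs_minus_commute)
  qed (use False eq in auto)
  then show ?thesis by simp
qed

lemma periodic_int_shift:
  assumes "\<And>x. f (x + \<omega>) = f (x::real)"
  shows "f (x + of_int k * \<omega>) = f x"
proof -
  have n: "f (y + of_nat n * \<omega>) = f y" for y n
    by (induction n) (auto simp: algebra_simps, metis add.assoc add.commute assms)
  show ?thesis
  proof (cases "k \<ge> 0")
    case True
    then show ?thesis using n[of x "nat k"] by (simp add: of_nat_nat)
  next
    case False
    then show ?thesis using n[of "x + of_int k * \<omega>" "nat (-k)"] by (simp add: of_nat_nat)
  qed
qed

lemma periodic_representative:
  assumes "\<omega> > 0"
  obtains k where "x + of_int k * \<omega> \<in> {0..(\<omega>::real)}"
proof -
  have "of_int \<lfloor>x / \<omega>\<rfloor> \<le> x / \<omega>" "x / \<omega> \<le> of_int \<lfloor>x / \<omega>\<rfloor> + 1" by linarith+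
  then have "of_int \<lfloor>x / \<omega>\<rfloor> * \<omega> \<le> x" "x \<le> (of_int \<lfloor>x / \<omega>\<rfloor> + 1) * \<omega>"
    by (simp_all only: pos_le_divide_eq[OF assms] pos_divide_le_eq[OF assms])
  then show ?thesis by (intro that[of "- \<lfloor>x / \<omega>\<rfloor>"]) (auto simp: algebra_simps)
qed

lemma periodic_reduce:
  assumes per: "\<And>x. f (x + \<omega>) = f (x::real)" and "\<omega> > 0"
  obtains y where "y \<in> {0..\<omega>}" "f x = f y"
  using periodic_representative[OF assms(2), of x] periodic_int_shift[of f \<omega> x, OF per] by metis

lemma continuous_periodic_bounded:
  fixes f :: "real \<Rightarrow> real"
  assumes "\<And>x. f (x + \<omega>) = f x" "\<omega> > 0" "continuous_on UNIV f"
  obtains C where "C > 0" "\<And>x. \<bar>f x\<bar> \<le> C"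
proof -
  have "compact (f ` {0..\<omega>})"
    by (intro compact_continuous_image continuous_on_subset[OF assms(3)]) auto
  then obtain C where "C > 0" "\<forall>y\<in>f ` {0..\<omega>}. norm y \<le> C"
    using compact_imp_bounded bounded_pos by metis
  then show ?thesis
    using that[of C] periodic_reduce[of f, OF assms(1,2)] by (metis image_eqI real_norm_def)
qed

text \<open>A primitive of a periodic function is periodic up to a linear drift, whose rate is the mean.\<close>

lemma antiderivative_increment:
  fixes P f :: "real \<Rightarrow> real"
  assumes P: "\<And>t. (P has_real_derivative f t) (at t)" and per: "\<And>x. f (x + \<omega>) = f x" and "\<omega> > 0"
  shows "P (t + \<omega>) = P t + integral {0..\<omega>} f"
proof -
  have "((\<lambda>t. P (t + \<omega>) - P t) has_real_derivative 0) (at t)" for t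
    using P[of t] DERIV_shift[of P "f (t + \<omega>)" t \<omega>] P[of "t + \<omega>"] per[of t]
    by (auto intro!: derivative_eq_intros)
  then have "P (t + \<omega>) - P t = P (0 + \<omega>) - P 0" using DERIV_isconst_all by blast
  moreover have "(f has_integral (P \<omega> - P 0)) {0..\<omega>}"
    using \<open>\<omega> > 0\<close> P by (intro fundamental_theorem_of_calculus)
      (auto simp: has_real_derivative_iff_has_vector_derivative[symmetric] intro: has_field_derivative_at_within)
  ultimately show ?thesis by (simp add: integral_unique)
qed

section \<open>Averaging for periodic scalar equations\<close>

text \<open>By periodicity the angle ranges over a compact set, so continuity is uniform in it.\<close>

lemma periodic_family_uniform:
  fixes G :: "real \<Rightarrow> real \<Rightarrow> real \<Rightarrow> real"
  assumes cont: "continuous_on ({0..e1} \<times> UNIV \<times> {a..b}) (\<lambda>(e, \<theta>, r). G e \<theta> r)"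
    and per: "\<And>e \<theta> r. G e (\<theta> + \<omega>) r = G e \<theta> r" and "\<omega> > 0" and r0: "r0 \<in> {a..b}" and "\<nu> > 0" "0 \<le> e1"
  obtains \<delta> where "\<delta> > 0" "\<And>e r \<theta>. \<lbrakk>e \<in> {0..e1}; e < \<delta>; r \<in> {a..b}; \<bar>r - r0\<bar> < \<delta>\<rbrakk> \<Longrightarrow> \<bar>G e \<theta> r - G 0 \<theta> r0\<bar> < \<nu>"
proof -
  let ?K = "{0..e1} \<times> {0..\<omega>} \<times> {a..b}"
  have "uniformly_continuous_on ?K (\<lambda>(e, \<theta>, r). G e \<theta> r)"
    by (intro compact_uniformly_continuous continuous_on_subset[OF cont] compact_Times) auto
  then obtain d where d: "d > 0" "\<And>p q. \<lbrakk>p \<in> ?K; q \<in> ?K; dist q p < d\<rbrakk> \<Longrightarrow>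
      dist ((\<lambda>(e, \<theta>, r). G e \<theta> r) q) ((\<lambda>(e, \<theta>, r). G e \<theta> r) p) < \<nu>"
    using \<open>\<nu> > 0\<close> unfolding uniformly_continuous_on_def by meson
  show ?thesis
  proof (rule that[of "d / 2"])
    fix e r \<theta> assume *: "e \<in> {0..e1}" "e < d / 2" "r \<in> {a..b}" "\<bar>r - r0\<bar> < d / 2"
    obtain k where k: "\<theta> + of_int k * \<omega> \<in> {0..\<omega>}" using periodic_representative[OF \<open>\<omega> > 0\<close>] .
    let ?t = "\<theta> + of_int k * \<omega>"
    have G: "G e \<theta> r = G e ?t r" for e r
      using periodic_int_shift[of "\<lambda>\<theta>. G e \<theta> r" \<omega> \<theta> k] per by simp
    have "dist (e, ?t, r) (0, ?t, r0) \<le> dist e 0 + (dist ?t ?t + dist r r0)"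
      unfolding dist_Pair_Pair by (rule order_trans[OF sqrt_sum_squares_le_sum]) (auto intro!: sqrt_sum_squares_le_sum)
    also have "\<dots> < d" using * by (simp add: dist_real_def)
    finally have "dist (G e ?t r) (G 0 ?t r0) < \<nu>"
      using d(2)[of "(0, ?t, r0)" "(e, ?t, r)"] * k r0 \<open>0 \<le> e1\<close> by simp
    then show "\<bar>G e \<theta> r - G 0 \<theta> r0\<bar> < \<nu>" using G by (simp add: dist_real_def)
  qed (use d in auto)
qed

lemma periodic_family_bounded:
  fixes G :: "real \<Rightarrow> real \<Rightarrow> real \<Rightarrow> real"
  assumes cont: "continuous_on ({0..e1} \<times> UNIV \<times> {a..b}) (\<lambda>(e, \<theta>, r). G e \<theta> r)"
    and per: "\<And>e \<theta> r. G e (\<theta> + \<omega>) r = G e \<theta> r" and "\<omega> > 0"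
  obtains B where "B > 0" "\<And>e r \<theta>. \<lbrakk>e \<in> {0..e1}; r \<in> {a..b}\<rbrakk> \<Longrightarrow> \<bar>G e \<theta> r\<bar> \<le> B"
proof -
  let ?K = "{0..e1} \<times> {0..\<omega>} \<times> {a..b}"
  have "compact ((\<lambda>(e, \<theta>, r). G e \<theta> r) ` ?K)"
    by (intro compact_continuous_image continuous_on_subset[OF cont] compact_Times) auto
  then obtain B where B: "B > 0" "\<And>y. y \<in> (\<lambda>(e, \<theta>, r). G e \<theta> r) ` ?K \<Longrightarrow> norm y \<le> B"
    using compact_imp_bounded bounded_pos by metis
  have "\<bar>G e \<theta> r\<bar> \<le> B" if "e \<in> {0..e1}" "r \<in> {a..b}" for e r \<theta>
  proof -
    obtain k where k: "\<theta> + of_int k * \<omega> \<in> {0..\<omega>}" using periodic_representative[OF \<open>\<omega> > 0\<close>] .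
    have "G e \<theta> r = G e (\<theta> + of_int k * \<omega>) r"
      using periodic_int_shift[of "\<lambda>\<theta>. G e \<theta> r" \<omega> \<theta> k] per by simp
    also have "\<bar>\<dots>\<bar> \<le> B"
      using B(2)[OF image_eqI[of _ _ "(e, \<theta> + of_int k * \<omega>, r)"]] that k by simp
    finally show ?thesis .
  qed
  then show ?thesis using B(1) that by blast
qed

text \<open>Clamping the radial variable and continuing linearly with slope \<open>d\<close> keeps the
  one-sided Lipschitz bound, and makes all solutions global.\<close>

definition clamp_extend :: "real \<Rightarrow> real \<Rightarrow> real \<Rightarrow> (real \<Rightarrow> real) \<Rightarrow> real \<Rightarrow> real" where
  "clamp_extend lo hi d g r = g (max lo (min hi r)) + d * (r - max lo (min hi r))"

lemma clamp_extend_bounds: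
  assumes "lo \<le> hi"
    and der: "\<And>r. r \<in> {lo..hi} \<Longrightarrow> (g has_real_derivative g' r) (at r within {lo..hi})"
    and up: "\<And>r. r \<in> {lo..hi} \<Longrightarrow> g' r \<le> \<alpha>" "d \<le> \<alpha>"
    and L: "\<And>r. r \<in> {lo..hi} \<Longrightarrow> \<bar>g' r\<bar> \<le> L" "\<bar>d\<bar> \<le> L"
  shows "(clamp_extend lo hi d g r - clamp_extend lo hi d g s) * (r - s) \<le> \<alpha> * (r - s)\<^sup>2"
    and "\<bar>clamp_extend lo hi d g r - clamp_extend lo hi d g s\<bar> \<le> L * \<bar>r - s\<bar>"
proof -
  have mvt: "\<exists>\<xi>\<in>{lo..hi}. g v - g u = (v - u) * g' \<xi>" if "u \<in> {lo..hi}" "v \<in> {lo..hi}" "u \<le> v" for u v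
  proof (cases "u = v")
    case False
    have "(g has_real_derivative g' x) (at x)" if "u < x" "x < v" for x
      using der[of x] that \<open>u \<in> _\<close> \<open>v \<in> _\<close> by (auto simp: at_within_Icc_at)
    moreover have "continuous_on {u..v} g"
      by (rule continuous_on_subset[of "{lo..hi}"]) (use that DERIV_continuous_on[of "{lo..hi}" g g', OF der] in auto)
    ultimately obtain x where "u < x" "x < v" "g v - g u = g' x * (v - u)"
      using mvt[of u v g "\<lambda>x. (*) (g' x)"] False \<open>u \<le> v\<close>
      by (auto simp: has_field_derivative_def)
    then show ?thesis using that by (intro bexI[of _ x]) (auto simp: mult.commute)
  qed (use that in auto)
  define c where "c r = max lo (min hi r)" for r
  have c: "c r \<in> {lo..hi}" for r using \<open>lo \<le> hi\<close> by (auto simp: c_def)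
  have main: "clamp_extend lo hi d g v - clamp_extend lo hi d g u \<le> \<alpha> * (v - u) \<and>
        \<bar>clamp_extend lo hi d g v - clamp_extend lo hi d g u\<bar> \<le> L * (v - u)" if "u \<le> v" for u v
  proof -
    have m: "c u \<le> c v" "u - c u \<le> v - c v" using that \<open>lo \<le> hi\<close> by (auto simp: c_def max_def min_def)
    obtain \<xi> where \<xi>: "\<xi> \<in> {lo..hi}" "g (c v) - g (c u) = (c v - c u) * g' \<xi>"
      using mvt[OF c c m(1)] by blast
    have eq: "clamp_extend lo hi d g v - clamp_extend lo hi d g u
        = (c v - c u) * g' \<xi> + ((v - c v) - (u - c u)) * d"
      using \<xi>(2) unfolding clamp_extend_def c_def[symmetric] by (simp add: algebra_simps)
    have "(c v - c u) * g' \<xi> \<le> (c v - c u) * \<alpha>" "((v - c v) - (u - c u)) * d \<le> ((v - c v) - (u - c u)) * \<alpha>"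
      using m up \<xi>(1) by (intro mult_left_mono; simp)+
    moreover have "\<bar>(c v - c u) * g' \<xi>\<bar> \<le> (c v - c u) * L" "\<bar>((v - c v) - (u - c u)) * d\<bar> \<le> ((v - c v) - (u - c u)) * L"
      unfolding abs_mult using m L \<xi>(1) by (auto intro!: mult_mono)
    ultimately show ?thesis unfolding eq by (auto simp: algebra_simps abs_le_iff)
  qed
  show "\<bar>clamp_extend lo hi d g r - clamp_extend lo hi d g s\<bar> \<le> L * \<bar>r - s\<bar>"
    using main[of r s] main[of s r] by (cases "r \<le> s") (auto simp: abs_minus_commute)
  show "(clamp_extend lo hi d g r - clamp_extend lo hi d g s) * (r - s) \<le> \<alpha> * (r - s)\<^sup>2"
  proof (cases "s \<le> r")
    case True
    then have "(clamp_extend lo hi d g r - clamp_extend lo hi d g s) * (r - s) \<le> (\<alpha> * (r - s)) * (r - s)"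
      using main by (intro mult_right_mono) auto
    then show ?thesis by (simp add: power2_eq_square)
  next
    case False
    then have "(clamp_extend lo hi d g s - clamp_extend lo hi d g r) * (s - r) \<le> (\<alpha> * (s - r)) * (s - r)"
      using main by (intro mult_right_mono) auto
    then show ?thesis by (simp add: power2_eq_square algebra_simps)
  qed
qed

text \<open>The solutions stay near \<open>r0\<close>, but this would have to be known before the equation can be
  linearised there. Clamping the radial variable removes the circularity: the extended equation contracts
  everywhere, at the rate given by the mean of \<open>D\<close> at \<open>r0\<close>. Hence its map over one period has a
  fixed point, the periodic solution, which attracts all others; and only afterwards is it shown that
  this solution, and those which start close to it, do not notice the clamping.\<close>

theorem periodic_averaging:
  fixes G D :: "real \<Rightarrow> real \<Rightarrow> real \<Rightarrow> real"
  assumes contG: "continuous_on ({0..e1} \<times> UNIV \<times> {a..b}) (\<lambda>(e, \<theta>, r). G e \<theta> r)"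
    and contD: "continuous_on ({0..e1} \<times> UNIV \<times> {a..b}) (\<lambda>(e, \<theta>, r). D e \<theta> r)"
    and der: "\<And>e \<theta> r. \<lbrakk>e \<in> {0..e1}; r \<in> {a..b}\<rbrakk> \<Longrightarrow>
        ((\<lambda>r. G e \<theta> r) has_real_derivative D e \<theta> r) (at r within {a..b})"
    and perG: "\<And>e \<theta> r. G e (\<theta> + \<omega>) r = G e \<theta> r" and perD: "\<And>e \<theta> r. D e (\<theta> + \<omega>) r = D e \<theta> r"
    and "\<omega> > 0" "e1 > 0" and r0: "a < r0" "r0 < b"
    and mean: "integral {0..\<omega>} (\<lambda>\<theta>. G 0 \<theta> r0) = 0"
    and slope: "integral {0..\<omega>} (\<lambda>\<theta>. D 0 \<theta> r0) < 0"
    and "\<delta> > 0"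
  obtains e0 where "e0 > 0"
    "\<And>e. \<lbrakk>0 < e; e < e0\<rbrakk> \<Longrightarrow> \<exists>R \<eta>. \<eta> > 0 \<and>
       (\<forall>\<theta>. R (\<theta> + \<omega>) = R \<theta> \<and> \<bar>R \<theta> - r0\<bar> < \<eta> \<and> \<bar>R \<theta> - r0\<bar> < \<delta> \<and>
            (R has_real_derivative e * G e \<theta> (R \<theta>)) (at \<theta>)) \<and>
       (\<forall>\<theta>0 k. \<bar>k - r0\<bar> < \<eta> \<longrightarrow> (\<exists>s. s \<theta>0 = k \<and>
            (\<forall>\<theta>\<ge>\<theta>0. \<bar>s \<theta> - r0\<bar> < \<delta> \<and> (s has_real_derivative e * G e \<theta> (s \<theta>)) (at \<theta>)) \<and>
            ((\<lambda>\<theta>. s \<theta> - R \<theta>) \<longlongrightarrow> 0) at_top))"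
proof -
  have r0': "r0 \<in> {a..b}" using r0 by auto
  have cont1: "continuous_on UNIV (\<lambda>\<theta>. H 0 \<theta> r0)"
    if "continuous_on ({0..e1} \<times> UNIV \<times> {a..b}) (\<lambda>(e, \<theta>, r). H e \<theta> r)" for H :: "real \<Rightarrow> real \<Rightarrow> real \<Rightarrow> real"
    using continuous_on_compose2[OF that, of UNIV "\<lambda>\<theta>. (0, \<theta>, r0)"] r0' \<open>e1 > 0\<close>
    by (simp add: continuous_on_Pair image_subset_iff)
  define d where "d = (\<lambda>\<theta>. D 0 \<theta> r0)"
  have dc: "continuous_on UNIV d" unfolding d_def by (rule cont1[OF contD])
  have dper: "d (\<theta> + \<omega>) = d \<theta>" for \<theta> unfolding d_def by (rule perD)
  define \<kappa> where "\<kappa> = - integral {0..\<omega>} d / \<omega>"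
  have \<kappa>: "\<kappa> > 0" using slope \<open>\<omega> > 0\<close> by (simp add: \<kappa>_def d_def divide_neg_pos)
  obtain AD where AD: "AD 0 = 0" "\<And>t. (AD has_real_derivative d t) (at t)"
    using continuous_real_antiderivative[OF dc, of 0] by blast
  define p where "p = (\<lambda>\<theta>. AD \<theta> + \<kappa> * \<theta>)"
  have p: "(p has_real_derivative d \<theta> + \<kappa>) (at \<theta>)" for \<theta>
    unfolding p_def by (auto intro!: derivative_eq_intros AD)
  have pper: "p (\<theta> + \<omega>) = p \<theta>" for \<theta>
    using antiderivative_increment[OF AD(2) dper \<open>\<omega> > 0\<close>, of \<theta>] \<open>\<omega> > 0\<close>
    by (simp add: p_def \<kappa>_def field_simps)
  have pc: "continuous_on UNIV p" using p by (intro DERIV_continuous_on) (rule has_field_derivative_at_within)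
  obtain Cp where Cp: "Cp > 0" "\<And>\<theta>. \<bar>p \<theta>\<bar> \<le> Cp"
    using continuous_periodic_bounded[of p, OF pper \<open>\<omega> > 0\<close> pc] by blast
  define \<alpha> where "\<alpha> = (\<lambda>\<theta>. d \<theta> + \<kappa> / 4)"
  define A where "A = (\<lambda>\<theta>. p \<theta> - 3 / 4 * \<kappa> * \<theta>)"
  have A: "(A has_real_derivative \<alpha> \<theta>) (at \<theta>)" for \<theta>
    unfolding A_def \<alpha>_def by (auto intro!: derivative_eq_intros p)
  obtain g where g: "g 0 = 0" "\<And>t. (g has_real_derivative G 0 t r0) (at t)"
    using continuous_real_antiderivative[OF cont1[OF contG], of 0] by blast
  have gper: "g (\<theta> + \<omega>) = g \<theta>" for \<theta>
    using antiderivative_increment[OF g(2) perG \<open>\<omega> > 0\<close>, of \<theta>] mean by simp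
  have gc: "continuous_on UNIV g" using g by (intro DERIV_continuous_on) (rule has_field_derivative_at_within)
  obtain Cg where Cg: "Cg > 0" "\<And>\<theta>. \<bar>g \<theta>\<bar> \<le> Cg"
    using continuous_periodic_bounded[of g, OF gper \<open>\<omega> > 0\<close> gc] by blast
  obtain L where L: "L > 0" "\<And>e r \<theta>. \<lbrakk>e \<in> {0..e1}; r \<in> {a..b}\<rbrakk> \<Longrightarrow> \<bar>D e \<theta> r\<bar> \<le> L"
    using periodic_family_bounded[OF contD perD \<open>\<omega> > 0\<close>] by blast
  obtain B where B: "B > 0" "\<And>e r \<theta>. \<lbrakk>e \<in> {0..e1}; r \<in> {a..b}\<rbrakk> \<Longrightarrow> \<bar>G e \<theta> r\<bar> \<le> B"
    using periodic_family_bounded[OF contG perG \<open>\<omega> > 0\<close>] by blast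
  obtain \<delta>D where \<delta>D: "\<delta>D > 0" "\<And>e r \<theta>. \<lbrakk>e \<in> {0..e1}; e < \<delta>D; r \<in> {a..b}; \<bar>r - r0\<bar> < \<delta>D\<rbrakk>
      \<Longrightarrow> \<bar>D e \<theta> r - D 0 \<theta> r0\<bar> < \<kappa> / 4"
    using periodic_family_uniform[OF contD perD \<open>\<omega> > 0\<close> r0', of "\<kappa> / 4"] \<kappa> \<open>e1 > 0\<close> by auto
  define \<delta>1 where "\<delta>1 = min (min \<delta> (\<delta>D / 2)) (min (r0 - a) (b - r0))"
  have \<delta>1: "\<delta>1 > 0" "\<delta>1 \<le> \<delta>" "\<delta>1 < \<delta>D" "{r0 - \<delta>1..r0 + \<delta>1} \<subseteq> {a..b}"
  proof -
    have "\<delta>1 \<le> r0 - a" "\<delta>1 \<le> b - r0" "\<delta>1 \<le> \<delta>D / 2" unfolding \<delta>1_def by linarith+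
    then show "\<delta>1 < \<delta>D" "{r0 - \<delta>1..r0 + \<delta>1} \<subseteq> {a..b}" using \<delta>D(1) by auto
  qed (use \<open>\<delta> > 0\<close> \<delta>D(1) r0 in \<open>auto simp: \<delta>1_def\<close>)
  \<comment> \<open>Distances of solutions grow at most by the factor \<open>exp 1 \<le> 3\<close>: starting within \<open>\<eta>\<close> of \<open>r0\<close>,
    hence within \<open>2 * \<eta>\<close> of \<open>R\<close>, they stay within \<open>6 * \<eta> + \<eta> < \<delta>1\<close> of \<open>r0\<close>.\<close>
  define \<eta> where "\<eta> = \<delta>1 / 8"
  have \<eta>: "\<eta> > 0" using \<delta>1 by (simp add: \<eta>_def)
  define \<nu> where "\<nu> = \<kappa> * \<eta> / 8"
  have \<nu>: "\<nu> > 0" using \<kappa> \<eta> by (simp add: \<nu>_def)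
  obtain \<delta>G where \<delta>G: "\<delta>G > 0" "\<And>e r \<theta>. \<lbrakk>e \<in> {0..e1}; e < \<delta>G; r \<in> {a..b}; \<bar>r - r0\<bar> < \<delta>G\<rbrakk>
      \<Longrightarrow> \<bar>G e \<theta> r - G 0 \<theta> r0\<bar> < \<nu>"
    using periodic_family_uniform[OF contG perG \<open>\<omega> > 0\<close> r0', of \<nu>] \<nu> \<open>e1 > 0\<close> by auto
  define e0 where "e0 = Min {e1, \<delta>D, \<delta>G, \<eta> / (2 * Cg), \<delta>G / Cg, 1 / (2 * Cp)}"
  have "e0 > 0" unfolding e0_def using \<open>e1 > 0\<close> \<delta>D(1) \<delta>G(1) \<eta> Cg(1) Cp(1) by simp
  have e0: "e < e1" "e < \<delta>D" "e < \<delta>G" "e * Cg < \<eta> / 2" "e * Cg < \<delta>G" "2 * e * Cp \<le> 1" if "e < e0" for e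
    using that Cg(1) Cp(1) unfolding e0_def by (auto simp: pos_less_divide_eq algebra_simps)
  show ?thesis
  proof (rule that[OF \<open>e0 > 0\<close>])
    fix e :: real assume e: "0 < e" "e < e0"
    note e' = e0[OF e(2)]
    have e_in: "e \<in> {0..e1}" using e e' by auto
    let ?lo = "r0 - \<delta>1" and ?hi = "r0 + \<delta>1"
    define f where "f \<theta> r = e * clamp_extend ?lo ?hi (d \<theta>) (G e \<theta>) r" for \<theta> r
    have der': "(G e \<theta> has_real_derivative D e \<theta> r) (at r within {?lo..?hi})" if "r \<in> {?lo..?hi}" for r \<theta>
      using der[OF e_in, of r \<theta>] \<delta>1(4) that by (auto intro: DERIV_subset)
    have up: "D e \<theta> r \<le> \<alpha> \<theta>" "\<bar>D e \<theta> r\<bar> \<le> L" if "r \<in> {?lo..?hi}" for r \<theta>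
    proof -
      have r: "r \<in> {a..b}" "\<bar>r - r0\<bar> < \<delta>D" using that \<delta>1(3,4) by auto
      show "D e \<theta> r \<le> \<alpha> \<theta>" using \<delta>D(2)[OF e_in e'(2) r, of \<theta>] unfolding \<alpha>_def d_def by linarith
      show "\<bar>D e \<theta> r\<bar> \<le> L" by (rule L(2)[OF e_in r(1)])
    qed
    have dL: "\<bar>d \<theta>\<bar> \<le> L" "d \<theta> \<le> \<alpha> \<theta>" for \<theta>
      using L(2)[of 0 r0 \<theta>] r0' \<open>e1 > 0\<close> \<kappa> by (auto simp: d_def \<alpha>_def)
    have lohi: "?lo \<le> ?hi" using \<delta>1 by simp
    note cb = clamp_extend_bounds[OF lohi der' up(1) dL(2) up(2) dL(1)]
    have one: "(f \<theta> r - f \<theta> s) * (r - s) \<le> e * \<alpha> \<theta> * (r - s)\<^sup>2" for \<theta> r s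
      using mult_left_mono[OF cb(1)[of \<theta> r s], of e] e by (simp add: f_def algebra_simps)
    have lip: "\<bar>f \<theta> r - f \<theta> s\<bar> \<le> (e * L) * \<bar>r - s\<bar>" for \<theta> r s
      using mult_left_mono[OF cb(2)[of \<theta> r s], of e] e by (simp add: f_def abs_mult flip: right_diff_distrib)
    have fin: "f \<theta> r = e * G e \<theta> r" if "r \<in> {?lo..?hi}" for \<theta> r
      using that by (simp add: f_def clamp_extend_def)
    have clamp: "max ?lo (min ?hi r) \<in> {a..b}" for r
    proof -
      have "max ?lo (min ?hi r) \<in> {?lo..?hi}" using \<delta>1(1) by auto
      then show ?thesis using \<delta>1(4) by blast
    qed
    have fc: "continuous_on UNIV (\<lambda>(\<theta>, r). f \<theta> r)"
    proof -
      let ?c = "\<lambda>r. max ?lo (min ?hi r)"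
      have "continuous_on UNIV (\<lambda>x. (\<lambda>(e, \<theta>, r). G e \<theta> r) (e, fst x, ?c (snd x)))"
        by (rule continuous_on_compose2[OF contG])
           (use e_in clamp in \<open>auto intro!: continuous_intros simp del: max.bounded_iff atLeastAtMost_iff\<close>)
      moreover have "continuous_on UNIV (\<lambda>x::real \<times> real. d (fst x))"
        by (rule continuous_on_compose2[OF dc]) (auto intro!: continuous_intros)
      ultimately show ?thesis
        unfolding f_def clamp_extend_def split_beta by (auto intro!: continuous_intros)
    qed
    have fB: "\<bar>f \<theta> 0\<bar> \<le> e * (B + L * \<bar>0 - max ?lo (min ?hi 0)\<bar>)" for \<theta>
    proof -
      have "\<bar>clamp_extend ?lo ?hi (d \<theta>) (G e \<theta>) 0\<bar> \<le> B + \<bar>d \<theta>\<bar> * \<bar>0 - max ?lo (min ?hi 0)\<bar>"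
        using B(2)[OF e_in clamp, of \<theta> 0] unfolding clamp_extend_def abs_mult[symmetric] by linarith
      also have "\<dots> \<le> B + L * \<bar>0 - max ?lo (min ?hi 0)\<bar>" using dL(1) by (intro add_mono mult_right_mono) auto
      finally show ?thesis using e(1) by (simp only: f_def abs_mult) (simp add: mult_left_mono)
    qed
    have "\<exists>s. s t0 = k \<and> (\<forall>t. (s has_real_derivative f t (s t)) (at t))" for t0 k
    proof -
      have "0 < e * L" using e(1) L(1) by simp
      from global_solution[of f, OF fc this lip fB, of t0 k] show ?thesis by blast
    qed
    then obtain S where S: "\<And>t0 k. S t0 k t0 = k"
        "\<And>t0 k t. (S t0 k has_real_derivative f t (S t0 k t)) (at t)" by metis
    have contract: "\<bar>s t - u t\<bar> \<le> \<bar>s t0 - u t0\<bar> * exp (e * (A t - A t0))"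
      if "\<And>t. (s has_real_derivative f t (s t)) (at t)" "\<And>t. (u has_real_derivative f t (u t)) (at t)" "t0 \<le> t"
      for s u t t0
    proof -
      have "\<bar>s t - u t\<bar> \<le> \<bar>s t0 - u t0\<bar> * exp (e * A t - e * A t0)"
      proof (rule abs_le_exp_growth[where w = "\<lambda>t. s t - u t" and A = "\<lambda>t. e * A t"
            and w' = "\<lambda>t. f t (s t) - f t (u t)" and \<alpha> = "\<lambda>t. e * \<alpha> t"])
        show "(s t - u t) * (f t (s t) - f t (u t)) \<le> e * \<alpha> t * (s t - u t)\<^sup>2" for t
          using one[of t "s t" "u t"] by (simp add: mult.commute)
      qed (use that in \<open>auto intro!: derivative_eq_intros A\<close>)
      then show ?thesis by (simp add: right_diff_distrib)
    qed
    have A\<omega>: "A \<omega> - A 0 = - (3/4 * \<kappa> * \<omega>)" using pper[of 0] by (simp add: A_def)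
    obtain k where k: "S 0 k \<omega> = k"
    proof -
      let ?q = "exp (e * (A \<omega> - A 0))"
      have "?q < 1" using e \<kappa> \<open>\<omega> > 0\<close> by (simp add: A\<omega>)
      moreover have "dist (S 0 x \<omega>) (S 0 y \<omega>) \<le> ?q * dist x y" for x y
        using contract[OF S(2) S(2), of 0 \<omega> 0 x 0 y] \<open>\<omega> > 0\<close> S(1) by (simp add: dist_real_def mult.commute)
      ultimately show ?thesis
        using ex1_implies_ex[OF banach_fix_type[of ?q "\<lambda>x. S 0 x \<omega>"]] that by auto
    qed
    define R where "R = S 0 k"
    have R: "(R has_real_derivative f t (R t)) (at t)" for t unfolding R_def by (rule S)
    have fper: "f (t + \<omega>) r = f t r" for t r
      unfolding f_def clamp_extend_def using perG dper by simp
    have Rper: "R (t + \<omega>) = R t" for t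
    proof -
      have "(\<lambda>t. R (t + \<omega>)) t = R t"
      proof (rule lipschitz_ode_unique[OF lip, where ?t0.0 = 0 and x = "\<lambda>t. R (t + \<omega>)" and y = R])
        show "((\<lambda>t. R (t + \<omega>)) has_real_derivative f t (R (t + \<omega>))) (at t)" for t
          using R[of "t + \<omega>"] DERIV_shift[of R "f t (R (t + \<omega>))" t \<omega>] fper by simp
      qed (use R k S(1) in \<open>auto simp: R_def\<close>)
      then show ?thesis .
    qed
    \<comment> \<open>The circle \<open>s\<close> solves the equation up to an error \<open>e * \<nu>\<close>; at the maximum of the
      weighted distance between \<open>R\<close> and \<open>s\<close> the contraction rate bounds that distance.\<close>
    define s where "s = (\<lambda>\<theta>. r0 + e * g \<theta>)"
    have s': "(s has_real_derivative e * G 0 \<theta> r0) (at \<theta>)" for \<theta>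
      unfolding s_def by (auto intro!: derivative_eq_intros g)
    have sr: "\<bar>s \<theta> - r0\<bar> < \<eta> / 2" "\<bar>s \<theta> - r0\<bar> < \<delta>G" for \<theta>
    proof -
      have "\<bar>s \<theta> - r0\<bar> \<le> e * Cg" using Cg(2)[of \<theta>] e by (simp add: s_def abs_mult mult_left_mono)
      then show "\<bar>s \<theta> - r0\<bar> < \<eta> / 2" "\<bar>s \<theta> - r0\<bar> < \<delta>G" using e' by auto
    qed
    have sin: "s \<theta> \<in> {?lo..?hi}" for \<theta> using sr(1)[of \<theta>] \<eta> unfolding \<eta>_def atLeastAtMost_iff by linarith
    define w where "w = (\<lambda>\<theta>. R \<theta> - s \<theta>)"
    have ww: "w \<theta> * (f \<theta> (R \<theta>) - e * G 0 \<theta> r0) \<le> e * \<alpha> \<theta> * (w \<theta>)\<^sup>2 + e * \<nu> * \<bar>w \<theta>\<bar>" for \<theta>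
    proof -
      have "\<bar>G e \<theta> (s \<theta>) - G 0 \<theta> r0\<bar> \<le> \<nu>"
        using \<delta>G(2)[OF e_in e'(3), of "s \<theta>" \<theta>] sr(2)[of \<theta>] sin[of \<theta>] \<delta>1(4) by (simp add: subset_iff)
      then have "\<bar>w \<theta>\<bar> * \<bar>e * (G e \<theta> (s \<theta>) - G 0 \<theta> r0)\<bar> \<le> \<bar>w \<theta>\<bar> * (e * \<nu>)"
        unfolding abs_mult using e by (intro mult_left_mono mult_mono) auto
      moreover have "w \<theta> * (e * (G e \<theta> (s \<theta>) - G 0 \<theta> r0)) \<le> \<bar>w \<theta>\<bar> * \<bar>e * (G e \<theta> (s \<theta>) - G 0 \<theta> r0)\<bar>"
        by (metis abs_ge_self abs_mult)
      moreover have "w \<theta> * (f \<theta> (R \<theta>) - f \<theta> (s \<theta>)) \<le> e * \<alpha> \<theta> * (w \<theta>)\<^sup>2"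
        using one[of \<theta> "R \<theta>" "s \<theta>"] by (simp add: w_def mult.commute)
      ultimately show ?thesis using fin[OF sin[of \<theta>], of \<theta>] by (simp add: algebra_simps)
    qed
    define V where "V = (\<lambda>\<theta>. (w \<theta>)\<^sup>2 * exp (- 2 * e * p \<theta>))"
    have V': "(V has_real_derivative 2 * exp (- 2 * e * p \<theta>) *
        (w \<theta> * (f \<theta> (R \<theta>) - e * G 0 \<theta> r0) - e * (d \<theta> + \<kappa>) * (w \<theta>)\<^sup>2)) (at \<theta>)" for \<theta>
      unfolding V_def w_def by (auto intro!: derivative_eq_intros R s' p simp: algebra_simps power2_eq_square)
    have Vper: "V (\<theta> + \<omega>) = V \<theta>" for \<theta> by (simp add: V_def w_def s_def Rper gper pper)
    have "continuous_on {0..\<omega>} V"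
      by (rule DERIV_continuous_on) (rule has_field_derivative_at_within[OF V'])
    then obtain \<theta>m where m: "\<theta>m \<in> {0..\<omega>}" "\<forall>\<theta>\<in>{0..\<omega>}. V \<theta> \<le> V \<theta>m"
      using continuous_attains_sup[of "{0..\<omega>}" V] \<open>\<omega> > 0\<close> by auto
    have Vmax: "V \<theta> \<le> V \<theta>m" for \<theta>
      using periodic_reduce[of V, OF Vper \<open>\<omega> > 0\<close>] m(2) by metis
    have wm: "\<bar>w \<theta>m\<bar> \<le> \<eta> / 6"
    proof -
      have "w \<theta>m * (f \<theta>m (R \<theta>m) - e * G 0 \<theta>m r0) - e * (d \<theta>m + \<kappa>) * (w \<theta>m)\<^sup>2 = 0"
        using DERIV_local_max[OF V'[of \<theta>m], of 1] Vmax by simp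
      then have "e * (d \<theta>m + \<kappa>) * (w \<theta>m)\<^sup>2 \<le> e * \<alpha> \<theta>m * (w \<theta>m)\<^sup>2 + e * \<nu> * \<bar>w \<theta>m\<bar>"
        using ww[of \<theta>m] by linarith
      then have "e * ((3/4 * \<kappa>) * (w \<theta>m)\<^sup>2) \<le> e * (\<nu> * \<bar>w \<theta>m\<bar>)" by (simp add: \<alpha>_def algebra_simps)
      then have "(3/4 * \<kappa> * \<bar>w \<theta>m\<bar>) * \<bar>w \<theta>m\<bar> \<le> \<nu> * \<bar>w \<theta>m\<bar>"
        using e by (simp add: power2_eq_square mult.assoc)
      then have "w \<theta>m = 0 \<or> 3/4 * \<kappa> * \<bar>w \<theta>m\<bar> \<le> \<nu>" 
        using mult_right_le_imp_le[of "3/4 * \<kappa> * \<bar>w \<theta>m\<bar>" "\<bar>w \<theta>m\<bar>" \<nu>] by (cases "w \<theta>m = 0") auto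
      then show ?thesis
      proof
        assume "3/4 * \<kappa> * \<bar>w \<theta>m\<bar> \<le> \<nu>"
        then have "\<kappa> * \<bar>w \<theta>m\<bar> \<le> \<kappa> * (\<eta> / 6)" by (simp add: \<nu>_def)
        then show ?thesis using \<kappa> by simp
      qed (use \<eta> in auto)
    qed
    have exp3: "exp (e * 2 * Cp) \<le> 3"
      using order_trans[OF _ exp_le, of "exp (e * 2 * Cp)"] e'(6) by (simp add: mult_ac)
    have wb: "\<bar>w \<theta>\<bar> \<le> \<eta> / 2" for \<theta>
    proof -
      have "V \<theta> * exp (2 * e * p \<theta>) \<le> V \<theta>m * exp (2 * e * p \<theta>)" using Vmax by simp
      then have "(w \<theta>)\<^sup>2 \<le> (w \<theta>m)\<^sup>2 * exp (2 * (e * (p \<theta> - p \<theta>m)))"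
        by (simp add: V_def algebra_simps flip: exp_add)
      also have "\<dots> = (\<bar>w \<theta>m\<bar> * exp (e * (p \<theta> - p \<theta>m)))\<^sup>2"
        by (simp add: power_mult_distrib exp_double)
      finally have "\<bar>w \<theta>\<bar> \<le> \<bar>w \<theta>m\<bar> * exp (e * (p \<theta> - p \<theta>m))"
        by (simp add: abs_le_square_iff[symmetric] abs_mult)
      also have "\<dots> \<le> \<eta> / 6 * 3"
      proof (intro mult_mono wm)
        have "p \<theta> - p \<theta>m \<le> 2 * Cp" using Cp(2)[of \<theta>] Cp(2)[of \<theta>m] by (simp add: abs_le_iff)
        then have "e * (p \<theta> - p \<theta>m) \<le> e * 2 * Cp" using e by (simp add: mult.assoc)
        then show "exp (e * (p \<theta> - p \<theta>m)) \<le> 3" using exp3 by (meson exp_le_cancel_iff order_trans)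
      qed (use \<eta> in auto)
      finally show ?thesis by simp
    qed
    have Rr: "\<bar>R \<theta> - r0\<bar> < \<eta>" for \<theta>
      using wb[of \<theta>] sr(1)[of \<theta>] unfolding w_def by linarith
    have \<eta>\<delta>: "\<eta> < \<delta>1" using \<eta> by (simp add: \<eta>_def)
    have Rgood: "\<bar>R \<theta> - r0\<bar> < \<delta>" "(R has_real_derivative e * G e \<theta> (R \<theta>)) (at \<theta>)" for \<theta>
    proof -
      show "\<bar>R \<theta> - r0\<bar> < \<delta>" using Rr[of \<theta>] \<eta>\<delta> \<delta>1(2) by linarith
      have "R \<theta> \<in> {?lo..?hi}" using Rr[of \<theta>] \<eta>\<delta> by (auto simp: abs_less_iff)
      then show "(R has_real_derivative e * G e \<theta> (R \<theta>)) (at \<theta>)" using R[of \<theta>] fin by simp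
    qed
    have orbit: "\<exists>s. s \<theta>0 = k \<and>
            (\<forall>\<theta>\<ge>\<theta>0. \<bar>s \<theta> - r0\<bar> < \<delta> \<and> (s has_real_derivative e * G e \<theta> (s \<theta>)) (at \<theta>)) \<and>
            ((\<lambda>\<theta>. s \<theta> - R \<theta>) \<longlongrightarrow> 0) at_top" if k: "\<bar>k - r0\<bar> < \<eta>" for k \<theta>0
    proof -
      let ?s = "S \<theta>0 k"
      have d0: "\<bar>?s \<theta>0 - R \<theta>0\<bar> \<le> 2 * \<eta>" using k Rr[of \<theta>0] S(1)[of \<theta>0 k] by linarith
      have est: "\<bar>?s \<theta> - R \<theta>\<bar> \<le> 6 * \<eta> * exp (- (3/4 * e * \<kappa> * (\<theta> - \<theta>0)))" if "\<theta>0 \<le> \<theta>" for \<theta>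
      proof -
        have "A \<theta> - A \<theta>0 \<le> 2 * Cp - 3/4 * \<kappa> * (\<theta> - \<theta>0)"
          using Cp(2)[of \<theta>] Cp(2)[of \<theta>0] unfolding A_def right_diff_distrib by linarith
        then have "e * (A \<theta> - A \<theta>0) \<le> e * 2 * Cp + - (3/4 * e * \<kappa> * (\<theta> - \<theta>0))"
          using mult_left_mono[of "A \<theta> - A \<theta>0" "2 * Cp - 3/4 * \<kappa> * (\<theta> - \<theta>0)" e] e by (simp add: algebra_simps)
        then have "exp (e * (A \<theta> - A \<theta>0)) \<le> exp (e * 2 * Cp) * exp (- (3/4 * e * \<kappa> * (\<theta> - \<theta>0)))"
          by (simp flip: exp_add)
        also have "\<dots> \<le> 3 * exp (- (3/4 * e * \<kappa> * (\<theta> - \<theta>0)))" using exp3 by simp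
        finally have *: "exp (e * (A \<theta> - A \<theta>0)) \<le> 3 * exp (- (3/4 * e * \<kappa> * (\<theta> - \<theta>0)))" .
        have "\<bar>?s \<theta> - R \<theta>\<bar> \<le> \<bar>?s \<theta>0 - R \<theta>0\<bar> * exp (e * (A \<theta> - A \<theta>0))"
          by (rule contract[OF S(2) R that])
        also have "\<dots> \<le> (2 * \<eta>) * (3 * exp (- (3/4 * e * \<kappa> * (\<theta> - \<theta>0))))"
          using d0 * \<eta> by (intro mult_mono) auto
        finally show ?thesis by simp
      qed
      have sr: "\<bar>?s \<theta> - r0\<bar> < \<delta>1" if "\<theta>0 \<le> \<theta>" for \<theta>
      proof -
        have "exp (- (3/4 * e * \<kappa> * (\<theta> - \<theta>0))) \<le> 1" using that e \<kappa> by simp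
        from mult_left_mono[OF this, of "6 * \<eta>"] have "\<bar>?s \<theta> - R \<theta>\<bar> \<le> 6 * \<eta>"
          using est[OF that] \<eta> by linarith
        then show ?thesis using Rr[of \<theta>] \<eta> unfolding \<eta>_def by linarith
      qed
      have good: "\<bar>?s \<theta> - r0\<bar> < \<delta>" "(?s has_real_derivative e * G e \<theta> (?s \<theta>)) (at \<theta>)" if \<theta>: "\<theta> \<ge> \<theta>0" for \<theta>
      proof -
        show "\<bar>?s \<theta> - r0\<bar> < \<delta>" using sr[OF \<theta>] \<delta>1(2) by linarith
        have "?s \<theta> \<in> {?lo..?hi}" using sr[OF \<theta>] by (auto simp: abs_less_iff)
        then show "(?s has_real_derivative e * G e \<theta> (?s \<theta>)) (at \<theta>)" using S(2)[of \<theta>0 k \<theta>] fin by simp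
      qed
      have "((\<lambda>\<theta>. 6 * \<eta> * exp (- (3/4 * e * \<kappa> * (\<theta> - \<theta>0)))) \<longlongrightarrow> 0) at_top"
      proof -
        have c: "3/4 * e * \<kappa> > 0" using e \<kappa> by simp
        have "((\<lambda>\<theta>. exp (- x * \<theta>)) \<longlongrightarrow> 0) at_top" if "x > 0" for x :: real
          using that by real_asymp
        from tendsto_mult_right_zero[OF this[OF c], of "6 * \<eta> * exp (3/4 * e * \<kappa> * \<theta>0)"]
        have "((\<lambda>\<theta>. 6 * \<eta> * exp (3/4 * e * \<kappa> * \<theta>0) * exp (- (3/4 * e * \<kappa>) * \<theta>)) \<longlongrightarrow> 0) at_top" .
        then show ?thesis unfolding mult.assoc[of "6 * \<eta>"] exp_add[symmetric] by (simp add: right_diff_distrib)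
      qed
      moreover have "\<forall>\<^sub>F \<theta> in at_top. norm (?s \<theta> - R \<theta>) \<le> 6 * \<eta> * exp (- (3/4 * e * \<kappa> * (\<theta> - \<theta>0)))"
        using eventually_ge_at_top[of \<theta>0] by eventually_elim (use est in simp)
      ultimately have "((\<lambda>\<theta>. ?s \<theta> - R \<theta>) \<longlongrightarrow> 0) at_top"
        by (rule Lim_null_comparison[rotated])
      then show ?thesis using S(1) good by (intro exI[of _ ?s] conjI allI impI) auto
    qed
    show "\<exists>R \<eta>. \<eta> > 0 \<and>
       (\<forall>\<theta>. R (\<theta> + \<omega>) = R \<theta> \<and> \<bar>R \<theta> - r0\<bar> < \<eta> \<and> \<bar>R \<theta> - r0\<bar> < \<delta> \<and>
            (R has_real_derivative e * G e \<theta> (R \<theta>)) (at \<theta>)) \<and>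
       (\<forall>\<theta>0 k. \<bar>k - r0\<bar> < \<eta> \<longrightarrow> (\<exists>s. s \<theta>0 = k \<and>
            (\<forall>\<theta>\<ge>\<theta>0. \<bar>s \<theta> - r0\<bar> < \<delta> \<and> (s has_real_derivative e * G e \<theta> (s \<theta>)) (at \<theta>)) \<and>
            ((\<lambda>\<theta>. s \<theta> - R \<theta>) \<longlongrightarrow> 0) at_top))"
      by (intro exI[of _ R] exI[of _ \<eta>] conjI allI impI \<eta> Rper Rr Rgood orbit)
  qed
qed

section \<open>Uniqueness, isolation and reversal of time\<close>

definition lipschitz_on_boxes :: "(real \<times> real \<Rightarrow> real \<times> real) \<Rightarrow> bool" where
  "lipschitz_on_boxes F \<longleftrightarrow> (\<forall>a b. 0 < a \<longrightarrow> (\<exists>L. \<forall>p\<in>{a..b} \<times> {a..b}. \<forall>q\<in>{a..b} \<times> {a..b}.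
      dist (F p) (F q) \<le> L * dist p q))"

lemma mem_quadrant: "p \<in> quadrant \<longleftrightarrow> fst p > 0 \<and> snd p > 0"
  by (cases p) (simp add: quadrant_def)

lemma solution_continuous_on:
  assumes "solution_on F I x" "J \<subseteq> I"
  shows "continuous_on J x"
proof (rule continuous_on_subset[OF _ assms(2)])
  show "continuous_on I x"
    using assms(1) unfolding solution_on_def continuous_on_eq_continuous_within
    by (blast intro: has_vector_derivative_continuous)
qed

lemma solution_in_box:
  assumes "solution_on F {0..} x"
  obtains a b where "0 < a" "\<And>t. t \<in> {0..T} \<Longrightarrow> x t \<in> {a..b} \<times> {a..b}"
proof (cases "0 \<le> T")
  case True
  have c: "continuous_on {0..T} x"
    by (rule solution_continuous_on[OF assms]) auto
  have pos: "fst (x t) > 0" "snd (x t) > 0" if "t \<in> {0..T}" for t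
    using assms that by (auto simp: solution_on_def mem_quadrant)
  have ex: "\<exists>a b. 0 < a \<and> (\<forall>t\<in>{0..T}. g t \<in> {a..b})"
    if g: "continuous_on {0..T} g" "\<And>t. t \<in> {0..T} \<Longrightarrow> g t > 0" for g :: "real \<Rightarrow> real"
  proof -
    obtain u where "u \<in> {0..T}" "\<forall>t\<in>{0..T}. g u \<le> g t"
      using continuous_attains_inf[of "{0..T}" g] g(1) True by (auto simp: Bex_def)
    moreover obtain v where "v \<in> {0..T}" "\<forall>t\<in>{0..T}. g t \<le> g v"
      using continuous_attains_sup[of "{0..T}" g] g(1) True by (auto simp: Bex_def)
    ultimately show ?thesis using g(2) by (intro exI[of _ "g u"] exI[of _ "g v"]) auto
  qed
  obtain a b where 1: "0 < a" "\<forall>t\<in>{0..T}. fst (x t) \<in> {a..b}"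
    using ex[of "\<lambda>t. fst (x t)"] c pos by (auto intro: continuous_intros)
  obtain a' b' where 2: "0 < a'" "\<forall>t\<in>{0..T}. snd (x t) \<in> {a'..b'}"
    using ex[of "\<lambda>t. snd (x t)"] c pos by (auto intro: continuous_intros)
  show ?thesis
    using 1 2 by (intro that[of "min a a'" "max b b'"]) (auto simp: mem_Times_iff min_le_iff_disj le_max_iff_disj)
qed (use that[of 1] in auto)

text \<open>Gronwall again, now for the squared distance; both solutions stay in a compact box up to time \<open>t\<close>.\<close>

lemma forward_solution_unique:
  assumes F: "lipschitz_on_boxes F" and x: "solution_on F {0..} x" and y: "solution_on F {0..} y"
    and eq: "x 0 = y 0" and "0 \<le> t"
  shows "x t = y t"
proof -
  obtain a b where a: "0 < a" "\<And>s. s \<in> {0..t} \<Longrightarrow> x s \<in> {a..b} \<times> {a..b}" using solution_in_box[OF x, of t] by blast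
  obtain a' b' where a': "0 < a'" "\<And>s. s \<in> {0..t} \<Longrightarrow> y s \<in> {a'..b'} \<times> {a'..b'}" using solution_in_box[OF y, of t] by blast
  define l u where "l = min a a'" and "u = max b b'"
  have box: "x s \<in> {l..u} \<times> {l..u}" "y s \<in> {l..u} \<times> {l..u}" if "s \<in> {0..t}" for s
    using a(2)[OF that] a'(2)[OF that] by (auto simp: l_def u_def mem_Times_iff)
  have "0 < l" using a a' by (simp add: l_def)
  then obtain L where L: "\<And>p q. p \<in> {l..u} \<times> {l..u} \<Longrightarrow> q \<in> {l..u} \<times> {l..u} \<Longrightarrow> dist (F p) (F q) \<le> L * dist p q"
    using F unfolding lipschitz_on_boxes_def by meson
  have dx: "(x has_vector_derivative F (x s)) (at s)" "(y has_vector_derivative F (y s)) (at s)" if "s > 0" for s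
  proof -
    have "at s within {0..} = at s" using that by (intro at_within_interior) auto
    then show "(x has_vector_derivative F (x s)) (at s)" "(y has_vector_derivative F (y s)) (at s)"
      using x y that unfolding solution_on_def by (metis atLeast_iff less_imp_le)+
  qed
  define N where "N = (\<lambda>s. (x s - y s) \<bullet> (x s - y s))"
  define V where "V = (\<lambda>s. N s * exp (- 2 * L * s))"
  have "V t \<le> V 0"
  proof (rule DERIV_nonpos_imp_decreasing_open[OF \<open>0 \<le> t\<close>])
    fix s assume s: "0 < s" "s < t"
    let ?w = "x s - y s" and ?w' = "F (x s) - F (y s)"
    have w: "((\<lambda>s. x s - y s) has_vector_derivative ?w') (at s)"
      using dx[OF s(1)] by (intro derivative_intros)
    have N: "(N has_real_derivative 2 * (?w \<bullet> ?w')) (at s)" unfolding N_def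
      using has_derivative_inner[OF w[unfolded has_vector_derivative_def] w[unfolded has_vector_derivative_def]]
      unfolding has_field_derivative_def by (rule has_derivative_eq_rhs) (auto simp: inner_commute algebra_simps)
    have "(V has_real_derivative 2 * exp (- 2 * L * s) * (?w \<bullet> ?w' - L * N s)) (at s)"
      unfolding V_def by (auto intro!: derivative_eq_intros N simp: algebra_simps)
    moreover have le: "2 * exp (- 2 * L * s) * (?w \<bullet> ?w' - L * N s) \<le> 0"
    proof -
      have "?w \<bullet> ?w' \<le> norm ?w * norm ?w'" by (rule norm_cauchy_schwarz)
      also have "\<dots> \<le> norm ?w * (L * norm ?w)"
        using L[OF box, of s s] s by (intro mult_left_mono) (auto simp: dist_norm)
      finally have "?w \<bullet> ?w' \<le> L * N s" by (simp add: N_def dot_square_norm power2_eq_square mult_ac)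
      then show ?thesis by (intro mult_nonneg_nonpos) auto
    qed
    ultimately show "\<exists>v. (V has_real_derivative v) (at s) \<and> v \<le> 0" by blast
  next
    have "continuous_on {0..t} x" "continuous_on {0..t} y"
      using solution_continuous_on[OF x] solution_continuous_on[OF y] by auto
    then show "continuous_on {0..t} V" unfolding V_def N_def by (intro continuous_intros)
  qed
  then have "(norm (x t - y t))\<^sup>2 \<le> 0" using eq by (simp add: V_def N_def dot_square_norm mult_le_0_iff not_le)
  then show ?thesis by simp
qed

lemma solution_on_shift:
  assumes "solution_on F UNIV x"
  shows "solution_on F {0..} (\<lambda>t. x (t + s))"
proof -
  have "((\<lambda>t. x (t + s)) has_vector_derivative F (x (t + s))) (at t within {0..})" for t
  proof -
    have "((\<lambda>t. t + s) has_vector_derivative 1) (at t)" by (auto intro!: derivative_eq_intros)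
    moreover have "(x has_vector_derivative F (x (t + s))) (at (t + s))"
      using assms by (simp add: solution_on_def)
    ultimately have "(x \<circ> (\<lambda>t. t + s) has_vector_derivative 1 *\<^sub>R F (x (t + s))) (at t)"
      by (rule vector_diff_chain_at)
    then show ?thesis by (simp add: o_def has_vector_derivative_at_within)
  qed
  then show ?thesis using assms by (simp add: solution_on_def)
qed

lemma periodic_orbit_closed:
  assumes "periodic_orbit F \<Gamma>"
  shows "closed \<Gamma>"
proof -
  obtain x T where x: "solution_on F UNIV x" "T > 0" "\<And>t. x (t + T) = x t" "\<Gamma> = range x"
    using assms unfolding periodic_orbit_def by blast
  have "continuous_on UNIV x"
    using solution_continuous_on[OF x(1)] by simp
  then have "compact (x ` {0..T})" by (intro compact_continuous_image) (auto intro: continuous_on_subset)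
  moreover have "\<Gamma> = x ` {0..T}"
  proof -
    have "x t \<in> x ` {0..T}" for t
    proof -
      obtain y where "y \<in> {0..T}" "x t = x y" using periodic_reduce[of x T t, OF x(3,2)] by blast
      then show ?thesis by simp
    qed
    then show ?thesis unfolding x(4) by blast
  qed
  ultimately show ?thesis using compact_imp_closed by simp
qed

text \<open>Two points make attraction imply isolation: a periodic orbit that is attracted to \<open>\<Gamma>\<close>
  returns to each of its points, so it lies at distance zero from \<open>\<Gamma>\<close>; and by uniqueness
  two orbits with a common point agree.\<close>

lemma attracting_periodic_orbit_stable:
  assumes F: "lipschitz_on_boxes F" and \<Gamma>: "periodic_orbit F \<Gamma>" and U: "open U" "\<Gamma> \<subseteq> U"
    and attr: "\<And>p. p \<in> U \<Longrightarrow> \<exists>x. solution_on F {0..} x \<and> x 0 = p \<and> ((\<lambda>t. infdist (x t) \<Gamma>) \<longlongrightarrow> 0) at_top"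
  shows "stable_limit_cycle F \<Gamma>"
proof -
  have "\<Gamma>' = \<Gamma>" if \<Gamma>': "periodic_orbit F \<Gamma>'" "\<Gamma>' \<inter> U \<noteq> {}" for \<Gamma>'
  proof -
    obtain x T where x: "solution_on F UNIV x" "T > 0" "\<And>t. x (t + T) = x t" "\<Gamma> = range x"
      using \<Gamma> unfolding periodic_orbit_def by blast
    obtain x' T' where x': "solution_on F UNIV x'" "T' > 0" "\<And>t. x' (t + T') = x' t" "\<Gamma>' = range x'"
      using \<Gamma>'(1) unfolding periodic_orbit_def by blast
    obtain s where "x' s \<in> U" using \<Gamma>'(2) x'(4) by auto
    then obtain y where y: "solution_on F {0..} y" "y 0 = x' s" "((\<lambda>t. infdist (y t) \<Gamma>) \<longlongrightarrow> 0) at_top"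
      using attr by blast
    have yx: "y t = x' (t + s)" if "0 \<le> t" for t
      using forward_solution_unique[OF F y(1) solution_on_shift[OF x'(1), of s] _ that] y(2) by simp
    have "x' t \<in> \<Gamma>" for t
    proof -
      have "filterlim (\<lambda>n. (t - s) + real n * T') at_top sequentially"
        using x'(2) by real_asymp
      from filterlim_compose[OF y(3) this]
      have "(\<lambda>n. infdist (y ((t - s) + real n * T')) \<Gamma>) \<longlonglongrightarrow> 0" .
      moreover have "\<forall>\<^sub>F n in sequentially. infdist (y ((t - s) + real n * T')) \<Gamma> = infdist (x' t) \<Gamma>"
      proof -
        have "filterlim (\<lambda>n. (t - s) + real n * T') at_top sequentially"
          using x'(2) by real_asymp
        then have "\<forall>\<^sub>F n in sequentially. 0 \<le> (t - s) + real n * T'" by (simp add: filterlim_at_top)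
        then show ?thesis
        proof eventually_elim
          case (elim n)
          have "x' (t + of_int (int n) * T') = x' t" by (rule periodic_int_shift[of x', OF x'(3)])
          then show ?case using yx[OF elim] by (simp add: algebra_simps)
        qed
      qed
      ultimately have "(\<lambda>n::nat. infdist (x' t) \<Gamma>) \<longlonglongrightarrow> 0" by (rule Lim_transform_eventually)
      then have "infdist (x' t) \<Gamma> = 0" by (simp add: LIMSEQ_const_iff)
      then show ?thesis
        using in_closed_iff_infdist_zero[OF periodic_orbit_closed[OF \<Gamma>]] x(4) by auto
    qed
    then have sub: "\<Gamma>' \<subseteq> \<Gamma>" using x'(4) by auto
    moreover have "\<Gamma> \<subseteq> \<Gamma>'"
    proof
      fix p assume "p \<in> \<Gamma>"
      then obtain t where t: "p = x t" using x(4) by auto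
      obtain u where u: "x' 0 = x u" using sub x(4) x'(4) by auto
      obtain k where k: "(t - u) + of_int k * T \<in> {0..T}" using periodic_representative[OF x(2)] .
      let ?v = "(t - u) + of_int k * T"
      have "x' (?v + 0) = x (?v + u)"
        using forward_solution_unique[OF F solution_on_shift[OF x'(1)] solution_on_shift[OF x(1)], of 0 u ?v] u k by simp
      moreover have "x (t + of_int k * T) = x t" by (rule periodic_int_shift[of x, OF x(3)])
      ultimately have "x' ?v = p" using t by (simp add: algebra_simps)
      then show "p \<in> \<Gamma>'" using x'(4) by auto
    qed
    ultimately show ?thesis by blast
  qed
  then show ?thesis unfolding stable_limit_cycle_def limit_cycle_def using \<Gamma> U attr by blast
qed

lemma solution_on_reverse:
  "solution_on (\<lambda>p. - F p) I x \<longleftrightarrow> solution_on F (uminus ` I) (\<lambda>t. x (- t))"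
proof -
  have *: "solution_on (\<lambda>p. - F p) (uminus ` I) (\<lambda>t. x (- t))" if "solution_on F I x" for F I and x :: "real \<Rightarrow> real \<times> real"
    unfolding solution_on_def
  proof (intro ballI conjI)
    fix t assume t: "t \<in> uminus ` I"
    then show "x (- t) \<in> quadrant" using that by (auto simp: solution_on_def)
    have "(x has_vector_derivative F (x (- t))) (at (- t) within I)" using that t by (auto simp: solution_on_def)
    moreover have "uminus ` uminus ` I = I" by force
    ultimately have "(x \<circ> uminus has_vector_derivative (-1) *\<^sub>R F (x (- t))) (at t within uminus ` I)"
      by (intro vector_diff_chain_within) (auto intro!: derivative_eq_intros)
    then show "((\<lambda>t. x (- t)) has_vector_derivative - F (x (- t))) (at t within uminus ` I)" by (simp add: o_def)
  qed
  have "uminus ` uminus ` I = I" by force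
  then show ?thesis using *[of "\<lambda>p. - F p" I x] *[of F "uminus ` I" "\<lambda>t. x (- t)"] by auto
qed

lemma stable_reverse_unstable:
  assumes "stable_limit_cycle (\<lambda>p. - F p) \<Gamma>"
  shows "unstable_limit_cycle F \<Gamma>"
proof -
  have im: "uminus ` (UNIV::real set) = UNIV" "uminus ` {0..} = {..0::real}" by force+
  have po: "periodic_orbit F \<Delta>" if per: "periodic_orbit (\<lambda>p. - F p) \<Delta>" for F and \<Delta> :: "(real \<times> real) set"
  proof -
    obtain x T s t where x: "solution_on (\<lambda>p. - F p) UNIV x" "T > 0" "\<And>t. x (t + T) = x t" "x s \<noteq> x t" "\<Delta> = range x"
      using per unfolding periodic_orbit_def by blast
    have "x (- (t + T)) = x (- t)" for t using x(3)[of "- (t + T)"] by simp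
    moreover have "range x = range (\<lambda>t. x (- t))" using image_comp[of x uminus UNIV] im by (simp add: o_def)
    moreover have "(\<lambda>t. x (- t)) (- s) \<noteq> (\<lambda>t. x (- t)) (- t)" using x(4) by simp
    moreover have "solution_on F UNIV (\<lambda>t. x (- t))" using x(1) solution_on_reverse[of F UNIV x] im by simp
    ultimately show ?thesis
      unfolding periodic_orbit_def using x(2,5)
      by (intro exI[of _ "\<lambda>t. x (- t)"] exI[of _ T]) blast
  qed
  have po_iff: "periodic_orbit (\<lambda>p. - F p) \<Delta> \<longleftrightarrow> periodic_orbit F \<Delta>" for \<Delta>
    using po[of F \<Delta>] po[of "\<lambda>p. - F p" \<Delta>] by auto
  obtain U where U: "open U" "\<Gamma> \<subseteq> U" "\<And>p. p \<in> U \<Longrightarrow> \<exists>x. solution_on (\<lambda>p. - F p) {0..} x \<and> x 0 = p \<and>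
       ((\<lambda>t. infdist (x t) \<Gamma>) \<longlongrightarrow> 0) at_top"
    using assms unfolding stable_limit_cycle_def by blast
  have "\<exists>x. solution_on F {..0} x \<and> x 0 = p \<and> ((\<lambda>t. infdist (x t) \<Gamma>) \<longlongrightarrow> 0) at_bot" if p: "p \<in> U" for p
  proof -
    obtain x where x: "solution_on (\<lambda>p. - F p) {0..} x" "x 0 = p" "((\<lambda>t. infdist (x t) \<Gamma>) \<longlongrightarrow> 0) at_top"
      using U(3)[OF p] by blast
    then show ?thesis using solution_on_reverse[of F "{0..}" x] im
      by (intro exI[of _ "\<lambda>t. x (- t)"]) (auto simp: filterlim_at_bot_mirror)
  qed
  moreover have "limit_cycle F \<Gamma>"
    using assms unfolding stable_limit_cycle_def limit_cycle_def po_iff by blast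
  ultimately show ?thesis unfolding unstable_limit_cycle_def using U by blast
qed

section \<open>From the angular equation to the plane\<close>

text \<open>\<open>\<Theta>\<close> is the time at which the angle \<open>\<theta>\<close> is reached, and \<open>\<tau>\<close> its inverse.\<close>

lemma time_change:
  fixes \<omega> :: "real \<Rightarrow> real"
  assumes cont: "continuous_on UNIV \<omega>" and "c > 0" and c: "\<And>\<theta>. \<omega> \<theta> \<ge> c"
  obtains \<Theta> \<tau> where "\<Theta> \<theta>0 = 0" "\<And>\<theta>. (\<Theta> has_real_derivative \<omega> \<theta>) (at \<theta>)"
    "\<And>\<theta>. \<tau> (\<Theta> \<theta>) = \<theta>" "\<And>t. \<Theta> (\<tau> t) = t"
    "\<And>t. (\<tau> has_real_derivative 1 / \<omega> (\<tau> t)) (at t)" "strict_mono \<tau>" "filterlim \<tau> at_top at_top"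
proof -
  obtain \<Theta> where \<Theta>: "\<Theta> \<theta>0 = 0" "\<And>\<theta>. (\<Theta> has_real_derivative \<omega> \<theta>) (at \<theta>)"
    using continuous_real_antiderivative[OF cont, of \<theta>0] by blast
  have pos: "\<omega> \<theta> > 0" for \<theta> using c[of \<theta>] \<open>c > 0\<close> by linarith
  have grow: "\<Theta> v - \<Theta> u \<ge> c * (v - u)" if "u \<le> v" for u v
  proof -
    have "\<Theta> u - c * u \<le> \<Theta> v - c * v"
    proof (rule DERIV_nonneg_imp_nondecreasing[OF that])
      fix x show "\<exists>y. ((\<lambda>x. \<Theta> x - c * x) has_real_derivative y) (at x) \<and> 0 \<le> y"
        using c[of x] by (intro exI[of _ "\<omega> x - c"]) (auto intro!: derivative_eq_intros \<Theta>)
    qed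
    then show ?thesis by (simp add: algebra_simps)
  qed
  have sm: "strict_mono \<Theta>"
  proof (rule strict_monoI)
    fix u v :: real assume "u < v"
    then have "0 < c * (v - u)" using \<open>c > 0\<close> by simp
    then show "\<Theta> u < \<Theta> v" using grow[of u v] \<open>u < v\<close> by linarith
  qed
  have cont\<Theta>: "isCont \<Theta> x" for x using \<Theta>(2) DERIV_isCont by blast
  have surj: "\<exists>\<theta>. \<Theta> \<theta> = t" for t
  proof -
    define h where "h = \<bar>t\<bar> / c"
    have h: "h \<ge> 0" "c * h = \<bar>t\<bar>" using \<open>c > 0\<close> by (auto simp: h_def)
    have "\<Theta> (\<theta>0 - h) \<le> t" "t \<le> \<Theta> (\<theta>0 + h)"
      using grow[of "\<theta>0 - h" \<theta>0] grow[of \<theta>0 "\<theta>0 + h"] h \<Theta>(1) by auto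
    then show ?thesis
      using IVT[of \<Theta> "\<theta>0 - h" t "\<theta>0 + h"] h(1) cont\<Theta> by auto
  qed
  define \<tau> where "\<tau> = inv \<Theta>"
  have inj: "inj \<Theta>" using sm by (rule strict_mono_imp_inj_on)
  have \<tau>1: "\<tau> (\<Theta> \<theta>) = \<theta>" for \<theta> unfolding \<tau>_def using inj by (rule inv_f_f)
  have \<tau>2: "\<Theta> (\<tau> t) = t" for t
    unfolding \<tau>_def using surj by (metis surj_def surj_f_inv_f)
  have sm\<tau>: "strict_mono \<tau>"
    by (rule strict_monoI) (metis \<tau>2 sm strict_mono_less)
  have contt: "isCont \<tau> t" for t
    using isCont_inverse_function[of 1 "\<tau> t" \<tau> \<Theta>] \<tau>1 \<tau>2 cont\<Theta> by simp
  have "(\<tau> has_real_derivative 1 / \<omega> (\<tau> t)) (at t)" for t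
    using DERIV_inverse_function[of \<Theta> "\<omega> (\<tau> t)" \<tau> t "t - 1" "t + 1"] \<Theta>(2) pos[of "\<tau> t"] \<tau>2 contt
    by (simp add: divide_inverse)
  moreover have "filterlim \<tau> at_top at_top"
    unfolding filterlim_at_top
  proof
    fix Z
    show "\<forall>\<^sub>F x in at_top. Z \<le> \<tau> x"
      using eventually_ge_at_top[of "\<Theta> Z"] by eventually_elim (metis \<tau>1 sm\<tau> strict_mono_less_eq)
  qed
  ultimately show ?thesis using that \<Theta> \<tau>1 \<tau>2 sm\<tau> by blast
qed

text \<open>The passage from the angular equation back to the plane. Along a graph \<open>r = s \<theta>\<close> over the
  angle, time is recovered as the primitive of \<open>1 / \<Omega>\<close>.\<close>

locale polar_chart =
  fixes F :: "real \<times> real \<Rightarrow> real \<times> real" and \<Phi> :: "real \<Rightarrow> real \<Rightarrow> real \<times> real"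
    and \<rho> :: "real \<times> real \<Rightarrow> real" and \<omega> a b :: real
    and S \<Omega> :: "real \<Rightarrow> real \<Rightarrow> real" and W M :: real
  assumes lipF: "lipschitz_on_boxes F" and \<omega>: "\<omega> > 0"
    and quad: "\<And>\<theta> r. r \<in> {a<..<b} \<Longrightarrow> \<Phi> \<theta> r \<in> quadrant"
    and per: "\<And>\<theta> r. \<Phi> (\<theta> + \<omega>) r = \<Phi> \<theta> r" "\<And>\<theta> r. \<Omega> (\<theta> + \<omega>) r = \<Omega> \<theta> r"
    and \<Omega>_cont: "continuous_on (UNIV \<times> {a<..<b}) (\<lambda>(\<theta>, r). \<Omega> \<theta> r)"
    and \<Omega>: "\<And>\<theta> r. r \<in> {a<..<b} \<Longrightarrow> 0 < \<Omega> \<theta> r \<and> \<Omega> \<theta> r \<le> W"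
    and flow: "\<And>s \<theta>. s \<theta> \<in> {a<..<b} \<Longrightarrow> (s has_real_derivative S \<theta> (s \<theta>)) (at \<theta>) \<Longrightarrow>
       ((\<lambda>\<theta>. \<Phi> \<theta> (s \<theta>)) has_vector_derivative (1 / \<Omega> \<theta> (s \<theta>)) *\<^sub>R F (\<Phi> \<theta> (s \<theta>))) (at \<theta>)"
    and lip\<Phi>: "\<And>\<theta> r r'. \<lbrakk>r \<in> {a<..<b}; r' \<in> {a<..<b}\<rbrakk> \<Longrightarrow> dist (\<Phi> \<theta> r) (\<Phi> \<theta> r') \<le> M * \<bar>r - r'\<bar>"
    and \<rho>_cont: "continuous_on quadrant \<rho>"
    and \<rho>_\<Phi>: "\<And>\<theta> r. r \<in> {a<..<b} \<Longrightarrow> \<rho> (\<Phi> \<theta> r) = r"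
    and \<Phi>_\<rho>: "\<And>p. p \<in> quadrant \<Longrightarrow> \<rho> p \<in> {a<..<b} \<Longrightarrow> \<exists>\<theta>. p = \<Phi> \<theta> (\<rho> p)"
    and nonconst: "\<And>r r'. \<lbrakk>r \<in> {a<..<b}; r' \<in> {a<..<b}\<rbrakk> \<Longrightarrow> \<Phi> 0 r \<noteq> \<Phi> (\<omega> / 2) r'"
begin

lemma W_pos: "a < b \<Longrightarrow> W > 0"
  using \<Omega>[of "(a + b) / 2" 0] by auto

lemma graph_solution:
  assumes "a < b" and s: "\<And>\<theta>. \<theta> \<ge> \<theta>0 \<Longrightarrow> s \<theta> \<in> {a<..<b} \<and> (s has_real_derivative S \<theta> (s \<theta>)) (at \<theta>)"
  obtains \<tau> where "\<tau> 0 = \<theta>0" "filterlim \<tau> at_top at_top" "\<And>t. t \<ge> 0 \<Longrightarrow> \<tau> t \<ge> \<theta>0"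
    "solution_on F {0..} (\<lambda>t. \<Phi> (\<tau> t) (s (\<tau> t)))"
proof -
  define \<nu> where "\<nu> = (\<lambda>\<theta>. 1 / \<Omega> (max \<theta> \<theta>0) (s (max \<theta> \<theta>0)))"
  have in_ab: "s (max \<theta> \<theta>0) \<in> {a<..<b}" for \<theta> using s by simp
  have sc: "continuous_on {\<theta>0..} s"
    by (rule DERIV_continuous_on[where D = "\<lambda>\<theta>. S \<theta> (s \<theta>)"]) (use s in \<open>auto intro: has_field_derivative_at_within\<close>)
  have smc: "continuous_on UNIV (\<lambda>\<theta>. s (max \<theta> \<theta>0))"
    by (rule continuous_on_compose2[OF sc]) (auto intro!: continuous_intros)
  have "continuous_on UNIV (\<lambda>\<theta>. \<Omega> (max \<theta> \<theta>0) (s (max \<theta> \<theta>0)))"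
    using continuous_on_compose2[OF \<Omega>_cont, of UNIV "\<lambda>\<theta>. (max \<theta> \<theta>0, s (max \<theta> \<theta>0))"] smc in_ab
    by (simp add: continuous_on_Pair continuous_on_max image_subset_iff)
  then have \<nu>c: "continuous_on UNIV \<nu>"
    unfolding \<nu>_def using \<Omega>[OF in_ab] by (intro continuous_intros) (auto simp: less_imp_neq[THEN not_sym])
  have \<nu>W: "\<nu> \<theta> \<ge> 1 / W" for \<theta>
    unfolding \<nu>_def using \<Omega>[OF in_ab, of "max \<theta> \<theta>0" \<theta>] by (intro divide_left_mono) auto
  obtain \<Theta> \<tau> where \<tau>: "\<Theta> \<theta>0 = 0" "\<And>\<theta>. \<tau> (\<Theta> \<theta>) = \<theta>"
    "\<And>t. (\<tau> has_real_derivative 1 / \<nu> (\<tau> t)) (at t)" "strict_mono \<tau>" "filterlim \<tau> at_top at_top"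
  proof -
    have "0 < 1 / W" using W_pos[OF \<open>a < b\<close>] by simp
    from time_change[OF \<nu>c this \<nu>W, of \<theta>0] show ?thesis using that by metis
  qed
  have \<tau>0: "\<tau> 0 = \<theta>0" using \<tau>(2)[of \<theta>0] \<tau>(1) by simp
  have ge: "\<tau> t \<ge> \<theta>0" if "t \<ge> 0" for t
    using strict_mono_less_eq[OF \<tau>(4), of 0 t] that \<tau>0 by simp
  have "solution_on F {0..} (\<lambda>t. \<Phi> (\<tau> t) (s (\<tau> t)))"
    unfolding solution_on_def
  proof (intro ballI conjI)
    fix t :: real assume "t \<in> {0..}"
    then have t: "\<tau> t \<ge> \<theta>0" using ge by simp
    note st = s[OF t]
    show "\<Phi> (\<tau> t) (s (\<tau> t)) \<in> quadrant" using quad st by blast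
    have "(\<tau> has_vector_derivative \<Omega> (\<tau> t) (s (\<tau> t))) (at t)"
      using \<tau>(3)[of t] t by (simp add: \<nu>_def max_def has_real_derivative_iff_has_vector_derivative)
    from vector_diff_chain_at[OF this flow[of s "\<tau> t"]] st
    have "((\<lambda>t. \<Phi> (\<tau> t) (s (\<tau> t))) has_vector_derivative F (\<Phi> (\<tau> t) (s (\<tau> t)))) (at t)"
      using \<Omega>[of "s (\<tau> t)" "\<tau> t"] by (simp add: o_def)
    then show "((\<lambda>t. \<Phi> (\<tau> t) (s (\<tau> t))) has_vector_derivative F (\<Phi> (\<tau> t) (s (\<tau> t)))) (at t within {0..})"
      by (rule has_vector_derivative_at_within)
  qed
  then show ?thesis using that \<tau>0 \<tau>(5) ge by blast
qed

lemma graph_periodic_orbit: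
  assumes "a < b" and R: "\<And>\<theta>. R \<theta> \<in> {a<..<b}" "\<And>\<theta>. (R has_real_derivative S \<theta> (R \<theta>)) (at \<theta>)"
    and Rper: "\<And>\<theta>. R (\<theta> + \<omega>) = R \<theta>"
  shows "periodic_orbit F (range (\<lambda>\<theta>. \<Phi> \<theta> (R \<theta>)))"
proof -
  define \<nu> where "\<nu> = (\<lambda>\<theta>. 1 / \<Omega> \<theta> (R \<theta>))"
  have Rc: "continuous_on UNIV R" by (rule DERIV_continuous_on[OF R(2)[THEN has_field_derivative_at_within]])
  have "continuous_on UNIV (\<lambda>\<theta>. \<Omega> \<theta> (R \<theta>))"
    using continuous_on_compose2[OF \<Omega>_cont, of UNIV "\<lambda>\<theta>. (\<theta>, R \<theta>)"] Rc R(1)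
    by (simp add: continuous_on_Pair image_subset_iff)
  then have \<nu>c: "continuous_on UNIV \<nu>"
    unfolding \<nu>_def using \<Omega>[OF R(1)] by (intro continuous_intros) (auto simp: less_imp_neq[THEN not_sym])
  have \<nu>W: "\<nu> \<theta> \<ge> 1 / W" for \<theta>
    unfolding \<nu>_def using \<Omega>[OF R(1), of \<theta> \<theta>] by (intro divide_left_mono) auto
  obtain \<Theta> \<tau> where \<tau>: "\<Theta> 0 = 0" "\<And>\<theta>. (\<Theta> has_real_derivative \<nu> \<theta>) (at \<theta>)" "\<And>\<theta>. \<tau> (\<Theta> \<theta>) = \<theta>"
    "\<And>t. \<Theta> (\<tau> t) = t" "\<And>t. (\<tau> has_real_derivative 1 / \<nu> (\<tau> t)) (at t)" "strict_mono \<tau>"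
  proof -
    have "0 < 1 / W" using W_pos[OF \<open>a < b\<close>] by simp
    from time_change[OF \<nu>c this \<nu>W, of 0] show ?thesis using that by metis
  qed
  define x where "x = (\<lambda>t. \<Phi> (\<tau> t) (R (\<tau> t)))"
  define T where "T = integral {0..\<omega>} \<nu>"
  have inc: "\<Theta> (\<theta> + \<omega>) = \<Theta> \<theta> + T" for \<theta>
    unfolding T_def by (rule antiderivative_increment[OF \<tau>(2) _ \<omega>]) (simp add: \<nu>_def per Rper)
  have "0 < T"
  proof -
    have "\<tau> (\<Theta> 0) < \<tau> (\<Theta> \<omega>)" using \<tau>(3) \<omega> by simp
    then have "\<Theta> 0 < \<Theta> \<omega>" using \<tau>(6) strict_mono_less by blast
    then show ?thesis using inc[of 0] \<tau>(1) by simp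
  qed
  moreover have "x (t + T) = x t" for t
  proof -
    have "\<tau> (t + T) = \<tau> t + \<omega>" using inc[of "\<tau> t"] \<tau>(3)[of "\<tau> t + \<omega>"] \<tau>(4)[of t] by simp
    then show ?thesis by (simp add: x_def per Rper)
  qed
  moreover have "x (\<Theta> 0) \<noteq> x (\<Theta> (\<omega> / 2))" using nonconst R(1) by (simp add: x_def \<tau>(3))
  moreover have "solution_on F UNIV x"
    unfolding solution_on_def
  proof (intro ballI conjI)
    fix t
    show "x t \<in> quadrant" unfolding x_def using quad R(1) by blast
    have "(\<tau> has_vector_derivative \<Omega> (\<tau> t) (R (\<tau> t))) (at t)"
      using \<tau>(5)[of t] by (simp add: \<nu>_def has_real_derivative_iff_has_vector_derivative)
    from vector_diff_chain_at[OF this flow[of R "\<tau> t", OF R]]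
    show "(x has_vector_derivative F (x t)) (at t)"
      using \<Omega>[of "R (\<tau> t)" "\<tau> t"] R(1)[of "\<tau> t"] by (simp add: o_def x_def)
  qed
  moreover have "range (\<lambda>\<theta>. \<Phi> \<theta> (R \<theta>)) = range x"
  proof -
    have "\<Phi> \<theta> (R \<theta>) = x (\<Theta> \<theta>)" for \<theta> by (simp add: x_def \<tau>(3))
    then have "range (\<lambda>\<theta>. \<Phi> \<theta> (R \<theta>)) \<subseteq> range x" by blast
    moreover have "range x \<subseteq> range (\<lambda>\<theta>. \<Phi> \<theta> (R \<theta>))" unfolding x_def by blast
    ultimately show ?thesis by blast
  qed
  ultimately show ?thesis unfolding periodic_orbit_def by blast
qed

lemma averaged_stable_limit_cycle:
  assumes R: "\<And>\<theta>. R (\<theta> + \<omega>) = R \<theta> \<and> \<bar>R \<theta> - r0\<bar> < \<eta> \<and> \<bar>R \<theta> - r0\<bar> < \<delta> \<and> (R has_real_derivative S \<theta> (R \<theta>)) (at \<theta>)"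
    and attr: "\<And>\<theta>0 k. \<bar>k - r0\<bar> < \<eta> \<Longrightarrow> \<exists>s. s \<theta>0 = k \<and>
            (\<forall>\<theta>\<ge>\<theta>0. \<bar>s \<theta> - r0\<bar> < \<delta> \<and> (s has_real_derivative S \<theta> (s \<theta>)) (at \<theta>)) \<and>
            ((\<lambda>\<theta>. s \<theta> - R \<theta>) \<longlongrightarrow> 0) at_top"
    and \<delta>: "a < r0 - \<delta>" "r0 + \<delta> < b" and \<eta>: "\<eta> > 0"
  shows "\<exists>\<Gamma>. stable_limit_cycle F \<Gamma> \<and> \<Gamma> \<noteq> {} \<and> (\<forall>p\<in>\<Gamma>. \<bar>\<rho> p - r0\<bar> < \<delta>)"
proof (intro exI conjI)
  let ?\<Gamma> = "range (\<lambda>\<theta>. \<Phi> \<theta> (R \<theta>))"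
  have in_ab: "r \<in> {a<..<b}" if "\<bar>r - r0\<bar> < \<delta>" for r using that \<delta> unfolding greaterThanLessThan_iff by linarith
  have "a < b" using R[of 0] in_ab[of "R 0"] by auto
  have Rin: "R \<theta> \<in> {a<..<b}" for \<theta> using R in_ab by blast
  show "\<forall>p\<in>?\<Gamma>. \<bar>\<rho> p - r0\<bar> < \<delta>" using R \<rho>_\<Phi>[OF Rin] by auto
  let ?U = "{p \<in> quadrant. \<rho> p \<in> {max a (r0 - \<eta>)<..<min b (r0 + \<eta>)}}"
  show "stable_limit_cycle F ?\<Gamma>"
  proof (rule attracting_periodic_orbit_stable[OF lipF])
    show "periodic_orbit F ?\<Gamma>" using R Rin by (intro graph_periodic_orbit \<open>a < b\<close>) auto
    have "open quadrant"
    proof -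
      have q: "quadrant = {0<..} \<times> ({0<..}::real set)" by (auto simp: mem_quadrant)
      show ?thesis unfolding q by (intro open_Times open_greaterThan)
    qed
    then show "open ?U"
      using continuous_open_preimage[OF \<rho>_cont _ open_greaterThanLessThan, of "max a (r0 - \<eta>)" "min b (r0 + \<eta>)"]
      by (simp add: vimage_def Int_def)
    show "?\<Gamma> \<subseteq> ?U"
    proof (rule image_subsetI, rule CollectI, rule conjI)
      fix \<theta>
      show "\<Phi> \<theta> (R \<theta>) \<in> quadrant" using quad Rin by blast
      show "\<rho> (\<Phi> \<theta> (R \<theta>)) \<in> {max a (r0 - \<eta>)<..<min b (r0 + \<eta>)}"
        using \<rho>_\<Phi>[OF Rin] Rin[of \<theta>] R[of \<theta>] by (auto simp: abs_less_iff)
    qed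
    fix p assume p: "p \<in> ?U"
    then obtain \<theta>0 where \<theta>0: "p = \<Phi> \<theta>0 (\<rho> p)" using \<Phi>_\<rho>[of p] by auto
    have "\<bar>\<rho> p - r0\<bar> < \<eta>" using p by (auto simp: abs_less_iff)
    then obtain s where s: "s \<theta>0 = \<rho> p"
       "\<And>\<theta>. \<theta> \<ge> \<theta>0 \<Longrightarrow> \<bar>s \<theta> - r0\<bar> < \<delta> \<and> (s has_real_derivative S \<theta> (s \<theta>)) (at \<theta>)"
       "((\<lambda>\<theta>. s \<theta> - R \<theta>) \<longlongrightarrow> 0) at_top" using attr by blast
    have s': "s \<theta> \<in> {a<..<b} \<and> (s has_real_derivative S \<theta> (s \<theta>)) (at \<theta>)" if "\<theta> \<ge> \<theta>0" for \<theta>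
      using s(2)[OF that] in_ab by blast
    obtain \<tau> where \<tau>: "\<tau> 0 = \<theta>0" "filterlim \<tau> at_top at_top" "\<And>t. t \<ge> 0 \<Longrightarrow> \<tau> t \<ge> \<theta>0"
      "solution_on F {0..} (\<lambda>t. \<Phi> (\<tau> t) (s (\<tau> t)))" using graph_solution[OF \<open>a < b\<close> s'] by blast
    have "((\<lambda>t. M * \<bar>s (\<tau> t) - R (\<tau> t)\<bar>) \<longlongrightarrow> 0) at_top"
      using filterlim_compose[OF s(3) \<tau>(2)] by (intro tendsto_mult_right_zero tendsto_rabs_zero)
    moreover have "\<forall>\<^sub>F t in at_top. norm (infdist (\<Phi> (\<tau> t) (s (\<tau> t))) ?\<Gamma>) \<le> M * \<bar>s (\<tau> t) - R (\<tau> t)\<bar>"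
      using eventually_ge_at_top[of 0]
    proof eventually_elim
      case (elim t)
      have "infdist (\<Phi> (\<tau> t) (s (\<tau> t))) ?\<Gamma> \<le> dist (\<Phi> (\<tau> t) (s (\<tau> t))) (\<Phi> (\<tau> t) (R (\<tau> t)))"
        by (intro infdist_le) auto
      also have "\<dots> \<le> M * \<bar>s (\<tau> t) - R (\<tau> t)\<bar>"
        using s'[OF \<tau>(3)[OF elim]] Rin by (intro lip\<Phi>) auto
      finally show ?case by (simp add: infdist_nonneg)
    qed
    ultimately have "((\<lambda>t. infdist (\<Phi> (\<tau> t) (s (\<tau> t))) ?\<Gamma>) \<longlongrightarrow> 0) at_top"
      by (rule Lim_null_comparison[rotated])
    then show "\<exists>x. solution_on F {0..} x \<and> x 0 = p \<and> ((\<lambda>t. infdist (x t) ?\<Gamma>) \<longlongrightarrow> 0) at_top"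
      using \<tau>(1,4) s(1) \<theta>0 by (intro exI[of _ "\<lambda>t. \<Phi> (\<tau> t) (s (\<tau> t))"]) auto
  qed
qed auto

end

section \<open>The damped oscillator\<close>

text \<open>The perturbation is divided by \<open>e\<close>. Writing \<open>(1 - z powr (- e)) / e\<close> through the entire function
  \<open>(exp x - 1) / x\<close> makes it jointly continuous in \<open>(e, z)\<close>, with the value \<open>ln z\<close> at \<open>e = 0\<close>.\<close>

definition exp_slope :: "real \<Rightarrow> real" where
  "exp_slope x = (if x = 0 then 1 else (exp x - 1) / x)"

lemma isCont_exp_slope: "isCont exp_slope x"
proof (cases "x = 0")
  case True
  have "((\<lambda>h. (exp (0 + h) - exp 0) / h) \<longlongrightarrow> exp 0) (at (0::real))"
    using DERIV_exp[of 0] unfolding DERIV_def by simp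
  moreover have "\<forall>\<^sub>F h in at 0. (exp (0 + h) - exp 0) / h = exp_slope h"
    by (auto simp: exp_slope_def eventually_at intro!: exI[of _ 1])
  ultimately have "(exp_slope \<longlongrightarrow> exp 0) (at 0)" by (rule Lim_transform_eventually)
  then show ?thesis using True by (simp add: isCont_def exp_slope_def)
next
  case False
  have "isCont (\<lambda>x. (exp x - 1) / x) x" using False by (intro continuous_intros) auto
  moreover have "\<forall>\<^sub>F y in nhds x. exp_slope y = (exp y - 1) / y"
    using t1_space_nhds[OF False] by eventually_elim (simp add: exp_slope_def)
  ultimately show ?thesis by (simp only: isCont_cong)
qed

definition power_slope :: "real \<Rightarrow> real \<Rightarrow> real" where
  "power_slope e z = ln z * exp_slope (- e * ln z)"

lemma power_slope_0 [simp]: "power_slope 0 z = ln z"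
  by (simp add: power_slope_def exp_slope_def)

lemma power_slope: "z > 0 \<Longrightarrow> e * power_slope e z = 1 - z powr (- e)"
  by (auto simp: power_slope_def exp_slope_def powr_def field_simps)

lemma power_slope_has_derivative:
  assumes "z > 0"
  shows "(power_slope e has_real_derivative z powr (- e - 1)) (at z)"
proof (cases "e = 0")
  case True
  then have "power_slope e = ln" by auto
  then show ?thesis using assms True by (auto intro!: derivative_eq_intros simp: powr_minus field_simps)
next
  case False
  have "((\<lambda>z. (1 - z powr (- e)) / e) has_real_derivative z powr (- e - 1)) (at z)"
    using assms False by (auto intro!: derivative_eq_intros)
  moreover have "\<forall>\<^sub>F w in nhds z. (1 - w powr (- e)) / e = power_slope e w"
    using eventually_nhds_in_open[OF open_greaterThan, of z 0] assms
    by (auto elim!: eventually_mono simp: power_slope[symmetric] False)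
  ultimately show ?thesis using DERIV_cong_ev[OF refl, of "\<lambda>w. (1 - w powr (- e)) / e" "power_slope e"] by simp
qed

lemma continuous_on_power_slope [continuous_intros]:
  assumes "continuous_on S f" "continuous_on S g" "\<And>x. x \<in> S \<Longrightarrow> g x > 0"
  shows "continuous_on S (\<lambda>x. power_slope (f x) (g x))"
proof -
  have ec: "continuous_on UNIV exp_slope" by (simp add: isCont_exp_slope continuous_at_imp_continuous_on)
  have lnf: "continuous_on S (\<lambda>x. - f x * ln (g x))" "continuous_on S (\<lambda>x. ln (g x))"
    using assms by (auto intro!: continuous_intros simp: less_imp_neq[THEN not_sym])
  have "continuous_on S (\<lambda>x. exp_slope (- f x * ln (g x)))"
    by (rule continuous_on_compose2[OF ec lnf(1)]) auto
  then show ?thesis unfolding power_slope_def by (rule continuous_on_mult[OF lnf(2)])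
qed

definition damped_field :: "real \<Rightarrow> nat \<Rightarrow> real \<Rightarrow> real \<Rightarrow> real \<times> real \<Rightarrow> real \<times> real" where
  "damped_field K m c e = s_field 1 K 1 K 0 1 0 (- (c * e / K)) (- e) 0 (real m) 0"

lemma planar_S_system_damped_field: "K > 0 \<Longrightarrow> planar_S_system (damped_field K m c e)"
  unfolding planar_S_system_def damped_field_def
  by (rule exI[of _ 1], rule exI[of _ K], rule exI[of _ 1], rule exI[of _ K]) (simp, blast)

lemma damped_field_eq:
  "z > 0 \<Longrightarrow> y > 0 \<Longrightarrow> damped_field K m c e (z, y) =
     (y - z powr (- e), K * y powr (- (c * e / K)) - K * z ^ m)"
  by (simp add: damped_field_def s_field_def powr_realpow)

lemma powr_lipschitz_interval:
  fixes a b \<alpha> :: real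
  assumes "0 < a"
  obtains L where "L \<ge> 0" "\<And>x y. x \<in> {a..b} \<Longrightarrow> y \<in> {a..b} \<Longrightarrow> \<bar>x powr \<alpha> - y powr \<alpha>\<bar> \<le> L * \<bar>x - y\<bar>"
proof -
  have "continuous_on {a..b} (\<lambda>x. \<bar>\<alpha> * x powr (\<alpha> - 1)\<bar>)"
    using assms by (intro continuous_intros) auto
  then have "bounded ((\<lambda>x. \<bar>\<alpha> * x powr (\<alpha> - 1)\<bar>) ` {a..b})"
    by (intro compact_imp_bounded compact_continuous_image) auto
  then obtain L where L: "L > 0" "\<And>x. x \<in> {a..b} \<Longrightarrow> \<bar>\<alpha> * x powr (\<alpha> - 1)\<bar> \<le> L"
    unfolding bounded_pos by auto
  have "norm (x powr \<alpha> - y powr \<alpha>) \<le> L * norm (x - y)" if "x \<in> {a..b}" "y \<in> {a..b}" for x y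
  proof (rule field_differentiable_bound[of "{a..b}" _ "\<lambda>x. \<alpha> * x powr (\<alpha> - 1)"])
    show "((\<lambda>x. x powr \<alpha>) has_field_derivative \<alpha> * x powr (\<alpha> - 1)) (at x within {a..b})" if "x \<in> {a..b}" for x
      using that assms by (intro has_field_derivative_at_within[OF has_real_derivative_powr]) auto
  qed (use L that in auto)
  then show ?thesis using that[of L] L(1) by auto
qed

lemma lipschitz_on_boxes_damped_field:
  "lipschitz_on_boxes (\<lambda>p. k *\<^sub>R damped_field K m c e p)"
  unfolding lipschitz_on_boxes_def
proof (intro allI impI)
  fix a b :: real assume a: "0 < a"
  obtain L1 where L1: "L1 \<ge> 0" "\<And>x y. x \<in> {a..b} \<Longrightarrow> y \<in> {a..b} \<Longrightarrow> \<bar>x powr (- e) - y powr (- e)\<bar> \<le> L1 * \<bar>x - y\<bar>"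
    using powr_lipschitz_interval[OF a] by blast
  obtain L2 where L2: "L2 \<ge> 0" "\<And>x y. x \<in> {a..b} \<Longrightarrow> y \<in> {a..b} \<Longrightarrow>
      \<bar>x powr (- (c * e / K)) - y powr (- (c * e / K))\<bar> \<le> L2 * \<bar>x - y\<bar>"
    using powr_lipschitz_interval[OF a] by blast
  obtain L3 where L3: "L3 \<ge> 0" "\<And>x y. x \<in> {a..b} \<Longrightarrow> y \<in> {a..b} \<Longrightarrow> \<bar>x powr (real m) - y powr (real m)\<bar> \<le> L3 * \<bar>x - y\<bar>"
    using powr_lipschitz_interval[OF a] by blast
  let ?F = "damped_field K m c e"
  let ?C = "1 + L1 + \<bar>K\<bar> * L2 + \<bar>K\<bar> * L3"
  have "dist (k *\<^sub>R ?F p) (k *\<^sub>R ?F q) \<le> \<bar>k\<bar> * ?C * dist p q"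
    if "p \<in> {a..b} \<times> {a..b}" "q \<in> {a..b} \<times> {a..b}" for p q
  proof -
    obtain z y z' y' where pq: "p = (z, y)" "q = (z', y')" by fastforce
    have pos: "z \<in> {a..b}" "y \<in> {a..b}" "z' \<in> {a..b}" "y' \<in> {a..b}" using that pq by auto
    have pos': "z > 0" "y > 0" "z' > 0" "y' > 0" using pos a by auto
    have zy: "\<bar>z - z'\<bar> \<le> dist p q" "\<bar>y - y'\<bar> \<le> dist p q"
      using dist_fst_le[of p q] dist_snd_le[of p q] by (auto simp: pq dist_real_def)
    have "dist (?F p) (?F q) \<le> \<bar>fst (?F p) - fst (?F q)\<bar> + \<bar>snd (?F p) - snd (?F q)\<bar>"
      unfolding dist_prod_def dist_real_def by (rule order_trans[OF sqrt_sum_squares_le_sum_abs]) simp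
    also have "\<bar>fst (?F p) - fst (?F q)\<bar> \<le> \<bar>y - y'\<bar> + \<bar>z powr (- e) - z' powr (- e)\<bar>"
      using pos' by (simp add: pq damped_field_eq)
    also have "\<dots> \<le> dist p q + L1 * dist p q"
      using L1(2)[OF pos(1,3)] mult_left_mono[OF zy(1) L1(1)] zy(2) by linarith
    also have "\<bar>snd (?F p) - snd (?F q)\<bar>
        = \<bar>K * (y powr (- (c * e / K)) - y' powr (- (c * e / K))) - K * (z powr real m - z' powr real m)\<bar>"
      using pos' by (simp add: pq damped_field_eq powr_realpow algebra_simps)
    also have "\<dots> \<le> \<bar>K\<bar> * \<bar>y powr (- (c * e / K)) - y' powr (- (c * e / K))\<bar> + \<bar>K\<bar> * \<bar>z powr real m - z' powr real m\<bar>"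
      unfolding abs_mult[symmetric] by linarith
    also have "\<dots> \<le> \<bar>K\<bar> * (L2 * dist p q) + \<bar>K\<bar> * (L3 * dist p q)"
      using order_trans[OF L2(2)[OF pos(2,4)] mult_left_mono[OF zy(2) L2(1)]]
        order_trans[OF L3(2)[OF pos(1,3)] mult_left_mono[OF zy(1) L3(1)]]
      by (intro add_mono mult_left_mono) auto
    finally have "dist (?F p) (?F q) \<le> ?C * dist p q" by (simp add: algebra_simps)
    then have "\<bar>k\<bar> * dist (?F p) (?F q) \<le> \<bar>k\<bar> * (?C * dist p q)" by (intro mult_left_mono) auto
    then show ?thesis by (simp add: dist_norm mult.assoc flip: scaleR_diff_right)
  qed
  then show "\<exists>L. \<forall>p\<in>{a..b} \<times> {a..b}. \<forall>q\<in>{a..b} \<times> {a..b}. dist (k *\<^sub>R ?F p) (k *\<^sub>R ?F q) \<le> L * dist p q"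
    by blast
qed

section \<open>Polar coordinates adapted to the energy\<close>

text \<open>\<open>X z\<close> is the signed square root of twice the potential energy and \<open>\<zeta>\<close> its inverse. The assumption
  \<open>force\<close> says that half the square of \<open>X\<close> has the derivative \<open>K * (z ^ m - 1)\<close>, so in the coordinates
  \<open>(X, x2 - 1)\<close> the unperturbed orbits are circles. The bound \<open>\<beta> \<le> 1\<close> keeps them above \<open>x2 = 0\<close>.\<close>

locale energy_coordinate =
  fixes K \<beta> :: real and m :: nat and X \<zeta> \<zeta>1 \<zeta>2 :: "real \<Rightarrow> real"
  assumes K: "K > 0" and \<beta>: "0 < \<beta>" "\<beta> \<le> 1"
    and \<zeta>_pos: "\<And>x. \<bar>x\<bar> < \<beta> \<Longrightarrow> \<zeta> x > 0"
    and \<zeta>_deriv: "\<And>x. \<bar>x\<bar> < \<beta> \<Longrightarrow> (\<zeta> has_real_derivative \<zeta>1 x) (at x)"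
    and \<zeta>1_pos: "\<And>x. \<bar>x\<bar> < \<beta> \<Longrightarrow> \<zeta>1 x > 0"
    and \<zeta>1_deriv: "\<And>x. \<bar>x\<bar> < \<beta> \<Longrightarrow> (\<zeta>1 has_real_derivative \<zeta>2 x) (at x)"
    and \<zeta>2_cont: "continuous_on {-\<beta><..<\<beta>} \<zeta>2"
    and X_\<zeta>: "\<And>x. \<bar>x\<bar> < \<beta> \<Longrightarrow> X (\<zeta> x) = x"
    and \<zeta>_X: "\<And>z. z > 0 \<Longrightarrow> \<bar>X z\<bar> < \<beta> \<Longrightarrow> \<zeta> (X z) = z"
    and X_cont: "continuous_on {0<..} X"
    and force: "\<And>x. \<bar>x\<bar> < \<beta> \<Longrightarrow> x = K * (\<zeta> x ^ m - 1) * \<zeta>1 x"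
begin

definition radius :: "real \<times> real \<Rightarrow> real" where
  "radius p = sqrt ((X (fst p))\<^sup>2 + (snd p - 1)\<^sup>2)"

text \<open>The unperturbed flow turns clockwise. The sign \<open>\<sigma>\<close> treats both time directions at once: along the field
  \<open>- \<sigma> * damped_field\<close> the angle of \<open>chart \<sigma>\<close> increases.\<close>

definition chart :: "real \<Rightarrow> real \<Rightarrow> real \<Rightarrow> real \<times> real" where
  "chart \<sigma> \<theta> r = (\<zeta> (r * cos \<theta>), 1 + \<sigma> * r * sin \<theta>)"

definition ps_z :: "real \<Rightarrow> real \<Rightarrow> real \<Rightarrow> real" where
  "ps_z e \<theta> r = power_slope e (\<zeta> (r * cos \<theta>))"

definition ps_y :: "real \<Rightarrow> real \<Rightarrow> real \<Rightarrow> real \<Rightarrow> real \<Rightarrow> real" where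
  "ps_y \<sigma> c e \<theta> r = power_slope (c * e / K) (1 + \<sigma> * r * sin \<theta>)"

definition ps_w :: "real \<Rightarrow> real \<Rightarrow> real \<Rightarrow> real \<Rightarrow> real \<Rightarrow> real" where
  "ps_w \<sigma> c e \<theta> r = \<zeta>1 (r * cos \<theta>) * ps_y \<sigma> c e \<theta> r"

text \<open>\<open>slope\<close> is \<open>dr/d\<theta>\<close> divided by \<open>e\<close>, and \<open>1 + e * twist\<close> is the factor by which the perturbation
  changes the angular speed.\<close>

definition num :: "real \<Rightarrow> real \<Rightarrow> real \<Rightarrow> real \<Rightarrow> real \<Rightarrow> real" where
  "num \<sigma> c e \<theta> r = - \<sigma> * (cos \<theta> * ps_z e \<theta> r - c * \<sigma> * sin \<theta> * ps_w \<sigma> c e \<theta> r)"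

definition twist :: "real \<Rightarrow> real \<Rightarrow> real \<Rightarrow> real \<Rightarrow> real \<Rightarrow> real" where
  "twist \<sigma> c e \<theta> r = (c * cos \<theta> * ps_w \<sigma> c e \<theta> r + \<sigma> * sin \<theta> * ps_z e \<theta> r) / r"

definition slope :: "real \<Rightarrow> real \<Rightarrow> real \<Rightarrow> real \<Rightarrow> real \<Rightarrow> real" where
  "slope \<sigma> c e \<theta> r = num \<sigma> c e \<theta> r / (1 + e * twist \<sigma> c e \<theta> r)"

text \<open>Derivatives with respect to \<open>r\<close>, of \<open>ps_z\<close>, \<open>ps_w\<close>, \<open>num\<close>, \<open>twist\<close> and \<open>slope\<close>.\<close>

definition ps_z' :: "real \<Rightarrow> real \<Rightarrow> real \<Rightarrow> real" where
  "ps_z' e \<theta> r = \<zeta> (r * cos \<theta>) powr (- e - 1) * (\<zeta>1 (r * cos \<theta>) * cos \<theta>)"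

definition ps_w' :: "real \<Rightarrow> real \<Rightarrow> real \<Rightarrow> real \<Rightarrow> real \<Rightarrow> real" where
  "ps_w' \<sigma> c e \<theta> r = \<zeta>2 (r * cos \<theta>) * cos \<theta> * ps_y \<sigma> c e \<theta> r
      + (1 + \<sigma> * r * sin \<theta>) powr (- (c * e / K) - 1) * (\<sigma> * sin \<theta>) * \<zeta>1 (r * cos \<theta>)"

definition num' :: "real \<Rightarrow> real \<Rightarrow> real \<Rightarrow> real \<Rightarrow> real \<Rightarrow> real" where
  "num' \<sigma> c e \<theta> r = - \<sigma> * (cos \<theta> * ps_z' e \<theta> r - c * \<sigma> * sin \<theta> * ps_w' \<sigma> c e \<theta> r)"

definition twist' :: "real \<Rightarrow> real \<Rightarrow> real \<Rightarrow> real \<Rightarrow> real \<Rightarrow> real" where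
  "twist' \<sigma> c e \<theta> r = ((c * cos \<theta> * ps_w' \<sigma> c e \<theta> r + \<sigma> * sin \<theta> * ps_z' e \<theta> r) - twist \<sigma> c e \<theta> r) / r"

definition slope' :: "real \<Rightarrow> real \<Rightarrow> real \<Rightarrow> real \<Rightarrow> real \<Rightarrow> real" where
  "slope' \<sigma> c e \<theta> r = (num' \<sigma> c e \<theta> r * (1 + e * twist \<sigma> c e \<theta> r) - num \<sigma> c e \<theta> r * (e * twist' \<sigma> c e \<theta> r))
      / (1 + e * twist \<sigma> c e \<theta> r)\<^sup>2"

lemmas chart_defs = chart_def ps_z_def ps_y_def ps_w_def num_def twist_def slope_def
  ps_z'_def ps_w'_def num'_def twist'_def slope'_def

lemma r_cos:
  assumes "r \<in> {0<..<\<beta>}"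
  shows "\<bar>r * cos \<theta>\<bar> < \<beta>"
proof -
  have "\<bar>r * cos \<theta>\<bar> \<le> r * 1" unfolding abs_mult using assms by (intro mult_mono) auto
  then show ?thesis using assms by auto
qed

lemma y_pos:
  assumes "r \<in> {0<..<\<beta>}" "\<sigma> \<in> {1, -1}"
  shows "1 + \<sigma> * r * sin \<theta> > 0"
proof -
  have "\<bar>\<sigma> * r * sin \<theta>\<bar> \<le> 1 * r * 1" unfolding abs_mult using assms by (intro mult_mono) auto
  then show ?thesis using assms(1) \<beta> unfolding greaterThanLessThan_iff by linarith
qed

lemma continuous_on_coordinate:
  fixes S :: "(real \<times> real \<times> real) set"
  assumes "S \<subseteq> {p. snd (snd p) \<in> {0<..<\<beta>}}"
  shows "continuous_on S (\<lambda>p. \<zeta> (snd (snd p) * cos (fst (snd p))))"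
    "continuous_on S (\<lambda>p. \<zeta>1 (snd (snd p) * cos (fst (snd p))))"
    "continuous_on S (\<lambda>p. \<zeta>2 (snd (snd p) * cos (fst (snd p))))"
proof -
  let ?I = "{-\<beta><..<\<beta>}"
  have c: "continuous_on S (\<lambda>p. snd (snd p) * cos (fst (snd p)))" by (intro continuous_intros)
  have r: "(\<lambda>p. snd (snd p) * cos (fst (snd p))) ` S \<subseteq> ?I"
  proof (rule image_subsetI)
    fix p assume "p \<in> S"
    then have "\<bar>snd (snd p) * cos (fst (snd p))\<bar> < \<beta>" using assms by (intro r_cos) auto
    then show "snd (snd p) * cos (fst (snd p)) \<in> ?I" by (auto simp: abs_less_iff)
  qed
  have "continuous_on ?I \<zeta>"
    by (rule DERIV_continuous_on[OF has_field_derivative_at_within[OF \<zeta>_deriv]]) (auto simp: abs_less_iff)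
  then show "continuous_on S (\<lambda>p. \<zeta> (snd (snd p) * cos (fst (snd p))))"
    by (rule continuous_on_compose2[OF _ c r])
  have "continuous_on ?I \<zeta>1"
    by (rule DERIV_continuous_on[OF has_field_derivative_at_within[OF \<zeta>1_deriv]]) (auto simp: abs_less_iff)
  then show "continuous_on S (\<lambda>p. \<zeta>1 (snd (snd p) * cos (fst (snd p))))"
    by (rule continuous_on_compose2[OF _ c r])
  show "continuous_on S (\<lambda>p. \<zeta>2 (snd (snd p) * cos (fst (snd p))))"
    by (rule continuous_on_compose2[OF \<zeta>2_cont c r])
qed

lemma continuous_on_parts:
  fixes S :: "(real \<times> real \<times> real) set"
  assumes S: "S \<subseteq> {p. snd (snd p) \<in> {0<..<\<beta>}}" and \<sigma>: "\<sigma> \<in> {1, -1}"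
  shows "continuous_on S (\<lambda>(e, \<theta>, r). num \<sigma> c e \<theta> r)" "continuous_on S (\<lambda>(e, \<theta>, r). twist \<sigma> c e \<theta> r)"
    "continuous_on S (\<lambda>(e, \<theta>, r). num' \<sigma> c e \<theta> r)" "continuous_on S (\<lambda>(e, \<theta>, r). twist' \<sigma> c e \<theta> r)"
proof -
  note z = continuous_on_coordinate[OF S]
  have zp: "\<zeta> (snd (snd p) * cos (fst (snd p))) > 0" if "p \<in> S" for p
    using S that by (intro \<zeta>_pos r_cos) auto
  have yp: "1 + \<sigma> * snd (snd p) * sin (fst (snd p)) > 0" if "p \<in> S" for p
    using S that \<sigma> by (intro y_pos) auto
  have nz: "\<forall>p\<in>S. \<zeta> (snd (snd p) * cos (fst (snd p))) \<noteq> 0" "\<forall>p\<in>S. 1 + \<sigma> * snd (snd p) * sin (fst (snd p)) \<noteq> 0"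
      "\<forall>p\<in>S. snd (snd p) \<noteq> 0" "\<forall>p\<in>S. K \<noteq> 0"
  proof -
    show "\<forall>p\<in>S. \<zeta> (snd (snd p) * cos (fst (snd p))) \<noteq> 0" using zp less_imp_neq by metis
    show "\<forall>p\<in>S. 1 + \<sigma> * snd (snd p) * sin (fst (snd p)) \<noteq> 0" using yp less_imp_neq by metis
    show "\<forall>p\<in>S. snd (snd p) \<noteq> 0" using S by auto
    show "\<forall>p\<in>S. K \<noteq> 0" using K by simp
  qed
  have tr: "continuous_on S (\<lambda>p. cos (fst (snd p)))" "continuous_on S (\<lambda>p. sin (fst (snd p)))"
    "continuous_on S (\<lambda>p. snd (snd p))" "continuous_on S (\<lambda>p. fst p)"
    by (intro continuous_intros)+
  note ops = continuous_on_add continuous_on_mult continuous_on_diff continuous_on_minus continuous_on_divide continuous_on_const tr nz(3)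
  have y: "continuous_on S (\<lambda>p. 1 + \<sigma> * snd (snd p) * sin (fst (snd p)))"
      "continuous_on S (\<lambda>p. c * fst p / K)" by (intro ops nz)+
  have u: "continuous_on S (\<lambda>p. ps_z (fst p) (fst (snd p)) (snd (snd p)))"
    unfolding ps_z_def by (rule continuous_on_power_slope[OF tr(4) z(1) zp])
  have v: "continuous_on S (\<lambda>p. ps_y \<sigma> c (fst p) (fst (snd p)) (snd (snd p)))"
    unfolding ps_y_def by (rule continuous_on_power_slope[OF y(2,1) yp])
  have w: "continuous_on S (\<lambda>p. ps_w \<sigma> c (fst p) (fst (snd p)) (snd (snd p)))"
    unfolding ps_w_def by (rule continuous_on_mult[OF z(2) v])
  have u': "continuous_on S (\<lambda>p. ps_z' (fst p) (fst (snd p)) (snd (snd p)))"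
    unfolding ps_z'_def by (intro ops continuous_on_powr z nz)
  have w': "continuous_on S (\<lambda>p. ps_w' \<sigma> c (fst p) (fst (snd p)) (snd (snd p)))"
    unfolding ps_w'_def
    by (intro ops continuous_on_powr z v y nz)
  show "continuous_on S (\<lambda>(e, \<theta>, r). num \<sigma> c e \<theta> r)"
    unfolding num_def split_beta by (intro ops u w)
  show "continuous_on S (\<lambda>(e, \<theta>, r). num' \<sigma> c e \<theta> r)"
    unfolding num'_def split_beta by (intro ops u' w')
  have t: "continuous_on S (\<lambda>p. twist \<sigma> c (fst p) (fst (snd p)) (snd (snd p)))"
    unfolding twist_def by (intro ops u w)
  then show "continuous_on S (\<lambda>(e, \<theta>, r). twist \<sigma> c e \<theta> r)" unfolding split_beta .
  show "continuous_on S (\<lambda>(e, \<theta>, r). twist' \<sigma> c e \<theta> r)"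
    unfolding twist'_def split_beta by (intro ops u' w' t)
qed

lemma slope_has_derivative:
  assumes r: "r \<in> {0<..<\<beta>}" and \<sigma>: "\<sigma> \<in> {1, -1}" and nz: "1 + e * twist \<sigma> c e \<theta> r \<noteq> 0"
  shows "(slope \<sigma> c e \<theta> has_real_derivative slope' \<sigma> c e \<theta> r) (at r)"
proof -
  have i: "((\<lambda>r. r * cos \<theta>) has_real_derivative cos \<theta>) (at r)"
    and j: "((\<lambda>r. 1 + \<sigma> * r * sin \<theta>) has_real_derivative \<sigma> * sin \<theta>) (at r)"
    by (auto intro!: derivative_eq_intros)
  have z: "((\<lambda>r. \<zeta> (r * cos \<theta>)) has_real_derivative \<zeta>1 (r * cos \<theta>) * cos \<theta>) (at r)"
    by (rule DERIV_chain'[OF i \<zeta>_deriv[OF r_cos[OF r]]])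
  have z1: "((\<lambda>r. \<zeta>1 (r * cos \<theta>)) has_real_derivative \<zeta>2 (r * cos \<theta>) * cos \<theta>) (at r)"
    by (rule DERIV_chain'[OF i \<zeta>1_deriv[OF r_cos[OF r]]])
  have u: "(ps_z e \<theta> has_real_derivative ps_z' e \<theta> r) (at r)"
    unfolding ps_z_def ps_z'_def
    by (rule DERIV_chain'[OF z power_slope_has_derivative[OF \<zeta>_pos[OF r_cos[OF r]]]])
  have v: "(ps_y \<sigma> c e \<theta> has_real_derivative
      (1 + \<sigma> * r * sin \<theta>) powr (- (c * e / K) - 1) * (\<sigma> * sin \<theta>)) (at r)"
    unfolding ps_y_def
    by (rule DERIV_chain'[OF j power_slope_has_derivative[OF y_pos[OF r \<sigma>]]])
  have w: "(ps_w \<sigma> c e \<theta> has_real_derivative ps_w' \<sigma> c e \<theta> r) (at r)"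
  proof -
    have "ps_w \<sigma> c e \<theta> = (\<lambda>r. \<zeta>1 (r * cos \<theta>) * ps_y \<sigma> c e \<theta> r)" by (simp add: ps_w_def fun_eq_iff)
    then show ?thesis unfolding ps_w'_def using DERIV_mult[OF z1 v] by simp
  qed
  have lin: "((\<lambda>r. A * ps_z e \<theta> r + B * ps_w \<sigma> c e \<theta> r) has_real_derivative
      A * ps_z' e \<theta> r + B * ps_w' \<sigma> c e \<theta> r) (at r)" for A B
    by (rule DERIV_add[OF DERIV_cmult[OF u] DERIV_cmult[OF w]])
  have n: "(num \<sigma> c e \<theta> has_real_derivative num' \<sigma> c e \<theta> r) (at r)"
  proof -
    have "num \<sigma> c e \<theta> = (\<lambda>r. (- \<sigma> * cos \<theta>) * ps_z e \<theta> r + (\<sigma> * c * \<sigma> * sin \<theta>) * ps_w \<sigma> c e \<theta> r)"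
      by (simp add: num_def fun_eq_iff algebra_simps)
    moreover have "num' \<sigma> c e \<theta> r = (- \<sigma> * cos \<theta>) * ps_z' e \<theta> r + (\<sigma> * c * \<sigma> * sin \<theta>) * ps_w' \<sigma> c e \<theta> r"
      by (simp add: num'_def algebra_simps)
    ultimately show ?thesis using lin by (simp only:)
  qed
  have t: "(twist \<sigma> c e \<theta> has_real_derivative twist' \<sigma> c e \<theta> r) (at r)"
  proof -
    have "twist \<sigma> c e \<theta> = (\<lambda>r. ((\<sigma> * sin \<theta>) * ps_z e \<theta> r + (c * cos \<theta>) * ps_w \<sigma> c e \<theta> r) / r)"
      by (simp add: twist_def fun_eq_iff add.commute)
    moreover have "twist' \<sigma> c e \<theta> r =
       (((\<sigma> * sin \<theta>) * ps_z' e \<theta> r + (c * cos \<theta>) * ps_w' \<sigma> c e \<theta> r) * r -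
        ((\<sigma> * sin \<theta>) * ps_z e \<theta> r + (c * cos \<theta>) * ps_w \<sigma> c e \<theta> r) * 1) / (r * r)"
      using r by (simp add: twist'_def twist_def field_simps)
    moreover have "r \<noteq> 0" using r by auto
    ultimately show ?thesis using DERIV_divide[OF lin DERIV_ident] by simp
  qed
  have d: "((\<lambda>r. 1 + e * twist \<sigma> c e \<theta> r) has_real_derivative e * twist' \<sigma> c e \<theta> r) (at r)"
    by (rule DERIV_add[OF DERIV_const DERIV_cmult[OF t], THEN DERIV_cong]) simp
  from DERIV_divide[OF n d nz] show ?thesis
    unfolding slope_def slope'_def by (simp add: power2_eq_square)
qed

end

text \<open>The algebra behind \<open>chart_flow\<close>: with \<open>u\<close> and \<open>w\<close> for the two components of the perturbation, polar
  components are turned back into Cartesian ones.\<close>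

lemma rotation_identities:
  fixes C S \<sigma> e u c w r :: real
  assumes "C * C + S * S = 1" "\<sigma> * \<sigma> = 1"
  shows "e * (- \<sigma> * (C * u - c * \<sigma> * S * w)) * C - (r + e * (c * C * w + \<sigma> * S * u)) * S = - \<sigma> * (\<sigma> * r * S + e * u)"
    and "e * (- \<sigma> * (C * u - c * \<sigma> * S * w)) * S + (r + e * (c * C * w + \<sigma> * S * u)) * C = r * C + c * e * w"
  using assms by algebra+

context energy_coordinate
begin

lemma parts_periodic:
  "num \<sigma> c e (\<theta> + 2 * pi) r = num \<sigma> c e \<theta> r" "twist \<sigma> c e (\<theta> + 2 * pi) r = twist \<sigma> c e \<theta> r"
  "slope \<sigma> c e (\<theta> + 2 * pi) r = slope \<sigma> c e \<theta> r" "slope' \<sigma> c e (\<theta> + 2 * pi) r = slope' \<sigma> c e \<theta> r"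
  "chart \<sigma> (\<theta> + 2 * pi) r = chart \<sigma> \<theta> r"
  by (simp_all add: chart_defs)

lemma chart_flow:
  assumes s: "s \<theta> \<in> {0<..<\<beta>}" "(s has_real_derivative e * slope \<sigma> c e \<theta> (s \<theta>)) (at \<theta>)"
    and \<sigma>: "\<sigma> \<in> {1, -1}" and nz: "1 + e * twist \<sigma> c e \<theta> (s \<theta>) > 0"
  shows "((\<lambda>\<theta>. chart \<sigma> \<theta> (s \<theta>)) has_vector_derivative
     (1 / ((1 + e * twist \<sigma> c e \<theta> (s \<theta>)) / \<zeta>1 (s \<theta> * cos \<theta>))) *\<^sub>R ((- \<sigma>) *\<^sub>R damped_field K m c e (chart \<sigma> \<theta> (s \<theta>)))) (at \<theta>)"
proof -
  let ?r = "s \<theta>" and ?C = "cos \<theta>" and ?S = "sin \<theta>"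
  define z y q u v D where "z = \<zeta> (?r * ?C)" and "y = 1 + \<sigma> * ?r * ?S" and "q = \<zeta>1 (?r * ?C)"
    and "u = ps_z e \<theta> ?r" and "v = ps_y \<sigma> c e \<theta> ?r" and "D = 1 + e * twist \<sigma> c e \<theta> ?r"
  note rc = r_cos[OF s(1), of \<theta>]
  have q: "q > 0" unfolding q_def by (rule \<zeta>1_pos[OF rc])
  have zy: "z > 0" "y > 0" using \<zeta>_pos[OF rc] y_pos[OF s(1) \<sigma>] by (auto simp: z_def y_def)
  have \<sigma>2: "\<sigma> * \<sigma> = 1" using \<sigma> by auto
  have CS: "?C * ?C + ?S * ?S = 1" using sin_cos_squared_add2[of \<theta>] by (simp only: power2_eq_square)
  have eu: "e * u = 1 - z powr (- e)" unfolding u_def ps_z_def z_def[symmetric] by (rule power_slope[OF zy(1)])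
  have "c * e / K * v = 1 - y powr (- (c * e / K))" unfolding v_def ps_y_def y_def[symmetric] by (rule power_slope[OF zy(2)])
  then have ev: "c * e * v = K - K * y powr (- (c * e / K))" using K by (simp add: field_simps)
  have F: "damped_field K m c e (chart \<sigma> \<theta> ?r) = (\<sigma> * ?r * ?S + e * u, - (c * e * v) - K * (z ^ m - 1))"
    unfolding chart_def z_def[symmetric] y_def[symmetric] damped_field_eq[OF zy] using eu ev by (simp add: y_def algebra_simps)
  have fo: "K * (z ^ m - 1) * q = ?r * ?C" using force[OF rc] by (simp add: z_def q_def)
  have rD: "?r * D = ?r + e * (c * ?C * (q * v) + \<sigma> * ?S * u)"
    using s(1) by (simp add: D_def twist_def ps_w_def u_def v_def q_def field_simps)
  have sl: "D * (e * slope \<sigma> c e \<theta> ?r) = e * (- \<sigma> * (?C * u - c * \<sigma> * ?S * (q * v)))"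
    using nz by (simp add: slope_def D_def num_def ps_w_def u_def v_def q_def)
  let ?s' = "e * slope \<sigma> c e \<theta> ?r"
  have D: "D > 0" using nz by (simp add: D_def)
  have cancel: "x * a = (x / D) * b" if "D * a = b" for a b x using D that by auto
  have "((\<lambda>\<theta>. \<zeta> (s \<theta> * cos \<theta>)) has_real_derivative q * (?s' * ?C - ?r * ?S)) (at \<theta>)"
  proof -
    have "((\<lambda>\<theta>. s \<theta> * cos \<theta>) has_real_derivative ?s' * ?C - ?r * ?S) (at \<theta>)"
      by (auto intro!: derivative_eq_intros s(2))
    from DERIV_chain'[OF this \<zeta>_deriv[OF rc]] show ?thesis by (simp add: q_def)
  qed
  moreover have "q * (?s' * ?C - ?r * ?S) = (q / D) * (- \<sigma> * (\<sigma> * ?r * ?S + e * u))"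
  proof -
    have "D * (?s' * ?C - ?r * ?S) = (D * ?s') * ?C - (?r * D) * ?S" by (simp add: algebra_simps)
    also have "\<dots> = - \<sigma> * (\<sigma> * ?r * ?S + e * u)"
      unfolding sl rD by (rule rotation_identities[OF CS \<sigma>2])
    finally show ?thesis by (rule cancel)
  qed
  ultimately have 1: "((\<lambda>\<theta>. \<zeta> (s \<theta> * cos \<theta>)) has_real_derivative (q / D) * (- \<sigma> * (\<sigma> * ?r * ?S + e * u))) (at \<theta>)" by simp
  have "((\<lambda>\<theta>. 1 + \<sigma> * s \<theta> * sin \<theta>) has_real_derivative \<sigma> * (?s' * ?S + ?r * ?C)) (at \<theta>)"
    by (auto intro!: derivative_eq_intros s(2) simp: algebra_simps)
  moreover have "\<sigma> * (?s' * ?S + ?r * ?C) = (q / D) * (- \<sigma> * (- (c * e * v) - K * (z ^ m - 1)))"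
  proof -
    have "D * (?s' * ?S + ?r * ?C) = (D * ?s') * ?S + (?r * D) * ?C" by (simp add: algebra_simps)
    also have "\<dots> = ?r * ?C + c * e * (q * v)"
      unfolding sl rD by (rule rotation_identities[OF CS \<sigma>2])
    also have "\<dots> = q * (c * e * v + K * (z ^ m - 1))" unfolding fo[symmetric] by (simp add: algebra_simps)
    finally have "D * (?s' * ?S + ?r * ?C) = q * (c * e * v + K * (z ^ m - 1))" .
    from cancel[OF this, of \<sigma>] show ?thesis by (simp add: algebra_simps)
  qed
  ultimately have 2: "((\<lambda>\<theta>. 1 + \<sigma> * s \<theta> * sin \<theta>) has_real_derivative
      (q / D) * (- \<sigma> * (- (c * e * v) - K * (z ^ m - 1)))) (at \<theta>)" by simp
  show ?thesis
    using has_vector_derivative_Pair[OF 1[unfolded has_real_derivative_iff_has_vector_derivative]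
        2[unfolded has_real_derivative_iff_has_vector_derivative]] q D
    unfolding F D_def[symmetric] q_def[symmetric] by (simp add: chart_def)
qed

lemma chart_radius:
  assumes r: "r \<in> {0<..<\<beta>}" and \<sigma>: "\<sigma> \<in> {1, -1}"
  shows "radius (chart \<sigma> \<theta> r) = r"
proof -
  have "(r * cos \<theta>)\<^sup>2 + (\<sigma> * r * sin \<theta>)\<^sup>2 = r\<^sup>2 * ((cos \<theta>)\<^sup>2 + (sin \<theta>)\<^sup>2)"
  proof -
    have "\<sigma>\<^sup>2 = 1" using \<sigma> by auto
    then show ?thesis unfolding power_mult_distrib by (simp only: distrib_left mult_1)
  qed
  then show ?thesis using r by (simp add: radius_def chart_def X_\<zeta>[OF r_cos[OF r]])
qed

lemma chart_of_radius:
  assumes p: "p \<in> quadrant" and r: "radius p \<in> {0<..<\<beta>}" and \<sigma>: "\<sigma> \<in> {1, -1}"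
  shows "\<exists>\<theta>. p = chart \<sigma> \<theta> (radius p)"
proof -
  obtain z y where zy: "p = (z, y)" by fastforce
  define R where "R = radius p"
  have R: "R > 0" "R < \<beta>" using r by (auto simp: R_def)
  have R2: "(X z)\<^sup>2 + (y - 1)\<^sup>2 = R\<^sup>2" by (simp add: R_def radius_def zy)
  have \<sigma>2: "\<sigma>\<^sup>2 = 1" "\<sigma> * \<sigma> = 1" using \<sigma> by auto
  have "(X z / R)\<^sup>2 + (\<sigma> * (y - 1) / R)\<^sup>2 = ((X z)\<^sup>2 + (y - 1)\<^sup>2) / R\<^sup>2"
    by (simp add: power_divide power_mult_distrib \<sigma>2 add_divide_distrib)
  also have "\<dots> = 1" unfolding R2 using R by simp
  finally obtain \<theta> where \<theta>: "X z / R = cos \<theta>" "\<sigma> * (y - 1) / R = sin \<theta>"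
    by (rule sincos_total_2pi)
  have "(X z)\<^sup>2 \<le> R\<^sup>2" using R2 zero_le_power2[of "y - 1"] by linarith
  then have "\<bar>X z\<bar> < \<beta>" using R by (simp add: abs_le_square_iff[symmetric])
  then have z: "\<zeta> (X z) = z" using \<zeta>_X p by (simp add: zy mem_quadrant)
  have "R * cos \<theta> = X z" "R * sin \<theta> = \<sigma> * (y - 1)" using \<theta> R by (auto simp: field_simps)
  moreover have "1 + \<sigma> * (\<sigma> * (y - 1)) = y" using \<sigma>2 by (simp add: mult.assoc[symmetric])
  ultimately have "p = chart \<sigma> \<theta> R" by (simp add: chart_def zy z mult.assoc)
  then show ?thesis unfolding R_def by blast
qed

text \<open>The time change and the distances in the plane are controlled by compactness of \<open>[a, b]\<close> inside
  \<open>(0, \<beta>)\<close>.\<close>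

lemma polar_chart_damped_field:
  assumes ab: "0 < a" "b < \<beta>" and \<sigma>: "\<sigma> \<in> {1, -1}" and e: "e \<in> {0..e1}"
    and tw: "\<And>\<theta> r. r \<in> {a..b} \<Longrightarrow> 1 + e * twist \<sigma> c e \<theta> r > 0"
  obtains W M where "polar_chart (\<lambda>p. (- \<sigma>) *\<^sub>R damped_field K m c e p) (chart \<sigma>) radius (2 * pi) a b
     (\<lambda>\<theta> r. e * slope \<sigma> c e \<theta> r) (\<lambda>\<theta> r. (1 + e * twist \<sigma> c e \<theta> r) / \<zeta>1 (r * cos \<theta>)) W M"
proof -
  let ?\<Omega> = "\<lambda>\<theta> r. (1 + e * twist \<sigma> c e \<theta> r) / \<zeta>1 (r * cos \<theta>)"
  have in0: "r \<in> {0<..<\<beta>}" if "r \<in> {a..b}" for r using that ab by auto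
  let ?S = "{0..e1} \<times> UNIV \<times> {a..b} :: (real \<times> real \<times> real) set"
  have S: "?S \<subseteq> {p. snd (snd p) \<in> {0<..<\<beta>}}" using ab by auto
  have "continuous_on ?S (\<lambda>p. (1 + e * twist \<sigma> c e (fst (snd p)) (snd (snd p))) / \<zeta>1 (snd (snd p) * cos (fst (snd p))))"
  proof (intro continuous_on_divide continuous_on_add continuous_on_mult continuous_on_const
      continuous_on_coordinate[OF S] ballI)
    have "continuous_on ?S (\<lambda>p. (\<lambda>(e, \<theta>, r). twist \<sigma> c e \<theta> r) (e, fst (snd p), snd (snd p)))"
      by (rule continuous_on_compose2[OF continuous_on_parts(2)[OF S \<sigma>]]) (use e in \<open>auto intro!: continuous_intros\<close>)
    then show "continuous_on ?S (\<lambda>p. twist \<sigma> c e (fst (snd p)) (snd (snd p)))" by (simp add: split_beta)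
    fix p assume "p \<in> ?S"
    then have "\<zeta>1 (snd (snd p) * cos (fst (snd p))) > 0" using S by (intro \<zeta>1_pos r_cos) blast
    then show "\<zeta>1 (snd (snd p) * cos (fst (snd p))) \<noteq> 0" by simp
  qed
  then have \<Omega>c: "continuous_on ?S (\<lambda>(e'::real, \<theta>, r). ?\<Omega> \<theta> r)" unfolding split_beta .
  obtain W where W: "W > 0" "\<And>\<theta> r. r \<in> {a..b} \<Longrightarrow> \<bar>?\<Omega> \<theta> r\<bar> \<le> W"
  proof -
    have "?\<Omega> (\<theta> + 2 * pi) r = ?\<Omega> \<theta> r" for \<theta> r by (simp add: parts_periodic)
    moreover have "2 * pi > 0" by simp
    ultimately obtain W where "W > 0" "\<And>e' r \<theta>. \<lbrakk>e' \<in> {0..e1}; r \<in> {a..b}\<rbrakk> \<Longrightarrow> \<bar>?\<Omega> \<theta> r\<bar> \<le> W"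
      by (rule periodic_family_bounded[OF \<Omega>c]) blast
    then show ?thesis using that[of W] e by blast
  qed
  have "continuous_on {-b..b} \<zeta>1"
    by (rule DERIV_continuous_on[OF has_field_derivative_at_within[OF \<zeta>1_deriv]]) (use ab in auto)
  then have "compact (\<zeta>1 ` {-b..b})" by (rule compact_continuous_image) auto
  then obtain Z where Z: "Z > 0" "\<And>x. x \<in> {-b..b} \<Longrightarrow> \<bar>\<zeta>1 x\<bar> \<le> Z"
  proof -
    obtain Z where "Z > 0" "\<forall>y\<in>\<zeta>1 ` {-b..b}. norm y \<le> Z"
      using compact_imp_bounded[OF \<open>compact (\<zeta>1 ` {-b..b})\<close>] unfolding bounded_pos by blast
    then show ?thesis using that[of Z] by auto
  qed
  have lip\<zeta>: "norm (\<zeta> x - \<zeta> y) \<le> Z * norm (x - y)" if "x \<in> {-b..b}" "y \<in> {-b..b}" for x y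
    by (rule field_differentiable_bound[of "{-b..b}" \<zeta> \<zeta>1])
       (use that Z ab in \<open>auto intro!: has_field_derivative_at_within[OF \<zeta>_deriv]\<close>)
  show ?thesis
  proof (rule that[of W "Z + 1"], unfold_locales)
    show "lipschitz_on_boxes (\<lambda>p. (- \<sigma>) *\<^sub>R damped_field K m c e p)" by (rule lipschitz_on_boxes_damped_field)
    show "2 * pi > 0" by simp
    show "chart \<sigma> \<theta> r \<in> quadrant" if "r \<in> {a<..<b}" for \<theta> r
    proof -
      have r: "r \<in> {0<..<\<beta>}" using that ab by auto
      show ?thesis using \<zeta>_pos[OF r_cos[OF r]] y_pos[OF r \<sigma>] by (simp add: mem_quadrant chart_def)
    qed
    show "chart \<sigma> (\<theta> + 2 * pi) r = chart \<sigma> \<theta> r" "?\<Omega> (\<theta> + 2 * pi) r = ?\<Omega> \<theta> r" for \<theta> r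
      by (simp_all add: parts_periodic)
    show "continuous_on (UNIV \<times> {a<..<b}) (\<lambda>(\<theta>, r). ?\<Omega> \<theta> r)"
    proof -
      have "continuous_on (UNIV \<times> {a<..<b}) (\<lambda>q. (\<lambda>(e'::real, \<theta>, r). ?\<Omega> \<theta> r) (e, q))"
        by (rule continuous_on_compose2[OF \<Omega>c]) (use e in \<open>auto intro!: continuous_intros\<close>)
      then show ?thesis by simp
    qed
    show "0 < ?\<Omega> \<theta> r \<and> ?\<Omega> \<theta> r \<le> W" if "r \<in> {a<..<b}" for \<theta> r
    proof -
      have r: "r \<in> {a..b}" using that by auto
      have "0 < ?\<Omega> \<theta> r" using tw[OF r] \<zeta>1_pos[OF r_cos[OF in0[OF r]]] by simp
      then show ?thesis using W(2)[OF r, of \<theta>] by linarith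
    qed
    show "((\<lambda>\<theta>. chart \<sigma> \<theta> (s \<theta>)) has_vector_derivative (1 / ?\<Omega> \<theta> (s \<theta>)) *\<^sub>R ((- \<sigma>) *\<^sub>R damped_field K m c e (chart \<sigma> \<theta> (s \<theta>)))) (at \<theta>)"
      if "s \<theta> \<in> {a<..<b}" "(s has_real_derivative e * slope \<sigma> c e \<theta> (s \<theta>)) (at \<theta>)" for s \<theta>
      by (rule chart_flow[OF _ that(2) \<sigma>]) (use that ab tw in auto)
    show "dist (chart \<sigma> \<theta> r) (chart \<sigma> \<theta> r') \<le> (Z + 1) * \<bar>r - r'\<bar>" if "r \<in> {a<..<b}" "r' \<in> {a<..<b}" for \<theta> r r'
    proof -
      have mem: "x * cos \<theta> \<in> {-b..b}" if "x \<in> {a<..<b}" for x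
      proof -
        have "\<bar>x * cos \<theta>\<bar> \<le> x * 1" unfolding abs_mult using that ab by (intro mult_mono) auto
        then show ?thesis using that unfolding greaterThanLessThan_iff atLeastAtMost_iff by linarith
      qed
      have "\<bar>\<zeta> (r * cos \<theta>) - \<zeta> (r' * cos \<theta>)\<bar> \<le> Z * (\<bar>r - r'\<bar> * \<bar>cos \<theta>\<bar>)"
        using lip\<zeta>[OF mem mem] that by (simp add: abs_mult flip: left_diff_distrib)
      also have "\<dots> \<le> Z * (\<bar>r - r'\<bar> * 1)" using Z by (intro mult_left_mono) auto
      finally have 1: "\<bar>\<zeta> (r * cos \<theta>) - \<zeta> (r' * cos \<theta>)\<bar> \<le> Z * \<bar>r - r'\<bar>" by simp
      have "\<bar>(1 + \<sigma> * r * sin \<theta>) - (1 + \<sigma> * r' * sin \<theta>)\<bar> = \<bar>\<sigma>\<bar> * \<bar>r - r'\<bar> * \<bar>sin \<theta>\<bar>"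
        by (simp add: abs_mult[symmetric] algebra_simps)
      also have "\<dots> \<le> 1 * \<bar>r - r'\<bar> * 1" using \<sigma> by (intro mult_mono) auto
      finally have 2: "\<bar>(1 + \<sigma> * r * sin \<theta>) - (1 + \<sigma> * r' * sin \<theta>)\<bar> \<le> \<bar>r - r'\<bar>" by simp
      have "dist (chart \<sigma> \<theta> r) (chart \<sigma> \<theta> r') \<le> \<bar>\<zeta> (r * cos \<theta>) - \<zeta> (r' * cos \<theta>)\<bar> + \<bar>(1 + \<sigma> * r * sin \<theta>) - (1 + \<sigma> * r' * sin \<theta>)\<bar>"
        unfolding chart_def dist_Pair_Pair dist_real_def by (rule order_trans[OF sqrt_sum_squares_le_sum_abs]) simp
      then show ?thesis using 1 2 by (simp add: algebra_simps)
    qed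
    show "continuous_on quadrant radius"
    proof -
      have "continuous_on quadrant (\<lambda>p. X (fst p))"
        by (rule continuous_on_compose2[OF X_cont]) (auto intro!: continuous_intros simp: mem_quadrant)
      then show ?thesis unfolding radius_def by (intro continuous_intros)
    qed
    show "radius (chart \<sigma> \<theta> r) = r" if "r \<in> {a<..<b}" for \<theta> r
      using that ab \<sigma> by (intro chart_radius) auto
    show "\<exists>\<theta>. p = chart \<sigma> \<theta> (radius p)" if "p \<in> quadrant" "radius p \<in> {a<..<b}" for p
      using that ab \<sigma> by (intro chart_of_radius) auto
    show "chart \<sigma> 0 r \<noteq> chart \<sigma> (2 * pi / 2) r'" if "r \<in> {a<..<b}" "r' \<in> {a<..<b}" for r r'
    proof
      assume "chart \<sigma> 0 r = chart \<sigma> (2 * pi / 2) r'"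
      then have "\<zeta> r = \<zeta> (- r')" by (simp add: chart_def)
      then have "X (\<zeta> r) = X (\<zeta> (- r'))" by simp
      then show False using X_\<zeta>[of r] X_\<zeta>[of "- r'"] that ab by auto
    qed
  qed
qed

theorem averaged_limit_cycle:
  assumes r0: "r0 \<in> {0<..<\<beta>}" and \<sigma>: "\<sigma> \<in> {1, -1}" and "\<delta> > 0"
    and mean: "integral {0..2 * pi} (\<lambda>\<theta>. slope \<sigma> c 0 \<theta> r0) = 0"
    and neg: "integral {0..2 * pi} (\<lambda>\<theta>. slope' \<sigma> c 0 \<theta> r0) < 0"
  obtains e0 where "e0 > 0" "\<And>e. \<lbrakk>0 < e; e < e0\<rbrakk> \<Longrightarrow>
    \<exists>\<Gamma>. stable_limit_cycle (\<lambda>p. (- \<sigma>) *\<^sub>R damped_field K m c e p) \<Gamma> \<and> \<Gamma> \<noteq> {} \<and> (\<forall>p\<in>\<Gamma>. \<bar>radius p - r0\<bar> < \<delta>)"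
proof -
  define a b where "a = r0 / 2" and "b = (r0 + \<beta>) / 2"
  have ab: "0 < a" "b < \<beta>" "a < r0" "r0 < b" using r0 by (auto simp: a_def b_def)
  define \<delta>' where "\<delta>' = min \<delta> (min (r0 - a) (b - r0)) / 2"
  have \<delta>': "\<delta>' > 0" "\<delta>' \<le> \<delta>" "a < r0 - \<delta>'" "r0 + \<delta>' < b" 
  proof -
    have *: "2 * \<delta>' \<le> \<delta>" "2 * \<delta>' \<le> r0 - a" "2 * \<delta>' \<le> b - r0" by (simp_all add: \<delta>'_def)
    show "\<delta>' > 0" using \<open>\<delta> > 0\<close> ab by (simp add: \<delta>'_def)
    then show "\<delta>' \<le> \<delta>" "a < r0 - \<delta>'" "r0 + \<delta>' < b" using * ab by linarith+
  qed
  let ?S = "\<lambda>e1. {0..e1} \<times> UNIV \<times> {a..b} :: (real \<times> real \<times> real) set"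
  have S: "?S e1 \<subseteq> {p. snd (snd p) \<in> {0<..<\<beta>}}" for e1 using ab by auto
  obtain B where B: "B > 0" "\<And>e r \<theta>. \<lbrakk>e \<in> {0..1}; r \<in> {a..b}\<rbrakk> \<Longrightarrow> \<bar>twist \<sigma> c e \<theta> r\<bar> \<le> B"
  proof -
    have "2 * pi > 0" by simp
    from periodic_family_bounded[OF continuous_on_parts(2)[OF S[of 1] \<sigma>] parts_periodic(2) this] show ?thesis using that by blast
  qed
  define e1 where "e1 = min 1 (1 / (2 * B))"
  have e1: "e1 > 0" "e1 \<le> 1" "e1 * B \<le> 1 / 2" using B by (auto simp: e1_def min_def field_simps)
  have tw: "1 + e * twist \<sigma> c e \<theta> r > 0" if "e \<in> {0..e1}" "r \<in> {a..b}" for e r \<theta>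
  proof -
    have "\<bar>e * twist \<sigma> c e \<theta> r\<bar> \<le> e1 * B" unfolding abs_mult using that e1 B by (intro mult_mono) auto
    then show ?thesis using e1(3) by linarith
  qed
  have tw0: "\<forall>p\<in>?S e1. 1 + fst p * twist \<sigma> c (fst p) (fst (snd p)) (snd (snd p)) \<noteq> 0"
  proof
    fix p assume "p \<in> ?S e1"
    then have "fst p \<in> {0..e1}" "snd (snd p) \<in> {a..b}" by auto
    from tw[OF this, of "fst (snd p)"] show "1 + fst p * twist \<sigma> c (fst p) (fst (snd p)) (snd (snd p)) \<noteq> 0" by simp
  qed
  note parts = continuous_on_parts[OF S[of e1] \<sigma>, unfolded split_beta]
  have c0: "continuous_on (?S e1) fst" by (intro continuous_intros)
  have cs: "continuous_on (?S e1) (\<lambda>(e, \<theta>, r). slope \<sigma> c e \<theta> r)"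
    unfolding slope_def split_beta
    by (intro continuous_on_divide continuous_on_add continuous_on_mult continuous_on_const parts c0 tw0)
  have cs': "continuous_on (?S e1) (\<lambda>(e, \<theta>, r). slope' \<sigma> c e \<theta> r)"
    unfolding slope'_def split_beta power2_eq_square
    by (intro continuous_on_divide continuous_on_add continuous_on_mult continuous_on_diff continuous_on_const parts c0) (use tw0 in auto)
  have der: "((\<lambda>r. slope \<sigma> c e \<theta> r) has_real_derivative slope' \<sigma> c e \<theta> r) (at r within {a..b})"
    if "e \<in> {0..e1}" "r \<in> {a..b}" for e \<theta> r
    by (rule has_field_derivative_at_within[OF slope_has_derivative[OF _ \<sigma>]]) (use tw[OF that, of \<theta>] that ab in auto)
  obtain e0 where e0: "e0 > 0" "\<And>e. \<lbrakk>0 < e; e < e0\<rbrakk> \<Longrightarrow> \<exists>R \<eta>. \<eta> > 0 \<and>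
       (\<forall>\<theta>. R (\<theta> + 2 * pi) = R \<theta> \<and> \<bar>R \<theta> - r0\<bar> < \<eta> \<and> \<bar>R \<theta> - r0\<bar> < \<delta>' \<and>
            (R has_real_derivative e * slope \<sigma> c e \<theta> (R \<theta>)) (at \<theta>)) \<and>
       (\<forall>\<theta>0 k. \<bar>k - r0\<bar> < \<eta> \<longrightarrow> (\<exists>s. s \<theta>0 = k \<and>
            (\<forall>\<theta>\<ge>\<theta>0. \<bar>s \<theta> - r0\<bar> < \<delta>' \<and> (s has_real_derivative e * slope \<sigma> c e \<theta> (s \<theta>)) (at \<theta>)) \<and>
            ((\<lambda>\<theta>. s \<theta> - R \<theta>) \<longlongrightarrow> 0) at_top))"
  proof -
    have "2 * pi > 0" by simp
    from periodic_averaging[OF cs cs' der parts_periodic(3,4) this e1(1) ab(3,4) mean neg \<delta>'(1)] show ?thesis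
      using that by blast
  qed
  show ?thesis
  proof (rule that[of "min e0 e1"])
    show "min e0 e1 > 0" using e0(1) e1(1) by simp
    fix e assume e: "0 < e" "e < min e0 e1"
    have e_in: "e \<in> {0..e1}" using e by auto
    obtain W M where "polar_chart (\<lambda>p. (- \<sigma>) *\<^sub>R damped_field K m c e p) (chart \<sigma>) radius (2 * pi) a b
       (\<lambda>\<theta> r. e * slope \<sigma> c e \<theta> r) (\<lambda>\<theta> r. (1 + e * twist \<sigma> c e \<theta> r) / \<zeta>1 (r * cos \<theta>)) W M"
      using polar_chart_damped_field[OF ab(1,2) \<sigma> e_in tw[OF e_in]] by blast
    then interpret polar_chart "\<lambda>p. (- \<sigma>) *\<^sub>R damped_field K m c e p" "chart \<sigma>" radius "2 * pi" a b
       "\<lambda>\<theta> r. e * slope \<sigma> c e \<theta> r" "\<lambda>\<theta> r. (1 + e * twist \<sigma> c e \<theta> r) / \<zeta>1 (r * cos \<theta>)" W M .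
    obtain R \<eta> where R: "\<eta> > 0" "\<And>\<theta>. R (\<theta> + 2 * pi) = R \<theta> \<and> \<bar>R \<theta> - r0\<bar> < \<eta> \<and> \<bar>R \<theta> - r0\<bar> < \<delta>' \<and>
            (R has_real_derivative e * slope \<sigma> c e \<theta> (R \<theta>)) (at \<theta>)"
       "\<And>\<theta>0 k. \<bar>k - r0\<bar> < \<eta> \<Longrightarrow> (\<exists>s. s \<theta>0 = k \<and>
            (\<forall>\<theta>\<ge>\<theta>0. \<bar>s \<theta> - r0\<bar> < \<delta>' \<and> (s has_real_derivative e * slope \<sigma> c e \<theta> (s \<theta>)) (at \<theta>)) \<and>
            ((\<lambda>\<theta>. s \<theta> - R \<theta>) \<longlongrightarrow> 0) at_top)"
      using e0(2)[of e] e by auto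
    obtain \<Gamma> where "stable_limit_cycle (\<lambda>p. (- \<sigma>) *\<^sub>R damped_field K m c e p) \<Gamma>" "\<Gamma> \<noteq> {}" "\<forall>p\<in>\<Gamma>. \<bar>radius p - r0\<bar> < \<delta>'"
      using averaged_stable_limit_cycle[OF R(2,3) \<delta>'(3,4) R(1)] by blast
    then show "\<exists>\<Gamma>. stable_limit_cycle (\<lambda>p. (- \<sigma>) *\<^sub>R damped_field K m c e p) \<Gamma> \<and> \<Gamma> \<noteq> {} \<and> (\<forall>p\<in>\<Gamma>. \<bar>radius p - r0\<bar> < \<delta>)"
      using \<delta>'(2) by (meson less_le_trans)
  qed
qed

end

section \<open>The Melnikov function\<close>

context energy_coordinate
begin

text \<open>The half height of the unperturbed orbit above \<open>z\<close>. The next two integrals are those of \<open>1 / x1\<close> and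
  \<open>1 / x2\<close> over the region enclosed by the orbit, after integration over \<open>x2\<close>.\<close>

definition height :: "real \<Rightarrow> real \<Rightarrow> real" where
  "height r z = sqrt (r\<^sup>2 - (X z)\<^sup>2)"

definition A_int :: "real \<Rightarrow> real" where
  "A_int r = integral {\<zeta> (- r)..\<zeta> r} (\<lambda>z. 2 * height r z / z)"

definition B_int :: "real \<Rightarrow> real" where
  "B_int r = integral {\<zeta> (- r)..\<zeta> r} (\<lambda>z. ln (1 + height r z) - ln (1 - height r z))"

lemma \<zeta>_strict_mono:
  assumes "\<bar>x\<bar> < \<beta>" "\<bar>y\<bar> < \<beta>" "x < y"
  shows "\<zeta> x < \<zeta> y"
proof (rule DERIV_pos_imp_increasing[OF assms(3)])
  fix u assume "x \<le> u" "u \<le> y"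
  then have "\<bar>u\<bar> < \<beta>" using assms by auto
  then show "\<exists>v. (\<zeta> has_real_derivative v) (at u) \<and> 0 < v" using \<zeta>_deriv \<zeta>1_pos by blast
qed

lemma \<zeta>_range:
  assumes r: "r \<in> {0<..<\<beta>}" and z: "z \<in> {\<zeta> (- r)..\<zeta> r}"
  shows "z > 0" "\<bar>X z\<bar> \<le> r"
proof -
  have "\<zeta> (-r) > 0" using r by (intro \<zeta>_pos) auto
  then show "z > 0" using z by auto
  have "continuous_on {-r..r} \<zeta>"
    by (rule DERIV_continuous_on[OF has_field_derivative_at_within[OF \<zeta>_deriv]]) (use r in auto)
  then obtain x where "x \<in> {-r..r}" "\<zeta> x = z" using IVT'[of \<zeta> "-r" z r] z r by auto
  then show "\<bar>X z\<bar> \<le> r" using X_\<zeta>[of x] r by auto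
qed

lemma height_bounds:
  assumes r: "r \<in> {0<..<\<beta>}" and z: "z \<in> {\<zeta> (- r)..\<zeta> r}"
  shows "0 \<le> height r z" "height r z \<le> r"
proof -
  have "(X z)\<^sup>2 \<le> r\<^sup>2" using \<zeta>_range[OF r z] r by (simp add: abs_le_square_iff[symmetric])
  then show "0 \<le> height r z" by (simp add: height_def)
  show "height r z \<le> r" using r by (simp add: height_def real_sqrt_le_iff[of _ "r\<^sup>2", simplified] real_le_lsqrt)
qed

lemma height_continuous:
  assumes r: "r \<in> {0<..<\<beta>}"
  shows "continuous_on {\<zeta> (- r)..\<zeta> r} (height r)"
proof -
  have "continuous_on {\<zeta> (- r)..\<zeta> r} X"
    using \<zeta>_range(1)[OF r] by (intro continuous_on_subset[OF X_cont]) auto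
  then show ?thesis unfolding height_def by (intro continuous_intros)
qed

text \<open>On the upper half of the orbit \<open>z\<close> decreases with the angle, hence the sign.\<close>

lemma arc_substitution:
  assumes r: "r \<in> {0<..<\<beta>}" and f: "continuous_on {\<zeta> (- r)..\<zeta> r} f"
  defines "z \<equiv> \<lambda>\<theta>. \<zeta> (r * cos \<theta>)" and "z' \<equiv> \<lambda>\<theta>. \<zeta>1 (r * cos \<theta>) * (- (r * sin \<theta>))"
  shows "((\<lambda>\<theta>. z' \<theta> * f (z \<theta>)) has_integral - integral {\<zeta> (- r)..\<zeta> r} f) {0..pi}"
    and "((\<lambda>\<theta>. z' \<theta> * f (z \<theta>)) has_integral integral {\<zeta> (- r)..\<zeta> r} f) {pi..2 * pi}"
proof -
  have mono: "\<zeta> x \<le> \<zeta> y" if "\<bar>x\<bar> \<le> r" "\<bar>y\<bar> \<le> r" "x \<le> y" for x y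
    using \<zeta>_strict_mono[of x y] that r by (cases "x = y") auto
  have rc: "\<bar>r * cos \<theta>\<bar> \<le> r" for \<theta>
    using r mult_left_mono[OF abs_cos_le_one[of \<theta>], of r] by (simp add: abs_mult)
  have im: "z ` S \<subseteq> {\<zeta> (- r)..\<zeta> r}" for S
  proof (rule image_subsetI)
    fix \<theta>
    have "- r \<le> r * cos \<theta>" "r * cos \<theta> \<le> r" using rc[of \<theta>] by linarith+
    then show "z \<theta> \<in> {\<zeta> (- r)..\<zeta> r}" unfolding z_def using rc r by (auto intro!: mono)
  qed
  have d: "(z has_real_derivative z' \<theta>) (at \<theta> within S)" for \<theta> S
  proof -
    have "((\<lambda>\<theta>. r * cos \<theta>) has_real_derivative - (r * sin \<theta>)) (at \<theta>)" by (auto intro!: derivative_eq_intros)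
    from DERIV_chain'[OF this \<zeta>_deriv[OF r_cos[OF r]]] show ?thesis
      unfolding z_def z'_def by (rule has_field_derivative_at_within)
  qed
  have zc: "continuous_on S z" for S by (rule DERIV_continuous_on[OF d])
  have e: "integral {\<zeta> r..\<zeta> (- r)} f = 0"
    using mono[of "-r" r] r by (cases "\<zeta> r = \<zeta> (- r)") auto
  have "((\<lambda>\<theta>. z' \<theta> *\<^sub>R f (z \<theta>)) has_integral (integral {z 0..z pi} f - integral {z pi..z 0} f)) {0..pi}"
    by (rule has_integral_substitution_general[OF finite.emptyI _ im f zc d]) auto
  then show "((\<lambda>\<theta>. z' \<theta> * f (z \<theta>)) has_integral - integral {\<zeta> (- r)..\<zeta> r} f) {0..pi}"
    using e by (simp add: z_def)
  have "((\<lambda>\<theta>. z' \<theta> *\<^sub>R f (z \<theta>)) has_integral (integral {z pi..z (2 * pi)} f - integral {z (2 * pi)..z pi} f)) {pi..2 * pi}"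
    by (rule has_integral_substitution_general[OF finite.emptyI _ im f zc d]) auto
  then show "((\<lambda>\<theta>. z' \<theta> * f (z \<theta>)) has_integral integral {\<zeta> (- r)..\<zeta> r} f) {pi..2 * pi}"
    using e by (simp add: z_def)
qed

lemma height_on_circle:
  assumes r: "r \<in> {0<..<\<beta>}"
  shows "\<theta> \<in> {0..pi} \<Longrightarrow> r * sin \<theta> = height r (\<zeta> (r * cos \<theta>))"
    and "\<theta> \<in> {pi..2 * pi} \<Longrightarrow> r * sin \<theta> = - height r (\<zeta> (r * cos \<theta>))"
proof -
  have "r\<^sup>2 - (r * cos \<theta>)\<^sup>2 = (r * sin \<theta>)\<^sup>2"
    by (simp add: power_mult_distrib cos_squared_eq right_diff_distrib)
  then have h: "height r (\<zeta> (r * cos \<theta>)) = r * \<bar>sin \<theta>\<bar>"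
    using X_\<zeta>[OF r_cos[OF r, of \<theta>]] r by (simp add: height_def abs_mult)
  show "\<theta> \<in> {0..pi} \<Longrightarrow> r * sin \<theta> = height r (\<zeta> (r * cos \<theta>))" using h sin_ge_zero[of \<theta>] by simp
  show "\<theta> \<in> {pi..2 * pi} \<Longrightarrow> r * sin \<theta> = - height r (\<zeta> (r * cos \<theta>))"
    using h sin_le_zero[of \<theta>] by (cases "\<theta> = 2 * pi") auto
qed

text \<open>An integration by parts turns the logarithm into \<open>1 / z\<close>; the two halves of the orbit then contribute
  equally.\<close>

lemma cos_ln_integral:
  assumes r: "r \<in> {0<..<\<beta>}"
  shows "((\<lambda>\<theta>. cos \<theta> * ln (\<zeta> (r * cos \<theta>))) has_integral A_int r / r) {0..2 * pi}"
proof -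
  let ?z = "\<lambda>\<theta>. \<zeta> (r * cos \<theta>)" and ?z' = "\<lambda>\<theta>. \<zeta>1 (r * cos \<theta>) * (- (r * sin \<theta>))"
  let ?f = "\<lambda>z. height r z / z"
  have zp: "?z \<theta> > 0" for \<theta> by (rule \<zeta>_pos[OF r_cos[OF r]])
  have fc: "continuous_on {\<zeta> (- r)..\<zeta> r} ?f"
    by (intro continuous_intros height_continuous[OF r]) (use \<zeta>_range(1)[OF r] in force)
  define I where "I = integral {\<zeta> (- r)..\<zeta> r} ?f"
  have AI: "A_int r = 2 * I" by (simp add: A_int_def I_def flip: integral_mult_right)
  have d: "((\<lambda>\<theta>. sin \<theta> * ln (?z \<theta>)) has_vector_derivative cos \<theta> * ln (?z \<theta>) + sin \<theta> * (?z' \<theta> / ?z \<theta>)) (at \<theta> within S)" for \<theta> S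
  proof -
    have "((\<lambda>\<theta>. r * cos \<theta>) has_real_derivative - (r * sin \<theta>)) (at \<theta>)" by (auto intro!: derivative_eq_intros)
    from DERIV_chain'[OF this \<zeta>_deriv[OF r_cos[OF r]]]
    have "(?z has_real_derivative ?z' \<theta>) (at \<theta>)" .
    then have "((\<lambda>\<theta>. ln (?z \<theta>)) has_real_derivative ?z' \<theta> / ?z \<theta>) (at \<theta>)"
      using zp[of \<theta>] by (auto intro!: derivative_eq_intros)
    from DERIV_mult[OF DERIV_sin this]
    have "((\<lambda>\<theta>. sin \<theta> * ln (?z \<theta>)) has_real_derivative cos \<theta> * ln (?z \<theta>) + sin \<theta> * (?z' \<theta> / ?z \<theta>)) (at \<theta>)"
      by (simp add: algebra_simps)
    then show ?thesis
      by (simp add: has_real_derivative_iff_has_vector_derivative has_vector_derivative_at_within)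
  qed
  have 1: "((\<lambda>\<theta>. cos \<theta> * ln (?z \<theta>) + sin \<theta> * (?z' \<theta> / ?z \<theta>)) has_integral 0) {0..2 * pi}"
    using fundamental_theorem_of_calculus[OF _ d, of 0 "2 * pi"] by simp
  have "((\<lambda>\<theta>. r * (sin \<theta> * (?z' \<theta> / ?z \<theta>))) has_integral - I) {0..pi}"
    using arc_substitution(1)[OF r fc] unfolding I_def
    by (rule has_integral_eq[rotated]) (simp add: height_on_circle(1)[OF r, symmetric] field_simps)
  moreover have "((\<lambda>\<theta>. r * (sin \<theta> * (?z' \<theta> / ?z \<theta>))) has_integral - I) {pi..2 * pi}"
    using has_integral_neg[OF arc_substitution(2)[OF r fc]] unfolding I_def
  proof (rule has_integral_eq[rotated])
    fix \<theta> assume "\<theta> \<in> {pi..2 * pi}"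
    then have "height r (?z \<theta>) = - (r * sin \<theta>)" using height_on_circle(2)[OF r, of \<theta>] by simp
    then show "- (?z' \<theta> * (height r (?z \<theta>) / ?z \<theta>)) = r * (sin \<theta> * (?z' \<theta> / ?z \<theta>))" by (simp add: field_simps)
  qed
  ultimately have "((\<lambda>\<theta>. r * (sin \<theta> * (?z' \<theta> / ?z \<theta>))) has_integral - I + - I) {0..2 * pi}"
    by (intro has_integral_combine[of 0 pi "2 * pi"]) auto
  from has_integral_mult_right[OF this, of "1 / r"]
  have "((\<lambda>\<theta>. sin \<theta> * (?z' \<theta> / ?z \<theta>)) has_integral - (A_int r / r)) {0..2 * pi}"
    using r by (simp add: AI field_simps)
  from has_integral_diff[OF 1 this] show ?thesis by simp
qed

lemma sin_ln_integral:
  assumes r: "r \<in> {0<..<\<beta>}" and \<sigma>: "\<sigma> \<in> {1, -1}"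
  shows "((\<lambda>\<theta>. \<sigma> * sin \<theta> * (\<zeta>1 (r * cos \<theta>) * ln (1 + \<sigma> * r * sin \<theta>))) has_integral B_int r / r) {0..2 * pi}"
proof -
  let ?z = "\<lambda>\<theta>. \<zeta> (r * cos \<theta>)" and ?z' = "\<lambda>\<theta>. \<zeta>1 (r * cos \<theta>) * (- (r * sin \<theta>))"
  let ?g = "\<lambda>\<theta>. \<sigma> * sin \<theta> * (\<zeta>1 (r * cos \<theta>) * ln (1 + \<sigma> * r * sin \<theta>))"
  let ?f = "\<lambda>k z. ln (1 + k * height r z)"
  have fc: "continuous_on {\<zeta> (- r)..\<zeta> r} (?f k)" if k: "k \<in> {1, -1}" for k
  proof (intro continuous_intros height_continuous[OF r] ballI)
    fix z assume "z \<in> {\<zeta> (- r)..\<zeta> r}"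
    from height_bounds[OF r this] show "1 + k * height r z \<noteq> 0" using k r \<beta> by auto
  qed
  let ?I = "\<lambda>k. integral {\<zeta> (- r)..\<zeta> r} (?f k)"
  have BI: "B_int r = ?I 1 - ?I (- 1)"
    unfolding B_int_def using fc[of 1] fc[of "-1"]
    by (subst integral_diff[symmetric]) (auto intro!: integrable_continuous_real)
  have \<sigma>m: "- \<sigma> \<in> {1, -1}" using \<sigma> by auto
  have "((\<lambda>\<theta>. r * ?g \<theta>) has_integral (- \<sigma>) * (- ?I \<sigma>)) {0..pi}"
    using has_integral_mult_right[OF arc_substitution(1)[OF r fc[OF \<sigma>]], of "- \<sigma>"]
    by (rule has_integral_eq[rotated]) (simp add: height_on_circle(1)[OF r, symmetric] mult.assoc)
  moreover have "((\<lambda>\<theta>. r * ?g \<theta>) has_integral (- \<sigma>) * ?I (- \<sigma>)) {pi..2 * pi}"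
    using has_integral_mult_right[OF arc_substitution(2)[OF r fc[OF \<sigma>m]], of "- \<sigma>"]
  proof (rule has_integral_eq[rotated])
    fix \<theta> assume "\<theta> \<in> {pi..2 * pi}"
    then have "height r (?z \<theta>) = - (r * sin \<theta>)" using height_on_circle(2)[OF r, of \<theta>] by simp
    then show "- \<sigma> * (?z' \<theta> * ?f (- \<sigma>) (?z \<theta>)) = r * ?g \<theta>" by (simp add: mult.assoc)
  qed
  ultimately have "((\<lambda>\<theta>. r * ?g \<theta>) has_integral (- \<sigma>) * (- ?I \<sigma>) + (- \<sigma>) * ?I (- \<sigma>)) {0..2 * pi}"
    by (intro has_integral_combine[of 0 pi "2 * pi"]) auto
  moreover have "(- \<sigma>) * (- ?I \<sigma>) + (- \<sigma>) * ?I (- \<sigma>) = B_int r" using \<sigma> BI by auto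
  ultimately have "((\<lambda>\<theta>. r * ?g \<theta>) has_integral B_int r) {0..2 * pi}" by simp
  from has_integral_mult_right[OF this, of "1 / r"] show ?thesis using r by (simp add: mult.assoc)
qed

text \<open>The Melnikov function: the angle decreases along the flow of \<open>damped_field\<close>, so a negative mean of
  \<open>slope 1\<close> is a gain of energy.\<close>

lemma mean_slope:
  assumes r: "r \<in> {0<..<\<beta>}" and \<sigma>: "\<sigma> \<in> {1, -1}"
  shows "integral {0..2 * pi} (\<lambda>\<theta>. slope \<sigma> c 0 \<theta> r) = - \<sigma> * (A_int r / r - c * (B_int r / r))"
proof -
  have "((\<lambda>\<theta>. - \<sigma> * (cos \<theta> * ln (\<zeta> (r * cos \<theta>)) - c * (\<sigma> * sin \<theta> * (\<zeta>1 (r * cos \<theta>) * ln (1 + \<sigma> * r * sin \<theta>)))))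
      has_integral - \<sigma> * (A_int r / r - c * (B_int r / r))) {0..2 * pi}"
    by (intro has_integral_mult_right has_integral_diff cos_ln_integral[OF r] sin_ln_integral[OF r \<sigma>])
  moreover have "slope \<sigma> c 0 \<theta> r = - \<sigma> * (cos \<theta> * ln (\<zeta> (r * cos \<theta>)) - c * (\<sigma> * sin \<theta> * (\<zeta>1 (r * cos \<theta>) * ln (1 + \<sigma> * r * sin \<theta>))))" for \<theta>
    by (simp add: slope_def num_def ps_z_def ps_w_def ps_y_def)
  ultimately show ?thesis by (simp only: integral_unique)
qed

text \<open>Both averages are differentiated under the integral sign at once, as the mean slopes for
  \<open>c = 0\<close> and \<open>c = 1\<close>.\<close>

lemma mean_slope_has_derivative:
  assumes r: "r \<in> {0<..<\<beta>}" and \<sigma>: "\<sigma> \<in> {1, -1}"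
  shows "((\<lambda>r. integral {0..2 * pi} (\<lambda>\<theta>. slope \<sigma> c 0 \<theta> r)) has_real_derivative
      integral {0..2 * pi} (\<lambda>\<theta>. slope' \<sigma> c 0 \<theta> r)) (at r)"
    and "continuous_on {0<..<\<beta>} (\<lambda>r. integral {0..2 * pi} (\<lambda>\<theta>. slope' \<sigma> c 0 \<theta> r))"
proof -
  let ?T = "{0} \<times> UNIV \<times> {0<..<\<beta>} :: (real \<times> real \<times> real) set"
  have S: "?T \<subseteq> {p. snd (snd p) \<in> {0<..<\<beta>}}" by auto
  have s0: "slope \<sigma> c 0 \<theta> r = num \<sigma> c 0 \<theta> r" "slope' \<sigma> c 0 \<theta> r = num' \<sigma> c 0 \<theta> r" for \<theta> r
    by (simp_all add: slope_def slope'_def)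
  have c': "continuous_on ({0<..<\<beta>} \<times> cbox 0 (2 * pi)) (\<lambda>(r, \<theta>). slope' \<sigma> c 0 \<theta> r)"
  proof -
    have "continuous_on ({0<..<\<beta>} \<times> cbox 0 (2 * pi)) (\<lambda>p. (\<lambda>(e, \<theta>, r). num' \<sigma> c e \<theta> r) (0, snd p, fst p))"
      by (rule continuous_on_compose2[OF continuous_on_parts(3)[OF S \<sigma>]]) (auto intro!: continuous_intros)
    then show ?thesis by (simp add: s0 split_beta)
  qed
  have c: "continuous_on (cbox 0 (2 * pi)) (\<lambda>\<theta>. slope \<sigma> c 0 \<theta> r)" if "r \<in> {0<..<\<beta>}" for r
  proof -
    have "continuous_on (cbox 0 (2 * pi)) (\<lambda>\<theta>. (\<lambda>(e, \<theta>, r). num \<sigma> c e \<theta> r) (0, \<theta>, r))"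
      by (rule continuous_on_compose2[OF continuous_on_parts(1)[OF S \<sigma>]]) (use that in \<open>auto intro!: continuous_intros\<close>)
    then show ?thesis by (simp add: s0)
  qed
  have "((\<lambda>r. integral (cbox 0 (2 * pi)) (\<lambda>\<theta>. slope \<sigma> c 0 \<theta> r)) has_real_derivative
      integral (cbox 0 (2 * pi)) (\<lambda>\<theta>. slope' \<sigma> c 0 \<theta> r)) (at r within {0<..<\<beta>})"
  proof (rule leibniz_rule_field_derivative[where f = "\<lambda>r \<theta>. slope \<sigma> c 0 \<theta> r" and fx = "\<lambda>r \<theta>. slope' \<sigma> c 0 \<theta> r"])
    show "((\<lambda>r. slope \<sigma> c 0 t r) has_real_derivative slope' \<sigma> c 0 t x) (at x within {0<..<\<beta>})"
      if "x \<in> {0<..<\<beta>}" for x t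
      by (rule has_field_derivative_at_within[OF slope_has_derivative[OF that \<sigma>]]) simp
    show "(\<lambda>\<theta>. slope \<sigma> c 0 \<theta> x) integrable_on cbox 0 (2 * pi)" if "x \<in> {0<..<\<beta>}" for x
      by (rule integrable_continuous[OF c[OF that]])
  qed (use c' r in auto)
  then show "((\<lambda>r. integral {0..2 * pi} (\<lambda>\<theta>. slope \<sigma> c 0 \<theta> r)) has_real_derivative
      integral {0..2 * pi} (\<lambda>\<theta>. slope' \<sigma> c 0 \<theta> r)) (at r)"
    using r by (simp add: at_within_open[OF r open_greaterThanLessThan])
  show "continuous_on {0<..<\<beta>} (\<lambda>r. integral {0..2 * pi} (\<lambda>\<theta>. slope' \<sigma> c 0 \<theta> r))"
    using integral_continuous_on_param[OF c'] by simp
qed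

end

section \<open>Transversal crossings of a common level\<close>

text \<open>Between the last point above the level \<open>h1\<close> and the next one below \<open>l1\<close> the mean value theorem gives a
  point of negative derivative; near it \<open>R\<close> decreases strictly and takes an interval of values. Having an
  interval of levels allows several descents to be treated one after the other without Sard's theorem.\<close>

lemma steep_descent_levels:
  fixes R R' :: "real \<Rightarrow> real"
  assumes der: "\<And>x. x \<in> {p..q} \<Longrightarrow> (R has_real_derivative R' x) (at x)"
    and cont: "continuous_on {p..q} R'" and "p < q" "l < h" "R p \<ge> h" "R q \<le> l"
  obtains l' h' where "l \<le> l'" "l' < h'" "h' \<le> h" "\<And>c. c \<in> {l'<..<h'} \<Longrightarrow> \<exists>x\<in>{p<..<q}. R x = c \<and> R' x < 0"
proof -
  have Rc: "continuous_on {p..q} R"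
    by (rule DERIV_continuous_on[OF has_field_derivative_at_within[OF der]])
  define h1 l1 where "h1 = (l + 2 * h) / 3" and "l1 = (2 * l + h) / 3"
  have lh: "l < l1" "l1 < h1" "h1 < h" using \<open>l < h\<close> by (auto simp: h1_def l1_def field_simps)
  define U where "U = {x \<in> {p..q}. h1 \<le> R x}"
  have "closed U"
    unfolding U_def using continuous_closed_preimage[OF Rc closed_atLeastAtMost closed_atLeast, of h1]
    by (simp add: vimage_def Int_def)
  moreover have "bounded U" unfolding U_def by (rule bounded_subset[OF bounded_closed_interval]) auto
  moreover have "p \<in> U" using \<open>p < q\<close> \<open>R p \<ge> h\<close> lh by (auto simp: U_def)
  ultimately obtain u where u: "u \<in> U" "\<And>x. x \<in> U \<Longrightarrow> x \<le> u"
    using compact_attains_sup[of U] by (auto simp: compact_eq_bounded_closed)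
  define V where "V = {x \<in> {u..q}. R x \<le> l1}"
  have up: "p \<le> u" "u \<le> q" "h1 \<le> R u" using u by (auto simp: U_def)
  have "closed V"
    unfolding V_def using continuous_closed_preimage[OF continuous_on_subset[OF Rc] closed_atLeastAtMost closed_atMost, of u q l1] up
    by (simp add: vimage_def Int_def)
  moreover have "bounded V" unfolding V_def by (rule bounded_subset[OF bounded_closed_interval]) auto
  moreover have "q \<in> V" using up \<open>R q \<le> l\<close> lh by (auto simp: V_def)
  ultimately obtain v where v: "v \<in> V" "\<And>x. x \<in> V \<Longrightarrow> v \<le> x"
    using compact_attains_inf[of V] by (auto simp: compact_eq_bounded_closed)
  have vp: "u \<le> v" "v \<le> q" "R v \<le> l1" using v by (auto simp: V_def)
  have "u \<noteq> v" using up vp lh by auto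
  then have "u < v" using vp by simp
  have mid: "R x \<in> {l<..<h}" if "x \<in> {u<..<v}" for x
  proof -
    have "x \<notin> U" "x \<notin> V" using u(2)[of x] v(2)[of x] that by force+
    then show ?thesis using that up vp lh by (auto simp: U_def V_def)
  qed
  obtain \<xi> where \<xi>: "u < \<xi>" "\<xi> < v" "R v - R u = (v - u) * R' \<xi>"
    using MVT2[OF \<open>u < v\<close>, of R R'] der up vp by auto
  have "R v - R u < 0" using up vp lh by linarith
  then have neg: "R' \<xi> < 0" using \<xi>(3) \<open>u < v\<close> by (simp add: mult_less_0_iff)
  have \<xi>pq: "p < \<xi>" "\<xi> < q" using \<xi> up vp by auto
  have "continuous_on {p<..<q} R'" by (rule continuous_on_subset[OF cont]) auto
  then have "isCont R' \<xi>" using \<xi>pq by (simp add: continuous_on_eq_continuous_at)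
  then have "\<forall>\<^sub>F x in at \<xi>. R' x < 0" using neg unfolding isCont_def by (rule order_tendstoD)
  then obtain d where d: "d > 0" "\<And>x. x \<noteq> \<xi> \<Longrightarrow> dist x \<xi> < d \<Longrightarrow> R' x < 0" by (auto simp: eventually_at)
  define k where "k = min (d / 2) (min ((\<xi> - p) / 2) ((q - \<xi>) / 2))"
  have k0: "k > 0" using d(1) \<xi>pq by (simp add: k_def)
  have kd: "k \<le> d / 2" and kp: "k \<le> (\<xi> - p) / 2" and kq: "k \<le> (q - \<xi>) / 2"
    unfolding k_def by (simp_all only: min.cobounded1 min.coboundedI1 min.coboundedI2 min.cobounded2 order_refl)
  have "k < d" using kd d(1) by (simp add: field_simps)
  moreover have "p < \<xi> - k" using kp \<xi>pq(1) by (simp add: field_simps)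
  moreover have "\<xi> + k < q" using kq \<xi>pq(2) by (simp add: field_simps)
  ultimately have k: "k > 0" "k < d" "p < \<xi> - k" "\<xi> + k < q" using k0 by auto
  have R'neg: "R' x < 0" if "x \<in> {\<xi> - k..\<xi> + k}" for x
    using d(2)[of x] neg that k by (cases "x = \<xi>") (auto simp: dist_real_def)
  have dec: "R y < R x" if "x \<in> {\<xi> - k..\<xi> + k}" "y \<in> {\<xi> - k..\<xi> + k}" "x < y" for x y
  proof (rule DERIV_neg_imp_decreasing[OF that(3)])
    fix u assume "x \<le> u" "u \<le> y"
    then have "u \<in> {p..q}" "u \<in> {\<xi> - k..\<xi> + k}" using that k by auto
    then show "\<exists>v. (R has_real_derivative v) (at u) \<and> v < 0" using der R'neg by blast
  qed
  have R\<xi>: "R \<xi> \<in> {l<..<h}" using mid \<xi> by auto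
  show ?thesis
  proof (rule that[of "max l (R (\<xi> + k))" "min h (R (\<xi> - k))"])
    show "max l (R (\<xi> + k)) < min h (R (\<xi> - k))"
      using dec[of "\<xi> - k" \<xi>] dec[of \<xi> "\<xi> + k"] k R\<xi> by auto
    fix c assume c: "c \<in> {max l (R (\<xi> + k))<..<min h (R (\<xi> - k))}"
    obtain x where x: "\<xi> - k \<le> x" "x \<le> \<xi> + k" "R x = c"
      using IVT2'[of R "\<xi> + k" c "\<xi> - k"] c k continuous_on_subset[OF Rc, of "{\<xi> - k..\<xi> + k}"] by auto
    then show "\<exists>x\<in>{p<..<q}. R x = c \<and> R' x < 0" using R'neg[of x] k by (intro bexI[of _ x]) auto
  qed auto
qed

lemma three_transversal_crossings:
  fixes R R' :: "real \<Rightarrow> real"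
  assumes der: "\<And>x. x \<in> {r0..r3} \<Longrightarrow> (R has_real_derivative R' x) (at x)"
    and cont: "continuous_on {r0..r3} R'" and r: "r0 < r1" "r1 < r2" "r2 < r3" and "l < h"
    and R: "R r0 \<ge> h" "R r1 \<le> l" "R r2 \<ge> h" "R r3 \<le> l"
  obtains c x1 x2 x3 where "x1 \<in> {r0<..<r1}" "x2 \<in> {r1<..<r2}" "x3 \<in> {r2<..<r3}"
    "R x1 = c" "R x2 = c" "R x3 = c" "R' x1 < 0" "R' x2 > 0" "R' x3 < 0"
proof -
  have d: "(R has_real_derivative R' x) (at x)" if "x \<in> {p..q}" "r0 \<le> p" "q \<le> r3" for x p q
    using der that by auto
  have c: "continuous_on {p..q} R'" if "r0 \<le> p" "q \<le> r3" for p q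
    by (rule continuous_on_subset[OF cont]) (use that in auto)
  obtain l1 h1 where 1: "l \<le> l1" "l1 < h1" "h1 \<le> h" "\<And>c. c \<in> {l1<..<h1} \<Longrightarrow> \<exists>x\<in>{r0<..<r1}. R x = c \<and> R' x < 0"
    using steep_descent_levels[OF d[of _ r0 r1] c[of r0 r1] r(1) \<open>l < h\<close> R(1,2)] r by auto
  obtain l2 h2 where 2: "- h1 \<le> l2" "l2 < h2" "h2 \<le> - l1"
    "\<And>c. c \<in> {l2<..<h2} \<Longrightarrow> \<exists>x\<in>{r1<..<r2}. - R x = c \<and> - R' x < 0"
  proof (rule steep_descent_levels[of r1 r2 "\<lambda>x. - R x" "\<lambda>x. - R' x" "- h1" "- l1"])
    show "((\<lambda>x. - R x) has_real_derivative - R' x) (at x)" if "x \<in> {r1..r2}" for x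
      using d[OF that] r by (intro DERIV_minus) auto
    show "continuous_on {r1..r2} (\<lambda>x. - R' x)" using c[of r1 r2] r by (intro continuous_intros) auto
  qed (use r R 1 in auto)
  obtain l3 h3 where 3: "- h2 \<le> l3" "l3 < h3" "h3 \<le> - l2" "\<And>c. c \<in> {l3<..<h3} \<Longrightarrow> \<exists>x\<in>{r2<..<r3}. R x = c \<and> R' x < 0"
  proof (rule steep_descent_levels[of r2 r3 R R' "- h2" "- l2"])
  qed (use r R 1 2 d[of _ r2 r3] c[of r2 r3] in auto)
  define c where "c = (l3 + h3) / 2"
  have "l3 < c" "c < h3" using 3(2) by (auto simp: c_def)
  then have "c \<in> {l3<..<h3}" "- c \<in> {l2<..<h2}" "c \<in> {l1<..<h1}" using 1(1-3) 2(1-3) 3(1-3) by auto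
  from 3(4)[OF this(1)] 2(4)[OF this(2)] 1(4)[OF this(3)] show ?thesis using that[of _ _ _ c] by force
qed

section \<open>A criterion for three limit cycles\<close>

context energy_coordinate
begin

lemma B_int_pos:
  assumes r: "r \<in> {0<..<\<beta>}"
  shows "B_int r > 0"
proof -
  let ?f = "\<lambda>z. ln (1 + height r z) - ln (1 - height r z)"
  have h: "0 \<le> height r z" "height r z < 1" if "z \<in> {\<zeta> (- r)..\<zeta> r}" for z
    using height_bounds[OF r that] r \<beta> by auto
  have c: "continuous_on {\<zeta> (- r)..\<zeta> r} ?f"
    by (intro continuous_intros height_continuous[OF r]) (use h in force)+
  have nn: "0 \<le> ?f z" if "z \<in> {\<zeta> (- r)..\<zeta> r}" for z using h[OF that] by simp
  have lt: "\<zeta> (- r) < \<zeta> 0" "\<zeta> 0 < \<zeta> r" using \<zeta>_strict_mono r by auto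
  have "0 \<le> B_int r" unfolding B_int_def by (rule integral_nonneg[OF integrable_continuous_real[OF c] nn])
  moreover have "B_int r \<noteq> 0"
  proof
    assume "B_int r = 0"
    then have "?f (\<zeta> 0) = 0"
      using integral_eq_0_iff[OF c _ nn] lt unfolding B_int_def by auto
    moreover have "height r (\<zeta> 0) = r" using X_\<zeta>[of 0] r \<beta> by (simp add: height_def)
    ultimately show False using r \<beta> by simp
  qed
  ultimately show ?thesis by simp
qed

text \<open>Where \<open>A / B = c\<close>, the derivative of the mean slope is, up to a positive factor, \<open>- \<sigma>\<close> times that of the ratio. So a
  descent of the ratio gives an attracting cycle for \<open>\<sigma> = - 1\<close>, that is for the field itself, and an
  ascent one for \<open>\<sigma> = 1\<close>, the reversed field.\<close>

theorem three_limit_cycles: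
  assumes r: "0 < r0" "r0 < r1" "r1 < r2" "r2 < r3" "r3 < \<beta>" and "l < h"
    and Q: "A_int r0 / B_int r0 \<ge> h" "A_int r1 / B_int r1 \<le> l" "A_int r2 / B_int r2 \<ge> h" "A_int r3 / B_int r3 \<le> l"
  shows "\<exists>F. planar_S_system F \<and>
     (\<exists>\<Gamma>1 \<Gamma>2 \<Gamma>3.
        \<Gamma>1 \<noteq> \<Gamma>2 \<and> \<Gamma>1 \<noteq> \<Gamma>3 \<and> \<Gamma>2 \<noteq> \<Gamma>3 \<and>
        stable_limit_cycle F \<Gamma>1 \<and> stable_limit_cycle F \<Gamma>2 \<and>
        unstable_limit_cycle F \<Gamma>3)"
proof -
  define M M' where "M \<sigma> c r = integral {0..2 * pi} (\<lambda>\<theta>. slope \<sigma> c 0 \<theta> r)"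
    and "M' \<sigma> c r = integral {0..2 * pi} (\<lambda>\<theta>. slope' \<sigma> c 0 \<theta> r)" for \<sigma> c r
  have M: "M \<sigma> c r = - \<sigma> * (A_int r / r - c * (B_int r / r))" if "r \<in> {0<..<\<beta>}" "\<sigma> \<in> {1, -1}" for \<sigma> c r
    unfolding M_def by (rule mean_slope[OF that])
  have dM: "(M \<sigma> c has_real_derivative M' \<sigma> c r) (at r)" if "r \<in> {0<..<\<beta>}" "\<sigma> \<in> {1, -1}" for \<sigma> c r
    using mean_slope_has_derivative(1)[OF that, of c] unfolding M_def[abs_def] M'_def .
  define a b a' b' where "a r = - M 1 0 r" and "b r = M 1 1 r - M 1 0 r"
    and "a' r = - M' 1 0 r" and "b' r = M' 1 1 r - M' 1 0 r" for r
  have one: "(1::real) \<in> {1, -1}" by simp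
  have ab: "a r = A_int r / r" "b r = B_int r / r" if "r \<in> {0<..<\<beta>}" for r
    using M[OF that one] by (simp_all add: a_def b_def)
  have da: "(a has_real_derivative a' r) (at r)" "(b has_real_derivative b' r) (at r)" if "r \<in> {0<..<\<beta>}" for r
    unfolding a_def[abs_def] b_def[abs_def] a'_def b'_def by (intro derivative_intros dM that one)+
  have M'eq: "M' \<sigma> c r = - \<sigma> * (a' r - c * b' r)" if "r \<in> {0<..<\<beta>}" "\<sigma> \<in> {1, -1}" for \<sigma> c r
  proof -
    have "((\<lambda>r. - \<sigma> * (a r - c * b r)) has_real_derivative - \<sigma> * (a' r - c * b' r)) (at r)"
      by (intro DERIV_cmult DERIV_diff da that)
    moreover have "\<forall>\<^sub>F x in nhds r. - \<sigma> * (a x - c * b x) = M \<sigma> c x"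
      using eventually_nhds_in_open[OF open_greaterThanLessThan that(1)]
      by eventually_elim (simp only: ab M that(2))
    ultimately have "(M \<sigma> c has_real_derivative - \<sigma> * (a' r - c * b' r)) (at r)"
      using DERIV_cong_ev[OF refl, of "\<lambda>r. - \<sigma> * (a r - c * b r)" "M \<sigma> c"] by simp
    then show ?thesis using dM[OF that] DERIV_unique by blast
  qed
  have bp: "b r > 0" if "r \<in> {0<..<\<beta>}" for r using B_int_pos[OF that] that by (simp add: ab)
  define R R' where "R r = a r / b r" and "R' r = (a' r * b r - a r * b' r) / (b r * b r)" for r
  have dR: "(R has_real_derivative R' r) (at r)" if "r \<in> {0<..<\<beta>}" for r
    unfolding R_def[abs_def] R'_def using bp[OF that] by (intro DERIV_divide da that) auto
  have c': "continuous_on {0<..<\<beta>} a'" "continuous_on {0<..<\<beta>} b'"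
    unfolding a'_def[abs_def] b'_def[abs_def] M'_def
    by (intro continuous_on_minus continuous_on_diff mean_slope_has_derivative(2)[of "\<beta> / 2"]; use \<beta> in simp)+
  have ca: "continuous_on {0<..<\<beta>} a" "continuous_on {0<..<\<beta>} b"
    by (rule DERIV_continuous_on[OF has_field_derivative_at_within[OF da(1)]]; simp)
       (rule DERIV_continuous_on[OF has_field_derivative_at_within[OF da(2)]]; simp)
  have "\<forall>r\<in>{0<..<\<beta>}. b r * b r \<noteq> 0" using bp by force
  then have "continuous_on {0<..<\<beta>} R'"
    unfolding R'_def[abs_def] by (intro continuous_on_divide continuous_on_diff continuous_on_mult c' ca)
  then have cR: "continuous_on {r0..r3} R'" by (rule continuous_on_subset) (use r in auto)
  have Rq: "R r = A_int r / B_int r" if "r \<in> {0<..<\<beta>}" for r using that by (simp add: R_def ab)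
  obtain c x1 x2 x3 where x: "x1 \<in> {r0<..<r1}" "x2 \<in> {r1<..<r2}" "x3 \<in> {r2<..<r3}"
    "R x1 = c" "R x2 = c" "R x3 = c" "R' x1 < 0" "R' x2 > 0" "R' x3 < 0"
  proof (rule three_transversal_crossings[of r0 r3 R R' r1 r2 l h])
    show "(R has_real_derivative R' x) (at x)" if "x \<in> {r0..r3}" for x using dR that r by auto
  qed (use cR r \<open>l < h\<close> Q Rq in auto)
  have xin: "x1 \<in> {0<..<\<beta>}" "x2 \<in> {0<..<\<beta>}" "x3 \<in> {0<..<\<beta>}" using x r by auto
  define \<delta> where "\<delta> = min (x2 - x1) (x3 - x2) / 2"
  have \<delta>: "\<delta> > 0" "2 * \<delta> \<le> x2 - x1" "2 * \<delta> \<le> x3 - x2" using x by (auto simp: \<delta>_def)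
  have zero: "M \<sigma> c r = 0" "M' \<sigma> c r = - \<sigma> * (b r * R' r)"
    if "r \<in> {0<..<\<beta>}" "\<sigma> \<in> {1, -1}" "R r = c" for r \<sigma>
  proof -
    have acb: "a r = c * b r" using that(3) bp[OF that(1)] by (simp add: R_def field_simps)
    then show "M \<sigma> c r = 0" using M[OF that(1,2), of c] ab[OF that(1)] by simp
    have "b r * R' r = a' r - c * b' r" using bp[OF that(1)] acb by (simp add: R'_def field_simps)
    then show "M' \<sigma> c r = - \<sigma> * (b r * R' r)" using M'eq[OF that(1,2)] by simp
  qed
  have cycle: "\<exists>e0>0. \<forall>e. 0 < e \<and> e < e0 \<longrightarrow> (\<exists>\<Gamma>. stable_limit_cycle (\<lambda>p. (- \<sigma>) *\<^sub>R damped_field K m c e p) \<Gamma> \<and>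
      \<Gamma> \<noteq> {} \<and> (\<forall>p\<in>\<Gamma>. \<bar>radius p - r\<bar> < \<delta>))"
    if "r \<in> {0<..<\<beta>}" "\<sigma> \<in> {1, -1}" "R r = c" "\<sigma> * R' r > 0" for r \<sigma>
  proof -
    have "M' \<sigma> c r = - (b r * (\<sigma> * R' r))" using zero(2)[OF that(1-3)] by (simp add: mult_ac)
    moreover have "b r * (\<sigma> * R' r) > 0" by (intro mult_pos_pos bp that)
    ultimately have "M' \<sigma> c r < 0" by linarith
    then show ?thesis
      using averaged_limit_cycle[OF that(1,2) \<delta>(1), of c] zero(1)[OF that(1-3)] unfolding M_def M'_def by metis
  qed
  obtain e1 where e1: "e1 > 0" "\<And>e. 0 < e \<Longrightarrow> e < e1 \<Longrightarrow> \<exists>\<Gamma>. stable_limit_cycle (\<lambda>p. (- (-1)) *\<^sub>R damped_field K m c e p) \<Gamma> \<and>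
      \<Gamma> \<noteq> {} \<and> (\<forall>p\<in>\<Gamma>. \<bar>radius p - x1\<bar> < \<delta>)"
    using cycle[OF xin(1), of "-1"] x by auto
  obtain e2 where e2: "e2 > 0" "\<And>e. 0 < e \<Longrightarrow> e < e2 \<Longrightarrow> \<exists>\<Gamma>. stable_limit_cycle (\<lambda>p. (- 1) *\<^sub>R damped_field K m c e p) \<Gamma> \<and>
      \<Gamma> \<noteq> {} \<and> (\<forall>p\<in>\<Gamma>. \<bar>radius p - x2\<bar> < \<delta>)"
    using cycle[OF xin(2), of 1] x by auto
  obtain e3 where e3: "e3 > 0" "\<And>e. 0 < e \<Longrightarrow> e < e3 \<Longrightarrow> \<exists>\<Gamma>. stable_limit_cycle (\<lambda>p. (- (-1)) *\<^sub>R damped_field K m c e p) \<Gamma> \<and>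
      \<Gamma> \<noteq> {} \<and> (\<forall>p\<in>\<Gamma>. \<bar>radius p - x3\<bar> < \<delta>)"
    using cycle[OF xin(3), of "-1"] x by auto
  define e where "e = min e1 (min e2 e3) / 2"
  have e: "0 < e" "e < e1" "e < e2" "e < e3" using e1(1) e2(1) e3(1) by (auto simp: e_def min_def)
  let ?F = "damped_field K m c e"
  obtain \<Gamma>1 where \<Gamma>1: "stable_limit_cycle ?F \<Gamma>1" "\<Gamma>1 \<noteq> {}" "\<forall>p\<in>\<Gamma>1. \<bar>radius p - x1\<bar> < \<delta>"
    using e1(2)[OF e(1,2)] by auto
  obtain \<Gamma>3 where \<Gamma>3: "stable_limit_cycle (\<lambda>p. - ?F p) \<Gamma>3" "\<Gamma>3 \<noteq> {}" "\<forall>p\<in>\<Gamma>3. \<bar>radius p - x2\<bar> < \<delta>"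
    using e2(2)[OF e(1,3)] by auto
  obtain \<Gamma>2 where \<Gamma>2: "stable_limit_cycle ?F \<Gamma>2" "\<Gamma>2 \<noteq> {}" "\<forall>p\<in>\<Gamma>2. \<bar>radius p - x3\<bar> < \<delta>"
    using e3(2)[OF e(1,4)] by auto
  have disj: "\<Gamma> \<noteq> \<Delta>" if dj: "\<Gamma> \<noteq> {}" "\<forall>p\<in>\<Gamma>. \<bar>radius p - x\<bar> < \<delta>" "\<forall>p\<in>\<Delta>. \<bar>radius p - y\<bar> < \<delta>" "2 * \<delta> \<le> y - x" for \<Gamma> \<Delta> x y
  proof
    assume "\<Gamma> = \<Delta>"
    then obtain p where "\<bar>radius p - x\<bar> < \<delta>" "\<bar>radius p - y\<bar> < \<delta>" using dj by blast
    then show False using dj(4) by linarith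
  qed
  have "\<Gamma>1 \<noteq> \<Gamma>3" by (rule disj[OF \<Gamma>1(2,3) \<Gamma>3(3) \<delta>(2)])
  moreover have "\<Gamma>3 \<noteq> \<Gamma>2" by (rule disj[OF \<Gamma>3(2,3) \<Gamma>2(3) \<delta>(3)])
  moreover have "\<Gamma>1 \<noteq> \<Gamma>2" by (rule disj[OF \<Gamma>1(2,3) \<Gamma>2(3)]) (use \<delta> in linarith)
  moreover have "unstable_limit_cycle ?F \<Gamma>3" by (rule stable_reverse_unstable[OF \<Gamma>3(1)])
  ultimately show ?thesis using \<Gamma>1(1) \<Gamma>2(1) planar_S_system_damped_field[OF K, of m c e]
    by (intro exI[of _ ?F] conjI exI[of _ \<Gamma>1] exI[of _ \<Gamma>2] exI[of _ \<Gamma>3]) auto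
qed

end

section \<open>The square root of the potential\<close>

definition potential :: "nat \<Rightarrow> real \<Rightarrow> real" where
  "potential m z = (z ^ Suc m - 1) / real (Suc m) - (z - 1)"

text \<open>\<open>potential_quot\<close> is the potential divided by \<open>(z - 1)\<^sup>2\<close>. Being positive and smooth, it allows a square
  root of the potential that is smooth across its minimum.\<close>

definition potential_quot :: "nat \<Rightarrow> real \<Rightarrow> real" where
  "potential_quot m z = (\<Sum>k<Suc m. \<Sum>j<k. z ^ j) / real (Suc m)"

definition potential_quot' :: "nat \<Rightarrow> real \<Rightarrow> real" where
  "potential_quot' m z = (\<Sum>k<Suc m. \<Sum>j<k. real j * z ^ (j - 1)) / real (Suc m)"

definition geo :: "nat \<Rightarrow> real \<Rightarrow> real" where "geo m z = (\<Sum>j<m. z ^ j)"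

definition geo' :: "nat \<Rightarrow> real \<Rightarrow> real" where "geo' m z = (\<Sum>j<m. real j * z ^ (j - 1))"

lemma geo_eq: "(z - 1) * geo m z = z ^ m - 1"
  unfolding geo_def using power_diff_1_eq[of z m] by (cases "m = 0") auto

lemma potential_eq: "potential m z = (z - 1)\<^sup>2 * potential_quot m z"
proof -
  have "(z - 1)\<^sup>2 * (\<Sum>k<Suc m. \<Sum>j<k. z ^ j) = (z - 1) * (\<Sum>k<Suc m. (z - 1) * geo k z)"
    by (simp only: power2_eq_square sum_distrib_left geo_def mult.assoc)
  also have "\<dots> = (z - 1) * (geo (Suc m) z - real (Suc m))"
    by (simp only: geo_eq) (simp add: sum_subtractf geo_def)
  also have "\<dots> = (z ^ Suc m - 1) - real (Suc m) * (z - 1)"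
    using geo_eq[of z "Suc m"] by (simp add: algebra_simps)
  finally show ?thesis by (simp add: potential_def potential_quot_def field_simps)
qed

lemma potential_quot_deriv: "(potential_quot m has_real_derivative potential_quot' m z) (at z)"
  unfolding potential_quot_def[abs_def] potential_quot'_def
  by (intro DERIV_cdivide DERIV_sum) (auto intro!: derivative_eq_intros)

lemma geo_deriv: "(geo m has_real_derivative geo' m z) (at z)"
  unfolding geo_def[abs_def] geo'_def by (intro DERIV_sum) (auto intro!: derivative_eq_intros)

lemma potential_deriv: "(potential m has_real_derivative z ^ m - 1) (at z)"
  unfolding potential_def[abs_def] by (auto intro!: derivative_eq_intros simp del: of_nat_Suc power_Suc)

lemma potential_quot_pos: "0 < z \<Longrightarrow> m \<ge> 1 \<Longrightarrow> potential_quot m z > 0"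
proof -
  assume "0 < z" "m \<ge> 1"
  have "(\<Sum>k<Suc m. \<Sum>j<k. z ^ j) > 0"
  proof (rule sum_pos2)
    show "1 \<in> {..<Suc m}" using \<open>m \<ge> 1\<close> by simp
    show "0 < (\<Sum>j<1::nat. z ^ j)" by simp
    show "0 \<le> (\<Sum>j<k. z ^ j)" for k using \<open>0 < z\<close> by (intro sum_nonneg) simp
  qed simp
  then show ?thesis by (simp add: potential_quot_def)
qed

lemma geo_pos: "0 < z \<Longrightarrow> m \<ge> 1 \<Longrightarrow> geo m z > 0"
  unfolding geo_def by (intro sum_pos) (auto simp: lessThan_empty_iff)

lemma potential_quot_identity: "2 * potential_quot m z + (z - 1) * potential_quot' m z = geo m z"
proof (cases "z = 1")
  case True
  have "2 * (\<Sum>k<n. real k) = real n * (real n - 1)" for n by (induction n) (auto simp: algebra_simps)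
  from this[of "Suc m"] show ?thesis using True by (simp add: potential_quot_def geo_def field_simps)
next
  case False
  have "((\<lambda>z. (z - 1)\<^sup>2 * potential_quot m z) has_real_derivative 2 * (z - 1) * potential_quot m z + (z - 1)\<^sup>2 * potential_quot' m z) (at z)"
    by (auto intro!: derivative_eq_intros potential_quot_deriv)
  then have "(potential m has_real_derivative 2 * (z - 1) * potential_quot m z + (z - 1)\<^sup>2 * potential_quot' m z) (at z)"
    by (simp add: potential_eq[abs_def])
  then have "2 * (z - 1) * potential_quot m z + (z - 1)\<^sup>2 * potential_quot' m z = z ^ m - 1"
    using potential_deriv DERIV_unique by blast
  then have "(z - 1) * (2 * potential_quot m z + (z - 1) * potential_quot' m z) = (z - 1) * geo m z"
    unfolding geo_eq by (simp add: algebra_simps power2_eq_square)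
  then show ?thesis using False by simp
qed

definition energy_root :: "real \<Rightarrow> nat \<Rightarrow> real \<Rightarrow> real" where
  "energy_root K m z = (z - 1) * sqrt (2 * K * potential_quot m z)"

definition root_slope :: "real \<Rightarrow> nat \<Rightarrow> real \<Rightarrow> real" where
  "root_slope K m z = K * geo m z / sqrt (2 * K * potential_quot m z)"

definition root_slope' :: "real \<Rightarrow> nat \<Rightarrow> real \<Rightarrow> real" where
  "root_slope' K m z = (K * geo' m z * sqrt (2 * K * potential_quot m z) - K * geo m z * (K * potential_quot' m z / sqrt (2 * K * potential_quot m z)))
      / (2 * K * potential_quot m z)"

context
  fixes K :: real and m :: nat
  assumes K: "K > 0" and m: "m \<ge> 1"
begin

lemma energy_root_squared: "0 < z \<Longrightarrow> (energy_root K m z)\<^sup>2 = 2 * K * potential m z"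
  using potential_quot_pos[OF _ m, of z] K by (simp add: energy_root_def power_mult_distrib potential_eq)

lemma sqrt_potential_quot_deriv:
  assumes "0 < z"
  shows "((\<lambda>z. sqrt (2 * K * potential_quot m z)) has_real_derivative K * potential_quot' m z / sqrt (2 * K * potential_quot m z)) (at z)"
proof -
  have p: "0 < 2 * K * potential_quot m z" using potential_quot_pos[OF assms m] K by simp
  have "((\<lambda>z. 2 * K * potential_quot m z) has_real_derivative 2 * K * potential_quot' m z) (at z)" by (intro DERIV_cmult potential_quot_deriv)
  from DERIV_chain'[OF this DERIV_real_sqrt[OF p]] show ?thesis by (rule DERIV_cong) (simp add: field_simps)
qed

lemma energy_root_deriv:
  assumes "0 < z"
  shows "(energy_root K m has_real_derivative root_slope K m z) (at z)"
proof -
  have p: "sqrt (2 * K * potential_quot m z) > 0" "sqrt (2 * K * potential_quot m z) * sqrt (2 * K * potential_quot m z) = 2 * K * potential_quot m z"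
    using potential_quot_pos[OF assms m] K by auto
  let ?s = "sqrt (2 * K * potential_quot m z)"
  have "(energy_root K m has_real_derivative 1 * ?s + (K * potential_quot' m z / ?s) * (z - 1)) (at z)"
    unfolding energy_root_def[abs_def]
    by (rule DERIV_mult[OF _ sqrt_potential_quot_deriv[OF assms]]) (auto intro!: derivative_eq_intros)
  moreover have "1 * ?s + (K * potential_quot' m z / ?s) * (z - 1) = root_slope K m z"
  proof -
    have "1 * s + (k / s) * (z - 1) = (s * s + k * (z - 1)) / s" if "s > 0" for s k :: real
      using that by (simp add: field_simps)
    from this[OF p(1)] have "1 * ?s + (K * potential_quot' m z / ?s) * (z - 1) = (?s * ?s + K * potential_quot' m z * (z - 1)) / ?s" .
    also have "?s * ?s + K * potential_quot' m z * (z - 1) = K * geo m z"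
      unfolding p(2) potential_quot_identity[symmetric] by (simp add: algebra_simps)
    finally show ?thesis by (simp add: root_slope_def)
  qed
  ultimately show ?thesis by simp
qed

lemma root_slope_pos: "0 < z \<Longrightarrow> root_slope K m z > 0"
  using potential_quot_pos[OF _ m, of z] geo_pos[OF _ m, of z] K by (simp add: root_slope_def)

lemma root_slope_deriv:
  assumes "0 < z"
  shows "(root_slope K m has_real_derivative root_slope' K m z) (at z)"
proof -
  have p: "sqrt (2 * K * potential_quot m z) > 0" using potential_quot_pos[OF assms m] K by simp
  then have "(root_slope K m has_real_derivative (K * geo' m z * sqrt (2 * K * potential_quot m z) - K * geo m z * (K * potential_quot' m z / sqrt (2 * K * potential_quot m z)))
      / (sqrt (2 * K * potential_quot m z) * sqrt (2 * K * potential_quot m z))) (at z)"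
    unfolding root_slope_def[abs_def]
    by (intro DERIV_divide sqrt_potential_quot_deriv DERIV_cmult geo_deriv assms) auto
  then show ?thesis using potential_quot_pos[OF assms m] K by (simp add: root_slope'_def)
qed

lemma root_slope'_continuous: "continuous_on {0<..} (root_slope' K m)"
proof -
  have k: "continuous_on {0<..} (potential_quot m)" "continuous_on {0<..} (geo m)" "continuous_on {0<..} (potential_quot' m)" "continuous_on {0<..} (geo' m)"
    unfolding potential_quot_def[abs_def] geo_def[abs_def] potential_quot'_def[abs_def] geo'_def[abs_def] by (intro continuous_intros; simp)+
  have "\<forall>z\<in>{0<..}. 2 * K * potential_quot m z \<noteq> 0" "\<forall>z\<in>{0<..}. sqrt (2 * K * potential_quot m z) \<noteq> 0"
    using potential_quot_pos[OF _ m] K by force+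
  then show ?thesis unfolding root_slope'_def[abs_def] by (intro continuous_intros k)
qed

lemma energy_root_strict_mono:
  assumes "0 < x" "x < y"
  shows "energy_root K m x < energy_root K m y"
proof (rule DERIV_pos_imp_increasing[OF assms(2)])
  fix u assume "x \<le> u" "u \<le> y"
  then have "0 < u" using assms by simp
  then show "\<exists>v. (energy_root K m has_real_derivative v) (at u) \<and> 0 < v"
    using energy_root_deriv root_slope_pos by blast
qed

definition "root_inv = inv_into {0<..} (energy_root K m)"

lemma inj_energy_root: "inj_on (energy_root K m) {0<..}"
  by (rule inj_onI) (metis energy_root_strict_mono greaterThan_iff less_irrefl linorder_neqE_linordered_idom)

lemma energy_root_continuous: "continuous_on {0<..} (energy_root K m)"
  by (rule DERIV_continuous_on[OF has_field_derivative_at_within[OF energy_root_deriv]]) simp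

lemma energy_coordinate_energy_root:
  assumes lo: "energy_root K m zl \<le> - 1" and hi: "1 \<le> energy_root K m zh" and z: "0 < zl" "zl < zh"
  defines "\<zeta>1 \<equiv> \<lambda>x. 1 / root_slope K m (root_inv x)"
  defines "\<zeta>2 \<equiv> \<lambda>x. - (root_slope' K m (root_inv x) * \<zeta>1 x) / (root_slope K m (root_inv x) * root_slope K m (root_inv x))"
  shows "energy_coordinate K 1 m (energy_root K m) root_inv \<zeta>1 \<zeta>2"
proof -
  have inv1: "root_inv (energy_root K m z) = z" if "z > 0" for z
    unfolding root_inv_def using inv_into_f_f[OF inj_energy_root] that by simp
  have img: "x \<in> energy_root K m ` {0<..}" if x: "\<bar>x\<bar> < 1" for x
  proof -
    have "continuous_on {zl..zh} (energy_root K m)"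
      by (rule continuous_on_subset[OF energy_root_continuous]) (use z in auto)
    then obtain w where "zl \<le> w" "w \<le> zh" "energy_root K m w = x"
      using IVT'[of "energy_root K m" zl x zh] lo hi z x by (auto simp: abs_less_iff)
    then show ?thesis using z by (intro image_eqI[of _ _ w]) auto
  qed
  have inv2: "energy_root K m (root_inv x) = x" "root_inv x > 0" if "\<bar>x\<bar> < 1" for x
    using f_inv_into_f[OF img[OF that]] inv_into_into[OF img[OF that]] unfolding root_inv_def by auto
  have cont: "isCont root_inv x" if x: "\<bar>x\<bar> < 1" for x
  proof -
    let ?w = "root_inv x"
    have w: "?w > 0" "energy_root K m ?w = x" using inv2[OF x] by auto
    have "isCont root_inv (energy_root K m ?w)"
    proof (rule isCont_inverse_function[where d = "?w / 2" and x = ?w and f = "energy_root K m" and g = root_inv])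
      show "root_inv (energy_root K m z) = z" if "\<bar>z - ?w\<bar> \<le> ?w / 2" for z
      proof -
        have "z > 0" using that w(1) by linarith
        then show ?thesis by (rule inv1)
      qed
      show "isCont (energy_root K m) z" if "\<bar>z - ?w\<bar> \<le> ?w / 2" for z
      proof -
        have "z > 0" using that w(1) by linarith
        then show ?thesis by (rule DERIV_isCont[OF energy_root_deriv])
      qed
    qed (use w in auto)
    then show ?thesis using w by simp
  qed
  have d: "(root_inv has_real_derivative \<zeta>1 x) (at x)" if x: "\<bar>x\<bar> < 1" for x
  proof -
    have "(root_inv has_real_derivative inverse (root_slope K m (root_inv x))) (at x)"
    proof (rule DERIV_inverse_function[where g = root_inv and x = x and D = "root_slope K m (root_inv x)" and f = "energy_root K m" and a = "- 1" and b = 1])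
      show "(energy_root K m has_real_derivative root_slope K m (root_inv x)) (at (root_inv x))"
        by (rule energy_root_deriv[OF inv2(2)[OF x]])
      show "root_slope K m (root_inv x) \<noteq> 0" using root_slope_pos[OF inv2(2)[OF x]] by simp
      show "energy_root K m (root_inv y) = y" if "- 1 < y" "y < 1" for y using that by (intro inv2) auto
    qed (use x cont in auto)
    then show ?thesis by (simp add: \<zeta>1_def divide_inverse)
  qed
  have d1: "(\<zeta>1 has_real_derivative \<zeta>2 x) (at x)" if x: "\<bar>x\<bar> < 1" for x
  proof -
    have "((\<lambda>x. root_slope K m (root_inv x)) has_real_derivative root_slope' K m (root_inv x) * \<zeta>1 x) (at x)"
      by (rule DERIV_chain'[OF d[OF x] root_slope_deriv[OF inv2(2)[OF x]]])
    from DERIV_divide[OF DERIV_const[of 1] this] root_slope_pos[OF inv2(2)[OF x]]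
    show ?thesis unfolding \<zeta>1_def[abs_def] \<zeta>2_def by simp
  qed
  have rc: "continuous_on {-1<..<1} root_inv"
    using cont by (auto intro!: continuous_at_imp_continuous_on)
  have im: "root_inv ` {-1<..<1} \<subseteq> {0<..}" using inv2(2) by auto
  show ?thesis
  proof
    show "K > 0" by (rule K)
    show "0 < root_inv x" if "\<bar>x\<bar> < 1" for x by (rule inv2(2)[OF that])
    show "(root_inv has_real_derivative \<zeta>1 x) (at x)" if "\<bar>x\<bar> < 1" for x by (rule d[OF that])
    show "0 < \<zeta>1 x" if "\<bar>x\<bar> < 1" for x unfolding \<zeta>1_def using root_slope_pos[OF inv2(2)[OF that]] by simp
    show "(\<zeta>1 has_real_derivative \<zeta>2 x) (at x)" if "\<bar>x\<bar> < 1" for x by (rule d1[OF that])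
    show "continuous_on {-1<..<1} \<zeta>2"
    proof -
      have a: "continuous_on {-1<..<1} (\<lambda>x. root_slope' K m (root_inv x))"
        by (rule continuous_on_compose2[OF root_slope'_continuous rc im])
      have "continuous_on {0<..} (root_slope K m)"
        by (rule DERIV_continuous_on[OF has_field_derivative_at_within[OF root_slope_deriv]]) simp
      then have b: "continuous_on {-1<..<1} (\<lambda>x. root_slope K m (root_inv x))"
        by (rule continuous_on_compose2[OF _ rc im])
      have nz: "\<forall>x\<in>{-1<..<1}. root_slope K m (root_inv x) \<noteq> 0" 
      proof
        fix x :: real assume "x \<in> {-1<..<1}"
        then have "root_inv x > 0" using im by blast
        from root_slope_pos[OF this] show "root_slope K m (root_inv x) \<noteq> 0" by simp
      qed
      then have "\<forall>x\<in>{-1<..<1}. root_slope K m (root_inv x) * root_slope K m (root_inv x) \<noteq> 0" by simp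
      then show ?thesis unfolding \<zeta>2_def \<zeta>1_def
        by (intro continuous_on_divide continuous_on_minus continuous_on_mult continuous_on_const a b nz)
    qed
    show "energy_root K m (root_inv x) = x" if "\<bar>x\<bar> < 1" for x by (rule inv2(1)[OF that])
    show "root_inv (energy_root K m z) = z" if "z > 0" for z by (rule inv1[OF that])
    show "continuous_on {0<..} (energy_root K m)" by (rule energy_root_continuous)
    show "x = K * (root_inv x ^ m - 1) * \<zeta>1 x" if x: "\<bar>x\<bar> < 1" for x
    proof -
      let ?w = "root_inv x"
      note w = inv2[OF x]
      have "energy_root K m ?w * root_slope K m ?w = K * ((?w - 1) * geo m ?w)"
        using potential_quot_pos[OF w(2) m] K by (simp add: energy_root_def root_slope_def)
      then have "x * root_slope K m ?w = K * (?w ^ m - 1)" unfolding w(1) geo_eq .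
      then show ?thesis using root_slope_pos[OF w(2)] by (simp add: \<zeta>1_def field_simps)
    qed
  qed auto
qed

end

section \<open>The ratio of the integrals near the equilibrium\<close>

lemma nonneg_of_derivative_nonneg:
  fixes f f' :: "real \<Rightarrow> real"
  assumes "\<And>x. 0 \<le> x \<Longrightarrow> x \<le> t \<Longrightarrow> (f has_real_derivative f' x) (at x)"
    "\<And>x. 0 \<le> x \<Longrightarrow> x \<le> t \<Longrightarrow> 0 \<le> f' x" "f 0 = 0" "0 \<le> t"
  shows "0 \<le> f t"
  using DERIV_nonneg_imp_nondecreasing[OF assms(4), of f] assms by (metis order_refl)

lemma ln_ratio_lower:
  assumes "0 \<le> t" "t < 1"
  shows "2 * (t + t ^ 3 / 3 + t ^ 5 / 5) \<le> ln (1 + t) - ln (1 - t :: real)"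
proof -
  let ?f = "\<lambda>t::real. ln (1 + t) - ln (1 - t) - 2 * (t + t ^ 3 / 3 + t ^ 5 / 5)"
  let ?f' = "\<lambda>t::real. 1 / (1 + t) + 1 / (1 - t) - 2 * (1 + t\<^sup>2 + t ^ 4)"
  have "0 \<le> ?f t"
  proof (rule nonneg_of_derivative_nonneg[of t ?f ?f'])
    fix x :: real assume x: "0 \<le> x" "x \<le> t"
    then have x1: "x < 1" using assms by simp
    have l: "((\<lambda>t. ln (1 + t) - ln (1 - t)) has_real_derivative 1 / (1 + x) + 1 / (1 - x)) (at x)"
      using x x1 by (auto intro!: derivative_eq_intros)
    have p: "((\<lambda>t. 2 * (t + t ^ 3 / 3 + t ^ 5 / 5)) has_real_derivative 2 * (1 + x\<^sup>2 + x ^ 4)) (at x)"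
      by (auto intro!: derivative_eq_intros)
    show "(?f has_real_derivative ?f' x) (at x)" by (rule DERIV_diff[OF l p])
    have "x\<^sup>2 < 1" using x x1 by (simp add: power_less_one_iff)
    have "1 / (1 + x) + 1 / (1 - x) = 2 / ((1 + x) * (1 - x))" using x x1 by (simp add: divide_simps)
    also have "(1 + x) * (1 - x) = 1 - x\<^sup>2" by (simp add: algebra_simps power2_eq_square)
    finally have "?f' x = 2 / (1 - x\<^sup>2) - 2 * (1 + x\<^sup>2 + x ^ 4)" by simp
    also have "\<dots> = 2 * x ^ 6 / (1 - x\<^sup>2)"
      using \<open>x\<^sup>2 < 1\<close> by (simp add: field_simps)
    also have "\<dots> \<ge> 0" using \<open>x\<^sup>2 < 1\<close> x by simp
    finally show "0 \<le> ?f' x" .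
  qed (use assms in auto)
  then show ?thesis by simp
qed

lemma ln_ratio_upper:
  assumes "0 \<le> t" "t < 1"
  shows "ln (1 + t) - ln (1 - t :: real) \<le> 2 * t / (1 - t)"
proof -
  have "ln (1 + t) \<le> t" using ln_add_one_self_le_self[OF assms(1)] .
  moreover have "- ln (1 - t) \<le> t / (1 - t)"
    using ln_le_minus_one[of "1 / (1 - t)"] assms by (simp add: ln_div field_simps)
  moreover have "t \<le> t / (1 - t)" using assms by (simp add: field_simps)
  ultimately show ?thesis by simp
qed

lemma arctan_upper:
  assumes "0 \<le> x"
  shows "arctan x \<le> x - x ^ 3 / 3 + x ^ 5 / 5"
proof -
  let ?f = "\<lambda>x::real. (x - x ^ 3 / 3 + x ^ 5 / 5) - arctan x" and ?f' = "\<lambda>x::real. (1 - x\<^sup>2 + x ^ 4) - inverse (1 + x\<^sup>2)"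
  have "0 \<le> ?f x"
  proof (rule nonneg_of_derivative_nonneg[of x ?f ?f'])
    fix y :: real
    have p: "((\<lambda>x. x - x ^ 3 / 3 + x ^ 5 / 5) has_real_derivative 1 - y\<^sup>2 + y ^ 4) (at y)"
      by (auto intro!: derivative_eq_intros)
    show "(?f has_real_derivative ?f' y) (at y)" by (rule DERIV_diff[OF p DERIV_arctan])
    have "inverse (1 + y\<^sup>2) * 1 \<le> inverse (1 + y\<^sup>2) * (1 + y ^ 6)"
      by (intro mult_left_mono) (auto simp: zero_le_even_power add_nonneg_nonneg)
    also have "1 + y ^ 6 = (1 + y\<^sup>2) * (1 - y\<^sup>2 + y ^ 4)" by (simp add: algebra_simps)
    also have "inverse (1 + y\<^sup>2) * \<dots> = 1 - y\<^sup>2 + y ^ 4"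
      using add_pos_nonneg[OF zero_less_one zero_le_power2[of y]] by (simp add: mult.assoc[symmetric])
    finally show "0 \<le> ?f' y" by simp
  qed (use assms in auto)
  then show ?thesis by simp
qed

lemma arctan_lower:
  assumes "0 \<le> x"
  shows "x - x ^ 3 / 3 \<le> arctan x"
proof -
  let ?f = "\<lambda>x::real. arctan x - (x - x ^ 3 / 3)" and ?f' = "\<lambda>x::real. inverse (1 + x\<^sup>2) - (1 - x\<^sup>2)"
  have "0 \<le> ?f x"
  proof (rule nonneg_of_derivative_nonneg[of x ?f ?f'])
    fix y :: real
    have p: "((\<lambda>x. x - x ^ 3 / 3) has_real_derivative 1 - y\<^sup>2) (at y)"
      by (auto intro!: derivative_eq_intros)
    show "(?f has_real_derivative ?f' y) (at y)" by (rule DERIV_diff[OF DERIV_arctan p])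
    have "1 - y\<^sup>2 = inverse (1 + y\<^sup>2) * ((1 + y\<^sup>2) * (1 - y\<^sup>2))"
      using add_pos_nonneg[OF zero_less_one zero_le_power2[of y]] by (simp add: mult.assoc[symmetric])
    also have "(1 + y\<^sup>2) * (1 - y\<^sup>2) = 1 - y ^ 4" by (simp add: algebra_simps)
    also have "inverse (1 + y\<^sup>2) * (1 - y ^ 4) \<le> inverse (1 + y\<^sup>2) * 1"
      by (intro mult_left_mono) (auto simp: zero_le_even_power add_nonneg_nonneg)
    finally show "0 \<le> ?f' y" by simp
  qed (use assms in auto)
  then show ?thesis by simp
qed

context energy_coordinate
begin

lemma integrands_continuous:
  assumes r: "r \<in> {0<..<\<beta>}"
  shows "continuous_on {\<zeta> (- r)..\<zeta> r} (\<lambda>z. 2 * height r z / z)"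
    "continuous_on {\<zeta> (- r)..\<zeta> r} (\<lambda>z. ln (1 + height r z) - ln (1 - height r z))"
proof -
  show "continuous_on {\<zeta> (- r)..\<zeta> r} (\<lambda>z. 2 * height r z / z)"
    by (intro continuous_intros height_continuous[OF r]) (use \<zeta>_range(1)[OF r] in force)
  have h: "0 \<le> height r z" "height r z < 1" if "z \<in> {\<zeta> (- r)..\<zeta> r}" for z
    using height_bounds[OF r that] r \<beta> by auto
  show "continuous_on {\<zeta> (- r)..\<zeta> r} (\<lambda>z. ln (1 + height r z) - ln (1 - height r z))"
    by (intro continuous_intros height_continuous[OF r]) (use h in force)+
qed

text \<open>Close to the equilibrium both \<open>1 / x1\<close> and \<open>1 / x2\<close> are close to 1.\<close>

lemma ratio_tends_to_one:
  assumes "\<zeta> 0 = 1" "h < 1" "r' > 0"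
  obtains r where "0 < r" "r < r'" "r < \<beta>" "h \<le> A_int r / B_int r"
proof -
  define \<eta> where "\<eta> = min ((1 - h) / 2) (1 / 2)"
  have \<eta>: "0 < \<eta>" "\<eta> < 1" "h \<le> 1 - 2 * \<eta>"
  proof -
    have "\<eta> \<le> (1 - h) / 2" "\<eta> \<le> 1 / 2" unfolding \<eta>_def by (rule min.cobounded1, rule min.cobounded2)
    then show "\<eta> < 1" "h \<le> 1 - 2 * \<eta>" by (linarith, simp add: field_simps)
    show "0 < \<eta>" using assms(2) by (simp add: \<eta>_def)
  qed
  have "isCont \<zeta> 0" using \<zeta>_deriv[of 0] \<beta> by (intro DERIV_isCont[of \<zeta> "\<zeta>1 0"]) auto
  then obtain d where d: "d > 0" "\<And>x. \<bar>x\<bar> < d \<Longrightarrow> \<bar>\<zeta> x - 1\<bar> < \<eta>"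
    using \<eta>(1) assms(1) unfolding continuous_at_eps_delta by (auto simp: dist_real_def)
  define r where "r = min (min d \<eta>) (min r' \<beta>) / 2"
  have r: "0 < r" "r < d" "r < \<eta>" "r < r'" "r < \<beta>"
    using d(1) \<eta>(1) assms(3) \<beta>(1) by (auto simp: r_def)
  have rin: "r \<in> {0<..<\<beta>}" using r by simp
  let ?I = "{\<zeta> (- r)..\<zeta> r}"
  define T where "T = integral ?I (height r)"
  have zr: "\<zeta> r < 1 + \<eta>" using d(2)[of r] r by auto
  have "2 * T / (1 + \<eta>) = integral ?I (\<lambda>z. 2 / (1 + \<eta>) * height r z)" by (simp add: T_def)
  also have "\<dots> \<le> A_int r"
    unfolding A_int_def
  proof (rule integral_le)
    show "(\<lambda>z. 2 / (1 + \<eta>) * height r z) integrable_on ?I" by (intro integrable_continuous_real continuous_on_mult continuous_on_const height_continuous[OF rin])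
    show "(\<lambda>z. 2 * height r z / z) integrable_on ?I" by (rule integrable_continuous_real[OF integrands_continuous(1)[OF rin]])
    fix z assume z: "z \<in> ?I"
    then have "0 < z" "z \<le> 1 + \<eta>" using \<zeta>_range(1)[OF rin z] zr by auto
    then have "2 * height r z / (1 + \<eta>) \<le> 2 * height r z / z"
      using height_bounds(1)[OF rin z] \<eta> by (intro divide_left_mono) auto
    then show "2 / (1 + \<eta>) * height r z \<le> 2 * height r z / z" by simp
  qed
  finally have A: "2 * T \<le> A_int r * (1 + \<eta>)" using \<eta> by (simp add: divide_le_eq)
  have "B_int r \<le> integral ?I (\<lambda>z. 2 / (1 - \<eta>) * height r z)"
    unfolding B_int_def
  proof (rule integral_le)
    show "(\<lambda>z. 2 / (1 - \<eta>) * height r z) integrable_on ?I" by (intro integrable_continuous_real continuous_on_mult continuous_on_const height_continuous[OF rin])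
    show "(\<lambda>z. ln (1 + height r z) - ln (1 - height r z)) integrable_on ?I"
      by (rule integrable_continuous_real[OF integrands_continuous(2)[OF rin]])
    fix z assume z: "z \<in> ?I"
    let ?t = "height r z"
    have t: "0 \<le> ?t" "?t \<le> \<eta>" using height_bounds[OF rin z] r by auto
    have "ln (1 + ?t) - ln (1 - ?t) \<le> 2 * ?t / (1 - ?t)" using t \<eta> by (intro ln_ratio_upper) auto
    also have "\<dots> \<le> 2 * ?t / (1 - \<eta>)" using t \<eta> by (intro divide_left_mono) auto
    finally show "ln (1 + ?t) - ln (1 - ?t) \<le> 2 / (1 - \<eta>) * ?t" by simp
  qed
  also have "\<dots> = 2 * T / (1 - \<eta>)" by (simp add: T_def)
  finally have B: "B_int r * (1 - \<eta>) \<le> 2 * T" using \<eta> by (simp add: le_divide_eq)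
  have Bp: "B_int r > 0" by (rule B_int_pos[OF rin])
  have "h * (1 + \<eta>) \<le> (1 - 2 * \<eta>) * (1 + \<eta>)" using \<eta> by (intro mult_right_mono) auto
  also have "\<dots> \<le> 1 - \<eta>" by (simp add: algebra_simps)
  finally have "B_int r * (h * (1 + \<eta>)) \<le> B_int r * (1 - \<eta>)" using Bp by (intro mult_left_mono) auto
  then have "(h * B_int r) * (1 + \<eta>) \<le> A_int r * (1 + \<eta>)" using A B by (simp add: mult_ac)
  then have "h * B_int r \<le> A_int r" using \<eta> by simp
  then have "h \<le> A_int r / B_int r" using Bp by (simp add: le_divide_eq)
  then show ?thesis using that r by blast
qed

text \<open>At first order \<open>A\<close> and \<open>B\<close> are equal. To see the next order in \<open>A\<close>, note that \<open>1 / z - 1\<close> is the product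
  of the force \<open>K * (z ^ m - 1)\<close>, which is a derivative along the orbit, with \<open>W = - 1 / (K * q z)\<close>. Integrating by
  parts, \<open>A\<close> becomes the integral of \<open>2 * t + 2 / 3 * w' * t ^ 3\<close>, where \<open>t\<close> is the height. The
  integrand of \<open>B\<close> is at least \<open>2 * t + 2 / 3 * t ^ 3\<close>, and \<open>w' 1 < 1\<close>.\<close>

lemma ratio_below_one:
  assumes \<zeta>0: "\<zeta> 0 = 1" and \<gamma>: "\<And>z. z > 0 \<Longrightarrow> (X z)\<^sup>2 = 2 * K * \<gamma> z"
    and d\<gamma>: "\<And>z. z > 0 \<Longrightarrow> (\<gamma> has_real_derivative z ^ m - 1) (at z)"
    and m: "m \<ge> 1" "real m + 1 < 2 * K * real m" and "r' > 0"
  obtains r where "0 < r" "r < r'" "r < \<beta>" "A_int r / B_int r < 1"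
proof -
  define q where "q z = z * geo m z" for z
  define w' where "w' z = (geo m z + z * geo' m z) / (K * (q z)\<^sup>2)" for z
  have q: "q z > 0" if "z > 0" for z using geo_pos[OF that m(1)] that by (simp add: q_def)
  have w'c: "continuous_on {0<..} w'"
  proof -
    have c: "continuous_on {0<..} (geo m)" "continuous_on {0<..} (geo' m)" "continuous_on {0<..} q"
      unfolding q_def[abs_def] geo_def[abs_def] geo'_def[abs_def] by (intro continuous_intros; simp)+
    have "\<forall>z\<in>{0<..}. K * (q z)\<^sup>2 \<noteq> 0" using q K by force
    then show ?thesis unfolding w'_def[abs_def] by (intro continuous_intros c)
  qed
  have w'1: "w' 1 < 1"
  proof -
    have s: "2 * (\<Sum>j<k. real j) = real k * (real k - 1)" for k by (induction k) (auto simp: algebra_simps)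
    have g1: "geo m 1 = real m" "geo' m 1 = real m * (real m - 1) / 2" using s[of m] by (simp_all add: geo_def geo'_def)
    have "w' 1 = (real m + 1) / (2 * K * real m)"
      using m(1) K by (simp add: w'_def q_def g1 power2_eq_square divide_simps) (simp add: algebra_simps)
    also have "\<dots> < 1" using m K by (simp add: divide_less_eq)
    finally show ?thesis .
  qed
  have "isCont w' 1" using w'c by (simp add: continuous_on_eq_continuous_at)
  then have "\<forall>\<^sub>F z in at 1. w' z < 1" using w'1 unfolding isCont_def by (rule order_tendstoD)
  then obtain \<eta> where \<eta>: "\<eta> > 0" "\<And>z. z \<noteq> 1 \<Longrightarrow> dist z 1 < \<eta> \<Longrightarrow> w' z < 1" by (auto simp: eventually_at)
  have "isCont \<zeta> 0" using \<zeta>_deriv[of 0] \<beta> by (intro DERIV_isCont[of \<zeta> "\<zeta>1 0"]) auto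
  then obtain d where d: "d > 0" "\<And>x. \<bar>x\<bar> < d \<Longrightarrow> \<bar>\<zeta> x - 1\<bar> < \<eta>"
    using \<eta>(1) \<zeta>0 unfolding continuous_at_eps_delta by (auto simp: dist_real_def)
  define r where "r = min d (min r' \<beta>) / 2"
  have r: "0 < r" "r < d" "r < r'" "r < \<beta>" using d(1) \<open>r' > 0\<close> \<beta>(1) by (auto simp: r_def)
  have rin: "r \<in> {0<..<\<beta>}" using r by simp
  let ?I = "{\<zeta> (- r)..\<zeta> r}" and ?t = "height r"
  note zp = \<zeta>_range(1)[OF rin]
  have lt: "\<zeta> (- r) < 1" "1 < \<zeta> r" using \<zeta>_strict_mono[of "- r" 0] \<zeta>_strict_mono[of 0 r] r \<zeta>0 by auto
  have w'lt: "w' z < 1" if "z \<in> ?I" for z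
  proof (cases "z = 1")
    case False
    have "\<bar>z - 1\<bar> < \<eta>" using d(2)[of r] d(2)[of "- r"] r that by (auto simp: abs_less_iff)
    then show ?thesis using \<eta>(2)[OF False] by (simp add: dist_real_def)
  qed (use w'1 in simp)
  have tc: "continuous_on ?I ?t" by (rule height_continuous[OF rin])
  have w'cI: "continuous_on ?I w'" by (rule continuous_on_subset[OF w'c]) (use zp in auto)
  have cD: "continuous_on ?I (\<lambda>z. 2 * ?t z + 2 / 3 * w' z * ?t z ^ 3)" by (intro continuous_intros tc w'cI)
  define W where "W = (\<lambda>z. - 1 / (K * q z))"
  define \<Psi> where "\<Psi> z = 2 / 3 * W z * ((r\<^sup>2 - (X z)\<^sup>2) * ?t z)" for z
  have "((\<lambda>z. (2 * ?t z + 2 / 3 * w' z * ?t z ^ 3) - 2 * ?t z / z) has_integral \<Psi> (\<zeta> r) - \<Psi> (\<zeta> (- r))) ?I"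
  proof (rule fundamental_theorem_of_calculus_interior)
    show "\<zeta> (- r) \<le> \<zeta> r" using lt by simp
    have "continuous_on ?I X" by (rule continuous_on_subset[OF X_cont]) (use zp in auto)
    moreover have "continuous_on ?I q" unfolding q_def[abs_def] geo_def[abs_def] by (intro continuous_intros)
    moreover have "\<forall>z\<in>?I. K * q z \<noteq> 0" using q zp K by force
    ultimately show "continuous_on ?I \<Psi>" unfolding \<Psi>_def[abs_def] W_def by (intro continuous_intros tc)
    fix z assume z: "z \<in> {\<zeta> (- r)<..<\<zeta> r}"
    then have zI: "z \<in> ?I" and z0: "z > 0" using zp[of z] by auto
    have Xlt: "\<bar>X z\<bar> < r"
    proof -
      have "\<bar>X z\<bar> \<le> r" by (rule \<zeta>_range(2)[OF rin zI])
      moreover have "X z \<noteq> r" "X z \<noteq> - r" using \<zeta>_X[of z] z z0 \<open>\<bar>X z\<bar> \<le> r\<close> r by auto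
      ultimately show ?thesis by linarith
    qed
    define H where "H = (\<lambda>z. r\<^sup>2 - 2 * K * \<gamma> z)"
    have HX: "H z = r\<^sup>2 - (X z)\<^sup>2" if "z > 0" for z using \<gamma>[OF that] by (simp add: H_def)
    have Hpos: "H z > 0" using Xlt r HX[OF z0] abs_square_less_1 by (simp add: power2_strict_mono abs_le_square_iff[symmetric] flip: not_le)
    have dH: "(H has_real_derivative - (2 * K * (z ^ m - 1))) (at z)"
      unfolding H_def by (auto intro!: derivative_eq_intros d\<gamma>[OF z0])
    have th: "?t z = sqrt (H z)" if "z > 0" for z using HX[OF that] by (simp add: height_def)
    have dq: "(q has_real_derivative geo m z + z * geo' m z) (at z)"
      unfolding q_def[abs_def] by (rule DERIV_cong[OF DERIV_mult[OF DERIV_ident geo_deriv]]) simp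
    have qz: "q z > 0" by (rule q[OF z0])
    have dW: "(W has_real_derivative w' z) (at z)"
    proof -
      have "((\<lambda>z. K * q z) has_real_derivative K * (geo m z + z * geo' m z)) (at z)" by (intro DERIV_cmult dq)
      moreover have "K * q z \<noteq> 0" using qz K by simp
      ultimately have "(W has_real_derivative
          (0 * (K * q z) - - 1 * (K * (geo m z + z * geo' m z))) / ((K * q z) * (K * q z))) (at z)"
        unfolding W_def by (intro DERIV_divide DERIV_const)
      then show ?thesis
        by (rule DERIV_cong) (use qz K in \<open>simp add: w'_def power2_eq_square field_simps\<close>)
    qed
    have dG: "((\<lambda>z. H z * sqrt (H z)) has_real_derivative - (3 * K * (z ^ m - 1)) * sqrt (H z)) (at z)"
    proof -
      from DERIV_mult[OF dH DERIV_chain'[OF dH DERIV_real_sqrt[OF Hpos]]]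
      show ?thesis
      proof (rule DERIV_cong)
        have s: "H z * (inverse (sqrt (H z)) / 2) = sqrt (H z) / 2"
          using Hpos by (simp add: field_simps)
        show "- (2 * K * (z ^ m - 1)) * sqrt (H z) + (inverse (sqrt (H z)) / 2 * - (2 * K * (z ^ m - 1))) * H z
            = - (3 * K * (z ^ m - 1)) * sqrt (H z)"
        proof -
          have "(inverse (sqrt (H z)) / 2 * - (2 * K * (z ^ m - 1))) * H z = - (2 * K * (z ^ m - 1)) * (H z * (inverse (sqrt (H z)) / 2))"
            by (simp only: mult_ac)
          then show ?thesis unfolding s by (simp add: algebra_simps)
        qed
      qed
    qed
    have "((\<lambda>z. 2 / 3 * W z * (H z * sqrt (H z))) has_real_derivative
        (2 * ?t z + 2 / 3 * w' z * ?t z ^ 3) - 2 * ?t z / z) (at z)"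
    proof (rule DERIV_cong[OF DERIV_mult[OF DERIV_cmult[OF dW] dG]])
      have t3: "H z * sqrt (H z) = ?t z ^ 3" using Hpos th[OF z0] by (simp add: power3_eq_cube)
      have e: "K * (z ^ m - 1) * W z = - ((z - 1) / z)"
        using K z0 geo_pos[OF z0 m(1)] by (simp add: W_def q_def geo_eq[symmetric] field_simps)
      have "- (3 * K * (z ^ m - 1)) * sqrt (H z) * (2 / 3 * W z) = (- 2 * sqrt (H z)) * (K * (z ^ m - 1) * W z)"
        by (simp add: algebra_simps)
      also have "\<dots> = 2 * ?t z * ((z - 1) / z)" unfolding e th[OF z0] by simp
      also have "\<dots> = 2 * ?t z - 2 * ?t z / z" using z0 by (simp add: field_simps)
      finally show "2 / 3 * w' z * (H z * sqrt (H z)) + - (3 * K * (z ^ m - 1)) * sqrt (H z) * (2 / 3 * W z)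
          = (2 * ?t z + 2 / 3 * w' z * ?t z ^ 3) - 2 * ?t z / z" unfolding t3 by simp
    qed
    moreover have "\<forall>\<^sub>F x in nhds z. 2 / 3 * W x * (H x * sqrt (H x)) = \<Psi> x"
      using eventually_nhds_in_open[OF open_greaterThan, of z 0] z0
      by (auto elim!: eventually_mono simp: \<Psi>_def HX th)
    ultimately have "(\<Psi> has_real_derivative (2 * ?t z + 2 / 3 * w' z * ?t z ^ 3) - 2 * ?t z / z) (at z)"
      using DERIV_cong_ev[OF refl, of "\<lambda>z. 2 / 3 * W z * (H z * sqrt (H z))" \<Psi>] by simp
    then show "(\<Psi> has_vector_derivative (2 * ?t z + 2 / 3 * w' z * ?t z ^ 3) - 2 * ?t z / z) (at z)"
      by (simp add: has_real_derivative_iff_has_vector_derivative)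
  qed
  moreover have "\<Psi> (\<zeta> r) = 0" "\<Psi> (\<zeta> (- r)) = 0" using X_\<zeta>[of r] X_\<zeta>[of "- r"] r by (simp_all add: \<Psi>_def)
  ultimately have "integral ?I (\<lambda>z. (2 * ?t z + 2 / 3 * w' z * ?t z ^ 3) - 2 * ?t z / z) = 0"
    by (simp add: integral_unique)
  then have A: "A_int r = integral ?I (\<lambda>z. 2 * ?t z + 2 / 3 * w' z * ?t z ^ 3)"
    unfolding A_int_def using integral_diff[OF integrable_continuous_real[OF cD] integrable_continuous_real[OF integrands_continuous(1)[OF rin]]]
    by simp
  let ?g = "\<lambda>z. (ln (1 + ?t z) - ln (1 - ?t z)) - (2 * ?t z + 2 / 3 * w' z * ?t z ^ 3)"
  have BA: "B_int r - A_int r = integral ?I ?g"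
    unfolding A B_int_def
    by (rule integral_diff[symmetric]) (intro integrable_continuous_real integrands_continuous(2)[OF rin] cD)+
  have gc: "continuous_on ?I ?g" by (intro continuous_on_diff integrands_continuous(2)[OF rin] cD)
  have glow: "2 / 3 * (1 - w' z) * ?t z ^ 3 \<le> ?g z" if "z \<in> ?I" for z
  proof -
    have t: "0 \<le> ?t z" "?t z < 1" using height_bounds[OF rin that] r \<beta> by auto
    have "0 \<le> ?t z ^ 5" using t by simp
    moreover have "2 * s + 2 / 3 * u \<le> L" if "0 \<le> v" "2 * (s + u / 3 + v / 5) \<le> L" for s u v L :: real
      using that by (simp add: field_simps)
    ultimately have "2 * ?t z + 2 / 3 * ?t z ^ 3 \<le> ln (1 + ?t z) - ln (1 - ?t z)" using ln_ratio_lower[OF t] by blast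
    moreover have "2 / 3 * (1 - w' z) * ?t z ^ 3 + (2 * ?t z + 2 / 3 * w' z * ?t z ^ 3) = 2 * ?t z + 2 / 3 * ?t z ^ 3"
      by (simp add: field_simps)
    ultimately show ?thesis unfolding le_diff_eq by (simp only:)
  qed
  have gn: "0 \<le> ?g z" if "z \<in> ?I" for z
  proof -
    have "0 \<le> 2 / 3 * (1 - w' z) * ?t z ^ 3"
      using w'lt[OF that] height_bounds(1)[OF rin that] by (intro mult_nonneg_nonneg) auto
    then show ?thesis using glow[OF that] by linarith
  qed
  have "0 \<le> integral ?I ?g" by (rule integral_nonneg[OF integrable_continuous_real[OF gc] gn])
  moreover have "integral ?I ?g \<noteq> 0"
  proof
    assume "integral ?I ?g = 0"
    then have "?g 1 = 0" using integral_eq_0_iff[OF gc _ gn] lt by auto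
    moreover have "?t 1 = r" using X_\<zeta>[of 0] r \<beta> \<zeta>0 by (simp add: height_def)
    moreover have "2 / 3 * (1 - w' 1) * r ^ 3 > 0" using w'1 r by simp
    ultimately show False using glow[of 1] lt by simp
  qed
  ultimately have "A_int r < B_int r" using BA by simp
  then have "A_int r / B_int r < 1" using B_int_pos[OF rin] by simp
  then show ?thesis using that r by blast
qed

end

section \<open>The limit of steep walls\<close>

text \<open>Two requirements meet here. In the limit of steep walls the ratio exceeds 1 for small radii if \<open>K < 1\<close>; and
  it falls below 1 near \<open>r = 1\<close> if \<open>K\<close> is not too small. The choice \<open>K = (49 / 50)\<^sup>2\<close> makes the arctangent at
  \<open>r = 49 / 50\<close> an arctangent of 1.\<close>

definition K0 :: real where "K0 = (49 / 50)\<^sup>2"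

text \<open>The height in terms of the potential, extended by 0 beyond the orbit; this puts the integrals for all \<open>m\<close> over
  one fixed interval. The integrand of \<open>A - B\<close> at height \<open>s\<close> is \<open>strip_integrand s\<close>.\<close>

definition section_height :: "nat \<Rightarrow> real \<Rightarrow> real \<Rightarrow> real" where
  "section_height m r z = sqrt (max 0 (r\<^sup>2 - 2 * K0 * potential m z))"

definition strip_integrand :: "real \<Rightarrow> real \<Rightarrow> real" where
  "strip_integrand s z = 2 * s / z - (ln (1 + s) - ln (1 - s))"

lemma K0_pos: "K0 > 0" by (simp add: K0_def)

text \<open>Hence the orbits with \<open>r < 1\<close> lie over the interval \<open>(1 / 4, 2)\<close>, for all these \<open>m\<close> at once.\<close>

lemma energy_root_ends:
  assumes m: "m \<ge> 4"
  shows "energy_root K0 m (1 / 4) \<le> - 1" "1 \<le> energy_root K0 m 2"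
proof -
  have m1: "m \<ge> 1" using m by simp
  have n: "real (Suc m) \<ge> 5" using m by simp
  have p: "2 ^ Suc m \<ge> 4 * real (Suc m)" using m by (induction m rule: nat_induct_at_least) auto
  have "0 \<le> (1 / 4) ^ Suc m / real (Suc m)" by simp
  moreover have "potential m (1 / 4) = (1 / 4) ^ Suc m / real (Suc m) - 1 / real (Suc m) + 3 / 4"
    unfolding potential_def diff_divide_distrib by simp
  moreover have "1 / real (Suc m) \<le> 1 / 5" using n by (intro divide_left_mono) auto
  ultimately have "potential m (1 / 4) \<ge> 11 / 20" by linarith
  then have "(energy_root K0 m (1 / 4))\<^sup>2 \<ge> 1"
    using energy_root_squared[OF K0_pos m1, of "1 / 4"] by (simp add: K0_def power2_eq_square)
  then have "\<bar>energy_root K0 m (1 / 4)\<bar> \<ge> 1" using abs_le_square_iff[of 1 "energy_root K0 m (1 / 4)"] by simp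
  moreover have "energy_root K0 m (1 / 4) \<le> 0"
    using potential_quot_pos[of "1 / 4" m] m1 K0_pos unfolding energy_root_def by (intro mult_nonpos_nonneg) auto
  ultimately show "energy_root K0 m (1 / 4) \<le> - 1" by simp
  have "(2 ^ Suc m - 1) / real (Suc m) \<ge> (4 * real (Suc m) - real (Suc m)) / real (Suc m)"
    using p n by (intro divide_right_mono) auto
  moreover have "(4 * N - N) / N = 3" if "N \<ge> 5" for N :: real using that by simp
  note this[OF n]
  moreover have "potential m 2 = (2 ^ Suc m - 1) / real (Suc m) - 1" by (simp add: potential_def)
  ultimately have "potential m 2 \<ge> 2" by linarith
  then have "(energy_root K0 m 2)\<^sup>2 \<ge> 1"
    using energy_root_squared[OF K0_pos m1, of 2] by (simp add: K0_def power2_eq_square)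
  then have "\<bar>energy_root K0 m 2\<bar> \<ge> 1" using abs_le_square_iff[of 1 "energy_root K0 m 2"] by simp
  moreover have "energy_root K0 m 2 \<ge> 0"
    using potential_quot_pos[of 2 m] m1 K0_pos unfolding energy_root_def by (intro mult_nonneg_nonneg) auto
  ultimately show "1 \<le> energy_root K0 m 2" by simp
qed

lemma window_integral:
  fixes \<phi> :: "real \<Rightarrow> real \<Rightarrow> real"
  assumes m: "m \<ge> 4" and r: "0 < r" "r < 1" and z: "\<And>z. \<phi> 0 z = 0"
    and ec: "energy_coordinate K0 1 m (energy_root K0 m) \<zeta> \<zeta>1 \<zeta>2"
  shows "integral {\<zeta> (- r)..\<zeta> r} (\<lambda>z. \<phi> (energy_coordinate.height (energy_root K0 m) r z) z)
      = integral {1 / 4..2} (\<lambda>z. \<phi> (section_height m r z) z)"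
proof -
  interpret energy_coordinate K0 1 m "energy_root K0 m" \<zeta> \<zeta>1 \<zeta>2 by (rule ec)
  have m1: "m \<ge> 1" using m by simp
  let ?X = "energy_root K0 m" and ?S = "{\<zeta> (- r)..\<zeta> r}" and ?T = "{1 / 4..2::real}"
  note mono = energy_root_strict_mono[OF K0_pos m1]
  have \<zeta>p: "\<zeta> r > 0" "\<zeta> (- r) > 0" and X\<zeta>: "?X (\<zeta> r) = r" "?X (\<zeta> (- r)) = - r"
    using r \<zeta>_pos X_\<zeta> by auto
  have "1 / 4 \<le> \<zeta> (- r)"
  proof (rule ccontr)
    assume "\<not> ?thesis"
    then have "?X (\<zeta> (- r)) < ?X (1 / 4)" using mono[OF \<zeta>p(2), of "1 / 4"] by simp
    then show False using energy_root_ends(1)[OF m] X\<zeta> r by simp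
  qed
  moreover have "\<zeta> r \<le> 2"
  proof (rule ccontr)
    assume "\<not> ?thesis"
    then have "?X 2 < ?X (\<zeta> r)" using mono[of 2 "\<zeta> r"] by simp
    then show False using energy_root_ends(2)[OF m] X\<zeta> r by simp
  qed
  ultimately have ST: "?S \<subseteq> ?T" by auto
  have "integral ?S (\<lambda>z. \<phi> (height r z) z) = integral ?T (\<lambda>z. if z \<in> ?S then \<phi> (height r z) z else 0)"
    by (simp only: integral_restrict_Int Int_absorb2[OF ST])
  also have "\<dots> = integral ?T (\<lambda>z. \<phi> (section_height m r z) z)"
  proof (rule integral_cong)
    fix w assume "w \<in> ?T"
    then have w: "w > 0" by simp
    have X2: "(?X w)\<^sup>2 = 2 * K0 * potential m w" by (rule energy_root_squared[OF K0_pos m1 w])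
    show "(if w \<in> ?S then \<phi> (height r w) w else 0) = \<phi> (section_height m r w) w"
    proof (cases "w \<in> ?S")
      case True
      then have "0 \<le> r\<^sup>2 - (?X w)\<^sup>2" using \<zeta>_range(2)[of r w] r by (simp add: abs_le_square_iff[symmetric])
      then show ?thesis using True by (simp add: height_def section_height_def X2)
    next
      case False
      then consider "w < \<zeta> (- r)" | "\<zeta> r < w" by fastforce
      then have "\<bar>?X w\<bar> > r"
      proof cases
        case 1
        then show ?thesis using mono[OF w 1] X\<zeta> by linarith
      next
        case 2
        then show ?thesis using mono[OF \<zeta>p(1) 2] X\<zeta> by linarith
      qed
      then have "r\<^sup>2 < \<bar>?X w\<bar>\<^sup>2" using r by (intro power_strict_mono) auto
      then have "r\<^sup>2 - (?X w)\<^sup>2 < 0" by simp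
      then have "section_height m r w = 0" unfolding section_height_def X2 by simp
      then show ?thesis using False z by auto
    qed
  qed
  finally show ?thesis .
qed

lemma potential_nonneg: "z > 0 \<Longrightarrow> m \<ge> 1 \<Longrightarrow> potential m z \<ge> 0"
  using potential_quot_pos[of z m] by (simp add: potential_eq)

lemma section_height_bounds:
  assumes "z > 0" "m \<ge> 1" "0 < r"
  shows "0 \<le> section_height m r z" "section_height m r z \<le> r"
proof -
  show "0 \<le> section_height m r z" by (simp add: section_height_def)
  have "max 0 (r\<^sup>2 - 2 * K0 * potential m z) \<le> r\<^sup>2"
    using potential_nonneg[OF assms(1,2)] K0_pos by simp
  then show "section_height m r z \<le> r"
    unfolding section_height_def using assms(3) by (intro real_le_lsqrt) auto
qed

text \<open>The limit of the heights as \<open>m\<close> tends to infinity: to the left of the wall the potential is \<open>1 - z\<close>.\<close>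

definition wall_height :: "real \<Rightarrow> real \<Rightarrow> real" where
  "wall_height r z = (if z \<le> 1 then sqrt (max 0 (r\<^sup>2 - 2 * K0 * (1 - z))) else 0)"

lemma section_height_tendsto:
  assumes "z > 0"
  shows "(\<lambda>m. section_height m r z) \<longlonglongrightarrow> wall_height r z"
proof (cases "z < 1")
  case True
  have "(\<lambda>m. (z ^ Suc m - 1) * inverse (real (Suc m)) - (z - 1)) \<longlonglongrightarrow> (0 - 1) * 0 - (z - 1)"
    by (intro tendsto_intros LIMSEQ_inverse_real_of_nat LIMSEQ_Suc[OF LIMSEQ_power_zero]) (use assms True in auto)
  then have "(\<lambda>m. potential m z) \<longlonglongrightarrow> 1 - z" by (simp add: potential_def[abs_def] divide_inverse)
  then have "(\<lambda>m. section_height m r z) \<longlonglongrightarrow> sqrt (max 0 (r\<^sup>2 - 2 * K0 * (1 - z)))"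
    unfolding section_height_def by (intro tendsto_intros)
  then show ?thesis using True by (simp add: wall_height_def)
next
  case False
  show ?thesis
  proof (cases "z = 1")
    case True
    then show ?thesis by (simp add: section_height_def wall_height_def potential_def)
  next
    case z: False
    have "z > 1" using False z by simp
    then have "filterlim (\<lambda>m. (z ^ Suc m - 1) / real (Suc m) - (z - 1)) at_top sequentially" by real_asymp
    then have "\<forall>\<^sub>F m in sequentially. r\<^sup>2 / (2 * K0) \<le> potential m z"
      unfolding potential_def filterlim_at_top by blast
    then have "\<forall>\<^sub>F m in sequentially. section_height m r z = wall_height r z"
      using \<open>z > 1\<close> K0_pos by (auto elim!: eventually_mono simp: section_height_def wall_height_def divide_le_eq mult_ac)
    then show ?thesis by (rule tendsto_eventually)
  qed
qed

lemma wall_height_bounds: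
  assumes "0 < r"
  shows "0 \<le> wall_height r z" "wall_height r z \<le> r"
proof -
  have "max 0 (r\<^sup>2 - 2 * K0 * (1 - z)) \<le> r\<^sup>2" if "z \<le> 1" using that K0_pos by simp
  then show "wall_height r z \<le> r"
    unfolding wall_height_def using assms by (auto intro!: real_le_lsqrt)
qed (simp add: wall_height_def)

lemma strip_integral_tendsto:
  assumes r: "0 < r" "r < 1"
  shows "(\<lambda>m. integral {1 / 4..2} (\<lambda>z. strip_integrand (section_height (m + 4) r z) z))
     \<longlonglongrightarrow> integral {1 / 4..2} (\<lambda>z. strip_integrand (wall_height r z) z)"
proof (rule dominated_convergence(2))
  let ?T = "{1 / 4..2::real}"
  have sb: "0 \<le> section_height (m + 4) r z" "section_height (m + 4) r z \<le> r" if "z \<in> ?T" for m z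
    using section_height_bounds[of z "m + 4" r] that r by auto
  show "(\<lambda>z. strip_integrand (section_height (m + 4) r z) z) integrable_on ?T" for m
  proof (rule integrable_continuous_real)
    have c: "continuous_on ?T (section_height (m + 4) r)"
      unfolding section_height_def potential_def by (intro continuous_intros) auto
    show "continuous_on ?T (\<lambda>z. strip_integrand (section_height (m + 4) r z) z)"
      unfolding strip_integrand_def
    proof (intro continuous_intros c ballI)
      fix z assume z: "z \<in> ?T"
      show "z \<noteq> 0" using z by auto
      show "1 + section_height (m + 4) r z \<noteq> 0" "1 - section_height (m + 4) r z \<noteq> 0"
        using sb[OF z, of m] r by auto
    qed
  qed
  show "(\<lambda>z. 8 + 2 / (1 - r)) integrable_on ?T" by (rule integrable_const_ivl)
  fix m z assume z: "z \<in> ?T"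
  let ?s = "section_height (m + 4) r z"
  have s: "0 \<le> ?s" "?s \<le> r" by (rule sb[OF z])+
  have "0 \<le> 2 * ?s / z" using s z by simp
  moreover have "2 * ?s / z \<le> 2 / (1 / 4)" using s z r by (intro frac_le) auto
  moreover have "0 \<le> ln (1 + ?s) - ln (1 - ?s)" using s r by simp
  moreover have "ln (1 + ?s) - ln (1 - ?s) \<le> 2 * ?s / (1 - ?s)" using s r by (intro ln_ratio_upper) auto
  moreover have "2 * ?s / (1 - ?s) \<le> 2 / (1 - r)" using s r by (intro frac_le) auto
  ultimately show "norm (strip_integrand ?s z) \<le> 8 + 2 / (1 - r)"
    unfolding strip_integrand_def by (simp add: abs_le_iff)
next
  fix z :: real assume z: "z \<in> {1 / 4..2}"
  have "(\<lambda>m. section_height (m + 4) r z) \<longlonglongrightarrow> wall_height r z"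
    by (rule LIMSEQ_ignore_initial_segment[OF section_height_tendsto]) (use z in simp)
  then show "(\<lambda>m. strip_integrand (section_height (m + 4) r z) z) \<longlonglongrightarrow> strip_integrand (wall_height r z) z"
    unfolding strip_integrand_def using wall_height_bounds[OF r(1), of z] r z
    by (intro tendsto_intros) auto
qed

text \<open>Substituting the height \<open>s\<close> for \<open>z\<close>, for which \<open>2 * K0 * z = \<mu>\<^sup>2 + s\<^sup>2\<close>, makes the integral elementary; this is
  the primitive that vanishes at 0.\<close>

definition wall_value :: "real \<Rightarrow> real \<Rightarrow> real" where
  "wall_value \<mu> s = 4 * (s - \<mu> * arctan (s / \<mu>)) - (s - (1 - s\<^sup>2) * (ln (1 + s) - ln (1 - s)) / 2) / K0"

lemma wall_integral:
  assumes r: "0 < r" "r \<le> 49 / 50" and \<mu>: "\<mu> > 0" "\<mu>\<^sup>2 = 2 * K0 - r\<^sup>2"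
  shows "integral {1 / 4..2} (\<lambda>z. strip_integrand (wall_height r z) z) = wall_value \<mu> r"
proof -
  define s0 where "s0 = 1 - r\<^sup>2 / (2 * K0)"
  have r2: "r\<^sup>2 \<le> K0" unfolding K0_def using r by (intro power_mono) auto
  have s0: "1 / 4 \<le> s0" "s0 < 1" using r2 r K0_pos by (auto simp: s0_def field_simps)
  define t where "t = (\<lambda>z. sqrt (r\<^sup>2 - 2 * K0 * (1 - z)))"
  have arg: "r\<^sup>2 - 2 * K0 * (1 - z) = 2 * K0 * (z - s0)" for z using K0_pos by (simp add: s0_def field_simps)
  have ends: "t s0 = 0" "t 1 = r" using r by (simp add: t_def arg, simp add: t_def)
  have tb: "0 \<le> t z" "t z \<le> r" if "z \<in> {s0..1}" for z
  proof -
    show "0 \<le> t z" using that K0_pos by (simp add: t_def arg)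
    have "r\<^sup>2 - 2 * K0 * (1 - z) \<le> r\<^sup>2" using that K0_pos by simp
    then show "t z \<le> r" unfolding t_def using r by (simp add: real_le_lsqrt)
  qed
  have tc: "continuous_on {s0..1} t" unfolding t_def by (intro continuous_intros)
  have dV: "(wall_value \<mu> has_real_derivative 4 * (s\<^sup>2 / (\<mu>\<^sup>2 + s\<^sup>2)) - s * (ln (1 + s) - ln (1 - s)) / K0) (at s)"
    if s: "0 < s" "s < 1" for s
  proof -
    have a: "((\<lambda>s. s - \<mu> * arctan (s / \<mu>)) has_real_derivative s\<^sup>2 / (\<mu>\<^sup>2 + s\<^sup>2)) (at s)"
    proof -
      have i: "((\<lambda>s. s / \<mu>) has_real_derivative 1 / \<mu>) (at s)" by (rule DERIV_cdivide[OF DERIV_ident])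
      have "((\<lambda>s. s - \<mu> * arctan (s / \<mu>)) has_real_derivative 1 - \<mu> * (inverse (1 + (s / \<mu>)\<^sup>2) * (1 / \<mu>))) (at s)"
        by (intro DERIV_diff DERIV_ident DERIV_cmult DERIV_chain'[OF i DERIV_arctan])
      moreover have "1 - \<mu> * (inverse (1 + (s / \<mu>)\<^sup>2) * (1 / \<mu>)) = s\<^sup>2 / (\<mu>\<^sup>2 + s\<^sup>2)"
      proof -
        have pos: "\<mu>\<^sup>2 + s\<^sup>2 > 0" "\<mu>\<^sup>2 > 0" using \<mu>(1) by (auto intro: add_pos_nonneg)
        have "\<mu> \<noteq> 0" using \<mu>(1) by simp
        then have "1 + (s / \<mu>)\<^sup>2 = (\<mu>\<^sup>2 + s\<^sup>2) / \<mu>\<^sup>2" by (simp add: power_divide add_divide_distrib)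
        then have "inverse (1 + (s / \<mu>)\<^sup>2) = \<mu>\<^sup>2 / (\<mu>\<^sup>2 + s\<^sup>2)" by simp
        then have "\<mu> * (inverse (1 + (s / \<mu>)\<^sup>2) * (1 / \<mu>)) = \<mu>\<^sup>2 / (\<mu>\<^sup>2 + s\<^sup>2)" using \<mu>(1) by simp
        moreover have "1 - x / (x + y) = y / (x + y)" if "x + y > 0" for x y :: real using that by (simp add: field_simps)
        ultimately show ?thesis using pos(1) by simp
      qed
      ultimately show ?thesis by simp
    qed
    have l: "((\<lambda>s. ln (1 + s) - ln (1 - s)) has_real_derivative 1 / (1 + s) + 1 / (1 - s)) (at s)"
      using s by (auto intro!: derivative_eq_intros)
    have q: "((\<lambda>s. 1 - s\<^sup>2) has_real_derivative - 2 * s) (at s)" by (auto intro!: derivative_eq_intros)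
    have b: "((\<lambda>s. s - (1 - s\<^sup>2) * (ln (1 + s) - ln (1 - s)) / 2) has_real_derivative s * (ln (1 + s) - ln (1 - s))) (at s)"
    proof (rule DERIV_cong[OF DERIV_diff[OF DERIV_ident DERIV_cdivide[OF DERIV_mult[OF q l]]]])
      have "1 / (1 + s) + 1 / (1 - s) = 2 / ((1 + s) * (1 - s))" using s by (simp add: divide_simps)
      moreover have "(1 + s) * (1 - s) = 1 - s\<^sup>2" by (simp add: algebra_simps power2_eq_square)
      moreover have "1 - s\<^sup>2 > 0" using s by (simp add: power_less_one_iff)
      moreover have "2 / x * x = 2" if "x > 0" for x :: real using that by simp
      ultimately have e: "(1 / (1 + s) + 1 / (1 - s)) * (1 - s\<^sup>2) = 2" by (simp only:)
      show "1 - (- 2 * s * (ln (1 + s) - ln (1 - s)) + (1 / (1 + s) + 1 / (1 - s)) * (1 - s\<^sup>2)) / 2 = s * (ln (1 + s) - ln (1 - s))"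
        unfolding e by (simp add: field_simps)
    qed
    show ?thesis unfolding wall_value_def[abs_def]
      by (rule DERIV_diff[OF DERIV_cmult[OF a] DERIV_cdivide[OF b]])
  qed
  have Vc: "continuous_on {0..r} (wall_value \<mu>)"
    unfolding wall_value_def[abs_def] by (intro continuous_intros) (use r \<mu> K0_pos in auto)
  have "((\<lambda>z. strip_integrand (t z) z) has_integral wall_value \<mu> (t 1) - wall_value \<mu> (t s0)) {s0..1}"
  proof (rule fundamental_theorem_of_calculus_interior)
    show "s0 \<le> 1" using s0 by simp
    show "continuous_on {s0..1} (\<lambda>z. wall_value \<mu> (t z))"
      by (rule continuous_on_compose2[OF Vc tc]) (use tb in auto)
    fix z assume z: "z \<in> {s0<..<1}"
    have zp: "z > 0" using z s0 by auto
    have ap: "r\<^sup>2 - 2 * K0 * (1 - z) > 0" using z K0_pos by (simp add: arg)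
    have tp: "t z > 0" "(t z)\<^sup>2 = r\<^sup>2 - 2 * K0 * (1 - z)" using ap by (auto simp: t_def)
    have t1: "t z < 1" using tb(2)[of z] z r by auto
    have dt: "(t has_real_derivative K0 / t z) (at z)"
    proof -
      have "((\<lambda>z. r\<^sup>2 - 2 * K0 * (1 - z)) has_real_derivative 2 * K0) (at z)" by (auto intro!: derivative_eq_intros)
      from DERIV_chain'[OF this DERIV_real_sqrt[OF ap]] show ?thesis
        unfolding t_def by (rule DERIV_cong) (simp add: field_simps)
    qed
    have "\<mu>\<^sup>2 + (t z)\<^sup>2 = 2 * K0 * z" unfolding tp(2) \<mu>(2) by (simp add: algebra_simps)
    then have "(4 * ((t z)\<^sup>2 / (\<mu>\<^sup>2 + (t z)\<^sup>2)) - t z * (ln (1 + t z) - ln (1 - t z)) / K0) * (K0 / t z) = strip_integrand (t z) z"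
      using tp(1) K0_pos zp by (simp add: strip_integrand_def field_simps power2_eq_square)
    with DERIV_chain'[OF dt dV[OF tp(1) t1]]
    show "((\<lambda>z. wall_value \<mu> (t z)) has_vector_derivative strip_integrand (t z) z) (at z)"
      by (simp add: has_real_derivative_iff_has_vector_derivative)
  qed
  moreover have "wall_value \<mu> (t 1) - wall_value \<mu> (t s0) = wall_value \<mu> r" unfolding ends by (simp add: wall_value_def)
  ultimately have "((\<lambda>z. if z \<in> {s0..1} then strip_integrand (t z) z else 0) has_integral wall_value \<mu> r) {1 / 4..2}"
    using s0(1) by (intro iffD2[OF has_integral_restrict]) auto
  then have "((\<lambda>z. strip_integrand (wall_height r z) z) has_integral wall_value \<mu> r) {1 / 4..2}"
  proof (rule has_integral_eq[rotated])
    fix z :: real assume "z \<in> {1 / 4..2}"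
    show "(if z \<in> {s0..1} then strip_integrand (t z) z else 0) = strip_integrand (wall_height r z) z"
    proof (cases "z \<in> {s0..1}")
      case True
      then have "wall_height r z = t z" using K0_pos by (simp add: wall_height_def t_def arg)
      then show ?thesis using True by simp
    next
      case False
      have "wall_height r z = 0"
      proof (cases "z \<le> 1")
        case True
        then have "2 * K0 * (z - s0) \<le> 0" using False K0_pos by (intro mult_nonneg_nonpos) auto
        then show ?thesis by (simp add: wall_height_def arg)
      qed (simp add: wall_height_def)
      then show ?thesis using False by (auto simp: strip_integrand_def)
    qed
  qed
  then show ?thesis by (rule integral_unique)
qed

text \<open>To leading order the value is \<open>2 / 15 * r ^ 5 * (1 / K0 - 1) / K0\<close>. At \<open>r = 1 / 10\<close> the series to fifth order
  decide the sign.\<close>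

lemma wall_value_small: "\<mu> > 0 \<Longrightarrow> \<mu>\<^sup>2 = 2 * K0 - (1 / 10)\<^sup>2 \<Longrightarrow> wall_value \<mu> (1 / 10) > 0"
proof -
  assume \<mu>: "\<mu> > 0" "\<mu>\<^sup>2 = 2 * K0 - (1 / 10)\<^sup>2"
  let ?r = "1 / 10 :: real"
  have \<mu>2: "\<mu>\<^sup>2 = 4777 / 2500" unfolding \<mu>(2) by (simp add: K0_def power2_eq_square)
  have \<mu>4: "\<mu> ^ 4 = (4777 / 2500)\<^sup>2" unfolding \<mu>2[symmetric] by simp
  have "arctan (?r / \<mu>) \<le> ?r / \<mu> - (?r / \<mu>) ^ 3 / 3 + (?r / \<mu>) ^ 5 / 5" using \<mu>(1) by (intro arctan_upper) simp
  then have "\<mu> * arctan (?r / \<mu>) \<le> \<mu> * (?r / \<mu> - (?r / \<mu>) ^ 3 / 3 + (?r / \<mu>) ^ 5 / 5)" using \<mu>(1) by (intro mult_left_mono) auto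
  also have "\<dots> = ?r - ?r ^ 3 / (3 * \<mu>\<^sup>2) + ?r ^ 5 / (5 * \<mu> ^ 4)"
    using \<mu>(1) by (simp add: power_divide field_simps power_numeral_reduce)
  finally have a: "\<mu> * arctan (?r / \<mu>) \<le> ?r - ?r ^ 3 / (3 * \<mu>\<^sup>2) + ?r ^ 5 / (5 * \<mu> ^ 4)" .
  have l: "2 * (?r + ?r ^ 3 / 3 + ?r ^ 5 / 5) \<le> ln (1 + ?r) - ln (1 - ?r)" by (rule ln_ratio_lower) auto
  have "(?r - (1 - ?r\<^sup>2) * (ln (1 + ?r) - ln (1 - ?r)) / 2) / K0 \<le> (?r - (1 - ?r\<^sup>2) * (2 * (?r + ?r ^ 3 / 3 + ?r ^ 5 / 5)) / 2) / K0"
    using K0_pos l by (intro divide_right_mono diff_left_mono mult_left_mono) (auto simp: power2_eq_square)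
  also have "\<dots> < 4 * (?r - (?r - ?r ^ 3 / (3 * \<mu>\<^sup>2) + ?r ^ 5 / (5 * \<mu> ^ 4)))"
    unfolding \<mu>2 \<mu>4 K0_def by (simp add: power_numeral_reduce)
  also have "\<dots> \<le> 4 * (?r - \<mu> * arctan (?r / \<mu>))" using a by simp
  finally show ?thesis by (simp add: wall_value_def)
qed

lemma pi_gt_31: "pi > 31 / 10"
proof -
  have "(1 / 7 :: real) - (1 / 7) ^ 3 / 3 \<le> arctan (1 / 7)" "(3 / 79 :: real) - (3 / 79) ^ 3 / 3 \<le> arctan (3 / 79)"
    by (intro arctan_lower; simp)+
  moreover have "5 * ((1 / 7 :: real) - (1 / 7) ^ 3 / 3) + 2 * ((3 / 79 :: real) - (3 / 79) ^ 3 / 3) > 31 / 40"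
    by (simp add: power3_eq_cube)
  moreover have "31 / 10 < p" if "x \<le> a" "y \<le> b" "5 * x + 2 * y > 31 / 40" "5 * a + 2 * b = p / 4" for x y a b p :: real
    using that by linarith
  ultimately show ?thesis using machin_Euler by blast
qed

lemma wall_value_large: "wall_value (49 / 50) (49 / 50) < 0"
proof -
  have "(1 + 5 / real 50) ^ 50 \<le> exp (5::real)" by (rule exp_ge_one_plus_x_over_n_power_n) auto
  moreover have "(99::real) < (11 / 10) ^ 50" by (simp add: power_divide)
  moreover have "1 + 5 / real 50 = 11 / 10" by simp
  ultimately have "99 < exp (5::real)" by (simp only:)
  then have "ln 99 < (5::real)" using ln_less_cancel_iff[of 99 "exp 5"] by simp
  moreover have "ln (1 + 49 / 50) - ln (1 - 49 / 50 :: real) = ln 99"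
    using ln_div[of "99 / 50" "1 / 50 :: real"] by simp
  ultimately have l: "ln (1 + 49 / 50) - ln (1 - 49 / 50 :: real) < 5" by simp
  have "(49 / 50 - (1 - (49 / 50)\<^sup>2) * 5 / 2) / K0 \<le> (49 / 50 - (1 - (49 / 50)\<^sup>2) * (ln (1 + 49 / 50) - ln (1 - 49 / 50)) / 2) / K0"
    using K0_pos l by (intro divide_right_mono diff_left_mono mult_left_mono) (auto simp: power2_eq_square)
  moreover have "4 * (49 / 50 - 49 / 50 * (31 / 40)) < (49 / 50 - (1 - (49 / 50 :: real)\<^sup>2) * 5 / 2) / K0"
    by (simp add: K0_def power2_eq_square)
  moreover have "4 * (49 / 50 - 49 / 50 * (pi / 4)) < 4 * (49 / 50 - 49 / 50 * (31 / 40))" using pi_gt_31 by simp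
  moreover have "wall_value (49 / 50) (49 / 50) = 4 * (49 / 50 - 49 / 50 * (pi / 4)) -
      (49 / 50 - (1 - (49 / 50)\<^sup>2) * (ln (1 + 49 / 50) - ln (1 - 49 / 50)) / 2) / K0"
    unfolding wall_value_def using arctan_one by simp
  moreover have "w < 0" if "p \<le> q" "c < p" "d < c" "w = d - q" for w p q c d :: real using that by simp
  ultimately show ?thesis by blast
qed

lemma steep_walls:
  obtains m where "m \<ge> 4"
    "integral {1 / 4..2} (\<lambda>z. strip_integrand (section_height m (1 / 10) z) z) > 0"
    "integral {1 / 4..2} (\<lambda>z. strip_integrand (section_height m (49 / 50) z) z) < 0"
proof -
  have p: "2 * K0 - (1 / 10)\<^sup>2 > 0" by (simp add: K0_def power2_eq_square)
  let ?\<mu> = "sqrt (2 * K0 - (1 / 10)\<^sup>2)"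
  have \<mu>: "?\<mu> > 0" "?\<mu>\<^sup>2 = 2 * K0 - (1 / 10)\<^sup>2" using p by auto
  have "integral {1 / 4..2} (\<lambda>z. strip_integrand (wall_height (1 / 10) z) z) > 0"
    using wall_integral[OF _ _ \<mu>] wall_value_small[OF \<mu>] by simp
  moreover have "integral {1 / 4..2} (\<lambda>z. strip_integrand (wall_height (49 / 50) z) z) < 0"
    using wall_integral[of "49 / 50" "49 / 50"] wall_value_large by (simp add: K0_def)
  ultimately have "\<forall>\<^sub>F m in sequentially. integral {1 / 4..2} (\<lambda>z. strip_integrand (section_height (m + 4) (1 / 10) z) z) > 0 \<and>
      integral {1 / 4..2} (\<lambda>z. strip_integrand (section_height (m + 4) (49 / 50) z) z) < 0"
    using order_tendstoD(1)[OF strip_integral_tendsto[of "1 / 10"]] order_tendstoD(2)[OF strip_integral_tendsto[of "49 / 50"]]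
    by (intro eventually_conj) auto
  then obtain m where "integral {1 / 4..2} (\<lambda>z. strip_integrand (section_height (m + 4) (1 / 10) z) z) > 0"
      "integral {1 / 4..2} (\<lambda>z. strip_integrand (section_height (m + 4) (49 / 50) z) z) < 0"
    using eventually_happens'[OF sequentially_bot] by blast
  then show ?thesis using that[of "m + 4"] by simp
qed

section \<open>Three limit cycles\<close>

theorem mainTheorem4:
  "\<exists>F. planar_S_system F \<and>
     (\<exists>\<Gamma>1 \<Gamma>2 \<Gamma>3.
        \<Gamma>1 \<noteq> \<Gamma>2 \<and> \<Gamma>1 \<noteq> \<Gamma>3 \<and> \<Gamma>2 \<noteq> \<Gamma>3 \<and>
        stable_limit_cycle F \<Gamma>1 \<and> stable_limit_cycle F \<Gamma>2 \<and>
        unstable_limit_cycle F \<Gamma>3)"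
proof -
  obtain m where m: "m \<ge> 4"
    "integral {1 / 4..2} (\<lambda>z. strip_integrand (section_height m (1 / 10) z) z) > 0"
    "integral {1 / 4..2} (\<lambda>z. strip_integrand (section_height m (49 / 50) z) z) < 0"
    using steep_walls by blast
  have m1: "m \<ge> 1" using m by simp
  obtain \<zeta> \<zeta>1 \<zeta>2 where ec: "energy_coordinate K0 1 m (energy_root K0 m) \<zeta> \<zeta>1 \<zeta>2"
    using energy_coordinate_energy_root[OF K0_pos m1 energy_root_ends[OF m(1)]] by auto
  interpret energy_coordinate K0 1 m "energy_root K0 m" \<zeta> \<zeta>1 \<zeta>2 by (rule ec)
  have diff: "A_int r - B_int r = integral {1 / 4..2} (\<lambda>z. strip_integrand (section_height m r z) z)"
    if r: "0 < r" "r < 1" for r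
  proof -
    have "A_int r - B_int r = integral {\<zeta> (- r)..\<zeta> r} (\<lambda>z. strip_integrand (height r z) z)"
      unfolding A_int_def B_int_def strip_integrand_def
      by (rule integral_diff[symmetric]) (intro integrable_continuous_real integrands_continuous; use r in simp)+
    then show ?thesis using window_integral[OF m(1) r _ ec, of strip_integrand] by (simp add: strip_integrand_def)
  qed
  have \<zeta>0: "\<zeta> 0 = 1"
    using \<zeta>_X[of 1] by (simp add: energy_root_def)
  have "A_int (1 / 10) > B_int (1 / 10)" using diff[of "1 / 10"] m(2) by simp
  then have q2: "A_int (1 / 10) / B_int (1 / 10) > 1" using B_int_pos[of "1 / 10"] by simp
  have "A_int (49 / 50) < B_int (49 / 50)" using diff[of "49 / 50"] m(3) by simp
  then have q3: "A_int (49 / 50) / B_int (49 / 50) < 1" using B_int_pos[of "49 / 50"] by simp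
  have slow: "real m + 1 < 2 * K0 * real m" using m(1) by (simp add: K0_def power2_eq_square)
  obtain r1 where r1: "0 < r1" "r1 < 1 / 10" "A_int r1 / B_int r1 < 1"
    using ratio_below_one[OF \<zeta>0 energy_root_squared[OF K0_pos m1] potential_deriv m1 slow, of "1 / 10"] by auto
  define l h where "l = max (A_int r1 / B_int r1) (A_int (49 / 50) / B_int (49 / 50))" and "h = (l + 1) / 2"
  have lh: "l < h" "h < 1" using r1(3) q3 by (auto simp: l_def h_def max_def)
  obtain r0 where r0: "0 < r0" "r0 < r1" "h \<le> A_int r0 / B_int r0"
    using ratio_tends_to_one[OF \<zeta>0 lh(2) r1(1)] by auto
  show ?thesis
    by (rule three_limit_cycles[of r0 r1 "1 / 10" "49 / 50" l h]) (use r0 r1 lh q2 in \<open>auto simp: l_def\<close>)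
qed

end
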